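(* For all $(n,m)\in\mathbb{Z}^2$ and all $\theta\in(0,\pi)$, $${\rm P}_{-\frac16+n}^{\frac14+m}(\cos\theta)=2^{-2m-3n}\,\Gamma(\tfrac34-m)^{-1}\,(\sin\theta)^{-1/4-m}\,B_+^{1/4+3m+3n}\,r^m_n(B_-/B_+),$$ $${\rm P}_{-\frac16+n}^{-\frac14-m}(\cos\theta)=2^{-2m-3n}\,3^{3/4+3m}\,\Gamma(\tfrac54+m)^{-1}\,(\sin\theta)^{-1/4-m}\,B_-^{1/4+3m+3n}\,\hat r^m_n(B_+/B_-),$$ where ${\rm P}_\nu^\mu$ is the Ferrers function of the first kind, $B_\pm=B_\pm(\theta)$ are the positive functions $$B_\pm(\theta)=\cos(\theta/3)\pm\sqrt{\frac{4\cos^2(\theta/3)-1}{3}},$$ and $r^m_n$, $\hat r^m_n$ are the octahedral functions and their rescalings defined in the context.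
   Context: For $z\in(-1,1)$, the Ferrers function is ${\rm P}_\nu^\mu(z)=\frac1{\Gamma(1-\mu)}\left(\frac{1+z}{1-z}\right)^{\mu/2}{}_2F_1\!\left(-\nu,\nu+1;1-\mu;\frac{1-z}2\right)$, with ${}_2F_1$ the Gauss function. The rising factorial is extended to all integers $k$: $(d)_k=d(d+1)\cdots(d+k-1)$ for $k\ge0$ and $(d)_k=[(d-k')\cdots(d-1)]^{-1}$ for $k=-k'\le0$. Octahedral functions: let $p_{\rm v}(u)=u(1-u)^4$, $p_{\rm e}(u)=(1+u)(1-34u+u^2)$, $p_{\rm f}(u)=1+14u+u^2$, and $R(u)=-108\,p_{\rm v}(u)/p_{\rm e}(u)^2=1-p_{\rm f}(u)^3/p_{\rm e}(u)^2$. For $(n,m)\in\mathbb{Z}^2$, $r^m_n$ is the rational function of $u$ that on a neighborhood of $u=0$ satisfies $${}_2F_1\!\left(-\tfrac1{24}-\tfrac m2-\tfrac n2,\ \tfrac{11}{24}-\tfrac m2-\tfrac n2;\ \tfrac34-m;\ R(u)\right)=p_{\rm e}(u)^{-1/12-m-n}\,r^m_n(u)$$ (with powers of $p_{\rm e}(u)$ equal to $1$ at $u=0$). One has $r^m_n(0)=1$, and $r^m_n(u)\sim d^m_nu^{3n+2m}$ as $u\to\infty$, where $d^m_n=(-1)^{m+n}3^{3m}\frac{(5/12)_{m-n}(13/12)_{m+n}}{(1/4)_m(5/4)_m}$. The rescaled function is $\hat r^m_n:=r^m_n/d^m_n$. *)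

theory Defs
  imports "HOL-Analysis.Analysis" "HOL-Computational_Algebra.Computational_Algebra"
begin

(* The power series at 0, hence the Gauss function only for |z| < 1; this is the only range in
   which it is used below. *)
definition gauss_2F1 :: "real \<Rightarrow> real \<Rightarrow> real \<Rightarrow> real \<Rightarrow> real" where
  "gauss_2F1 a b c z = eval_fps (fps_hypergeo [a, b] [c] 1) z"

lemma gauss_2F1_altdef:
  "gauss_2F1 a b c z =
     (\<Sum>k. pochhammer a k * pochhammer b k / (pochhammer c k * fact k) * z ^ k)"
  by (simp add: gauss_2F1_def eval_fps_def)

(* For z in (-1,1) and 1 - \<mu> not a non-positive integer. *)
definition ferrers_P :: "real \<Rightarrow> real \<Rightarrow> real \<Rightarrow> real" where
  "ferrers_P \<nu> \<mu> z =
     1 / Gamma (1 - \<mu>) * ((1 + z) / (1 - z)) powr (\<mu> / 2) *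
     gauss_2F1 (- \<nu>) (\<nu> + 1) (1 - \<mu>) ((1 - z) / 2)"

(* For k = -k' < 0 this is 1 / ((d - k') ... (d - 1)). *)
definition rising_fact :: "real \<Rightarrow> int \<Rightarrow> real" where
  "rising_fact d k =
     (if k \<ge> 0 then pochhammer d (nat k)
      else inverse (pochhammer (d - real (nat (- k))) (nat (- k))))"

definition p_v :: "real \<Rightarrow> real" where
  "p_v u = u * (1 - u) ^ 4"

definition p_e :: "real \<Rightarrow> real" where
  "p_e u = (1 + u) * (1 - 34 * u + u\<^sup>2)"

definition p_f :: "real \<Rightarrow> real" where
  "p_f u = 1 + 14 * u + u\<^sup>2"

definition R_oct :: "real \<Rightarrow> real" where
  "R_oct u = - 108 * p_v u / (p_e u)\<^sup>2"

lemma R_oct_altdef: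
  assumes "p_e u \<noteq> 0"
  shows "R_oct u = 1 - (p_f u) ^ 3 / (p_e u)\<^sup>2"
proof -
  have "(p_e u)\<^sup>2 - (p_f u) ^ 3 = - 108 * p_v u"
    unfolding p_e_def p_f_def p_v_def by algebra
  with assms show ?thesis
    by (simp add: R_oct_def field_simps)
qed

(* The quotient is in lowest terms, so removable singularities are filled in and a rational
   function is determined by its germ at any point (with the HOL value 0 at its poles). *)
definition rational_fun :: "(real \<Rightarrow> real) \<Rightarrow> bool" where
  "rational_fun f \<longleftrightarrow>
     (\<exists>p q :: real poly. q \<noteq> 0 \<and> coprime p q \<and> (\<forall>u. f u = poly p u / poly q u))"

(* r_oct n m is r^m_n: the lower index comes first.  Near u = 0 one has p_e u > 0, and the real
   power below is the branch equal to 1 at u = 0.  The equation is required only near 0: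
   elsewhere r_oct n m is given by rationality. *)
definition r_oct :: "int \<Rightarrow> int \<Rightarrow> real \<Rightarrow> real" where
  "r_oct n m =
     (THE r. rational_fun r \<and>
        (\<forall>\<^sub>F u in nhds 0.
           gauss_2F1 (- 1/24 - real_of_int m / 2 - real_of_int n / 2)
                     (11/24 - real_of_int m / 2 - real_of_int n / 2)
                     (3/4 - real_of_int m) (R_oct u)
           = p_e u powr (- 1/12 - real_of_int m - real_of_int n) * r u))"

(* The coefficient in r^m_n(u) ~ d^m_n u^(3n+2m) as u tends to infinity. *)
definition d_oct :: "int \<Rightarrow> int \<Rightarrow> real" where
  "d_oct n m =
     (- 1) powi (m + n) * 3 powi (3 * m) *
     (rising_fact (5/12) (m - n) * rising_fact (13/12) (m + n)) /
     (rising_fact (1/4) m * rising_fact (5/4) m)"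

definition r_oct_hat :: "int \<Rightarrow> int \<Rightarrow> real \<Rightarrow> real" where
  "r_oct_hat n m u = r_oct n m u / d_oct n m"

definition B_plus :: "real \<Rightarrow> real" where
  "B_plus \<theta> = cos (\<theta> / 3) + sqrt ((4 * (cos (\<theta> / 3))\<^sup>2 - 1) / 3)"

definition B_minus :: "real \<Rightarrow> real" where
  "B_minus \<theta> = cos (\<theta> / 3) - sqrt ((4 * (cos (\<theta> / 3))\<^sup>2 - 1) / 3)"

end

theory Submission
  imports Defs "HOL-Real_Asymp.Real_Asymp"
begin

text \<open>
  Under \<open>u = B\<^sub>- / B\<^sub>+\<close> one has \<open>R_oct u = - (tan \<theta>)\<^sup>2\<close>, so a quadratic transformation relates the
  Ferrers function to the hypergeometric function that defines \<open>r_oct\<close>. Instead of that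
  transformation, which covers only \<open>\<bar>tan \<theta>\<bar> < 1\<close>, the proof uses the lattice structure. The shifts
  \<open>n \<rightarrow> n \<plusminus> 1\<close> and \<open>m \<rightarrow> m \<plusminus> 1\<close> of both functions are first-order differential operators (contiguous
  relations), and in the variable \<open>u\<close> they become the same operators on rational functions, for the
  germ at \<open>u = 0\<close> and for the Ferrers functions of order \<open>1/4 + m\<close> and \<open>- 1/4 - m\<close> alike. None of the
  constants in these relations vanishes. Hence one rational function obeys all three formulas
  for all \<open>(n, m)\<close> once the constant \<open>1\<close> does so for \<open>n = m = 0\<close>, and there the
  hypergeometric and the algebraic function solve the same second-order equation with the
  same behaviour at the singular point, so that their Wronskian vanishes.
\<close>

section \<open>Contiguous relations for the Gauss function\<close>

text \<open>The argument \<open>B_minus \<theta> / B_plus \<theta>\<close> runs through (0,1) and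
  its reciprocal through the ray beyond 1, far outside the germ where the power series defines
  \<open>r_oct\<close>. Only rationality reaches these points, so every step must act on rational
  functions with poles under control.

  The two sides match because the parametrization is homogeneous: \<open>B^2 p_f u = 4\<close> and
  \<open>B^3 p_e u = 8 cos \<theta>\<close>, and then \<open>p_f^3 - p_e^2 = 108 p_v\<close> is the
  identity cos^2 + sin^2 = 1. A step operator always raises the exponent of B by 3; where it should
  fall by 3, the surplus \<open>B^6\<close> is traded for \<open>p_f^3\<close> or
  \<open>p_v\<close>.

  The origin of \<open>d_oct\<close>: the order 1/4 + m and the order -1/4 - m have different ladder
  constants for the same operator on \<rho>. Their quotients accumulate to the rising factorials of
  5/12 and 13/12.\<close>

lemma noninteger_add_of_nat: "a + real k \<noteq> 0" if "(a::real) \<notin> \<int>"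
  using that by (metis Ints_minus Ints_of_nat add.inverse_inverse eq_neg_iff_add_eq_0)

abbreviation hyp_fps :: "real \<Rightarrow> real \<Rightarrow> real \<Rightarrow> real fps" where
  "hyp_fps a b c \<equiv> fps_hypergeo [a, b] [c] 1"

lemma hyp_fps_nth:
  "fps_nth (hyp_fps a b c) k = pochhammer a k * pochhammer b k / (pochhammer c k * fact k)"
  by (simp add: fps_hypergeo_nth)

declare fps_hypergeo_nth [simp del]

lemma hyp_fps_Suc:
  assumes "c \<notin> \<int>"
  shows "(c + real k) * (real k + 1) * fps_nth (hyp_fps a b c) (Suc k) =
         (a + real k) * (b + real k) * fps_nth (hyp_fps a b c) k"
proof -
  have "c + real k \<noteq> 0" "pochhammer c k \<noteq> 0"
    using assms noninteger_add_of_nat[OF assms]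
    by (auto simp: pochhammer_eq_0_iff eq_neg_iff_add_eq_0)
  moreover have "fact k \<noteq> (0::real)" "1 + real k \<noteq> 0" by auto
  ultimately show ?thesis
    by (simp add: hyp_fps_nth pochhammer_Suc divide_simps) 
qed

lemma pochhammer_nonzero_if_nonint: "pochhammer a k \<noteq> 0" if "(a::real) \<notin> \<int>"
  using noninteger_add_of_nat[OF that] by (auto simp: pochhammer_eq_0_iff eq_neg_iff_add_eq_0)

lemma hyp_fps_nonzero:
  assumes "a \<notin> \<int>" "b \<notin> \<int>" "c \<notin> \<int>"
  shows "fps_nth (hyp_fps a b c) k \<noteq> 0"
  using assms by (simp add: hyp_fps_nth pochhammer_nonzero_if_nonint)

text \<open>Ratio test. Non-integral a and b keep all coefficients nonzero; a terminating series
  would have infinite radius instead.\<close>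

lemma conv_radius_hyp_fps:
  assumes "a \<notin> \<int>" "b \<notin> \<int>" "c \<notin> \<int>"
  shows "fps_conv_radius (hyp_fps a b c) = 1"
  unfolding fps_conv_radius_def
proof (rule conv_radius_ratio_limit_nonzero[where c = 1])
  let ?h = "fps_nth (hyp_fps a b c)"
  have "norm (?h n) / norm (?h (Suc n)) =
          \<bar>((c + real n) * (real n + 1)) / ((a + real n) * (b + real n))\<bar>" for n
  proof -
    have "a + real n \<noteq> 0" "b + real n \<noteq> 0" "?h (Suc n) \<noteq> 0"
      using assms noninteger_add_of_nat hyp_fps_nonzero by blast+
    then have "?h n / ?h (Suc n) = ((c + real n) * (real n + 1)) / ((a + real n) * (b + real n))"
      using hyp_fps_Suc[OF assms(3), of n a b]
      by (simp add: frac_eq_eq mult.commute)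
    then show ?thesis by (metis abs_divide real_norm_def)
  qed
  moreover have "(\<lambda>n. \<bar>((c + real n) * (real n + 1)) / ((a + real n) * (b + real n))\<bar>) \<longlonglongrightarrow> 1"
  proof -
    have "(\<lambda>n. ((c / real n + 1) * (1 + 1 / real n)) / ((a / real n + 1) * (b / real n + 1)))
            \<longlonglongrightarrow> ((0 + 1) * (1 + 0)) / ((0 + 1) * (0 + 1))"
      by (intro tendsto_intros lim_const_over_n) auto
    moreover have "\<forall>\<^sub>F n in sequentially.
        ((c / real n + 1) * (1 + 1 / real n)) / ((a / real n + 1) * (b / real n + 1)) =
        ((c + real n) * (real n + 1)) / ((a + real n) * (b + real n))"
      using eventually_gt_at_top[of 0]
    proof eventually_elim
      case (elim n)
      have "(x / real n + 1) = (x + real n) / real n" for x using elim by (simp add: field_simps)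
      moreover have "1 + 1 / real n = (real n + 1) / real n" using elim by (simp add: field_simps)
      ultimately show ?case using elim by simp
    qed
    ultimately have "(\<lambda>n. ((c + real n) * (real n + 1)) / ((a + real n) * (b + real n))) \<longlonglongrightarrow> 1"
      by (simp add: tendsto_cong)
    from tendsto_rabs[OF this] show ?thesis by simp
  qed
  ultimately show "(\<lambda>n. norm (?h n) / norm (?h (Suc n))) \<longlonglongrightarrow> 1" by simp
qed (auto simp: one_ereal_def)

text \<open>Every contiguous relation below has this shape, so each one reduces to a recurrence
  between coefficients. The constant coefficient is a separate hypothesis because only there the
  terms with \<open>p1\<close>, \<open>p2\<close>, \<open>q1\<close> drop out.\<close>

lemma eval_fps_linear_relation:
  fixes F G :: "real fps"
  assumes "ereal \<bar>z\<bar> < fps_conv_radius F" "ereal \<bar>z\<bar> < fps_conv_radius G"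
    and "p0 * fps_nth F 1 + q0 * fps_nth F 0 = k * fps_nth G 0"
    and "\<And>n. p0 * (real n + 2) * fps_nth F (Suc (Suc n)) + p1 * (real n + 1) * fps_nth F (Suc n)
           + p2 * real n * fps_nth F n + q0 * fps_nth F (Suc n) + q1 * fps_nth F n
           = k * fps_nth G (Suc n)"
  shows "(p0 + p1 * z + p2 * z\<^sup>2) * eval_fps (fps_deriv F) z + (q0 + q1 * z) * eval_fps F z
           = k * eval_fps G z"
proof -
  define P where "P = fps_of_poly [:p0, p1, p2:]"
  define Q where "Q = fps_of_poly [:q0, q1:]"
  have P: "P * A = fps_const p0 * A + fps_X * (fps_const p1 * A) + fps_X * (fps_X * (fps_const p2 * A))"
    and Q: "Q * A = fps_const q0 * A + fps_X * (fps_const q1 * A)" for A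
    by (simp_all add: P_def Q_def fps_of_poly_pCons ring_distribs)
  have eq: "P * fps_deriv F + Q * F = fps_const k * G"
  proof (rule fps_ext)
    fix n
    show "fps_nth (P * fps_deriv F + Q * F) n = fps_nth (fps_const k * G) n"
    proof (cases n)
      case 0
      then show ?thesis using assms(3) by (simp add: P Q)
    next
      case (Suc n)
      have "fps_nth (P * fps_deriv F) (Suc n) = p0 * (real n + 2) * fps_nth F (Suc (Suc n))
              + p1 * (real n + 1) * fps_nth F (Suc n) + p2 * real n * fps_nth F n"
        by (cases n) (simp_all add: P algebra_simps)
      moreover have "fps_nth (Q * F) (Suc n) = q0 * fps_nth F (Suc n) + q1 * fps_nth F n"
        by (simp add: Q)
      ultimately show ?thesis using assms(4)[of n] Suc by simp
    qed
  qed
  have d: "ereal \<bar>z\<bar> < fps_conv_radius (fps_deriv F)"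
    using assms(1) by (rule less_le_trans) (rule fps_conv_radius_deriv)
  have "ereal \<bar>z\<bar> < fps_conv_radius (P * fps_deriv F)" "ereal \<bar>z\<bar> < fps_conv_radius (Q * F)"
    using d assms(1) fps_conv_radius_mult[of P "fps_deriv F"] fps_conv_radius_mult[of Q F]
    by (auto simp: P_def Q_def)
  then have "eval_fps (P * fps_deriv F + Q * F) z =
      poly [:p0, p1, p2:] z * eval_fps (fps_deriv F) z + poly [:q0, q1:] z * eval_fps F z"
    using d assms(1) by (simp add: eval_fps_add eval_fps_mult P_def Q_def del: poly_pCons)
  also have "\<dots> = (p0 + p1 * z + p2 * z\<^sup>2) * eval_fps (fps_deriv F) z + (q0 + q1 * z) * eval_fps F z"
    by (simp add: power2_eq_square algebra_simps)
  finally show ?thesis using assms(2) by (simp add: eq eval_fps_mult)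
qed


lemma hyp_fps_commute: "hyp_fps a b c = hyp_fps b a c"
  by (rule fps_ext) (simp add: hyp_fps_nth mult.commute)

lemma gauss_2F1_commute: "gauss_2F1 a b c = gauss_2F1 b a c"
  by (rule ext) (simp add: gauss_2F1_def hyp_fps_commute)

lemma hyp_fps_Suc':
  assumes "c \<notin> \<int>"
  shows "fps_nth (hyp_fps a b c) (Suc k) =
         (a + real k) * (b + real k) / ((c + real k) * (real k + 1)) * fps_nth (hyp_fps a b c) k"
  using hyp_fps_Suc[OF assms, of k a b] noninteger_add_of_nat[OF assms, of k]
  by (simp add: eq_divide_eq mult.commute)

lemma pochhammer_shift: "a * pochhammer (a + 1) k = (a + real k) * pochhammer a k"
  by (metis mult.commute of_nat_Suc pochhammer_Suc pochhammer_rec)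

text \<open>The source of the contiguous relations: the factor \<open>(a + k) / a\<close> on the
  k-th coefficient is the action of \<open>(z d/dz + a) / a\<close>.\<close>

lemma hyp_fps_raise_a:
  assumes "a \<notin> \<int>"
  shows "fps_nth (hyp_fps (a + 1) b c) k = (a + real k) / a * fps_nth (hyp_fps a b c) k"
proof -
  have "a \<noteq> 0" using assms by auto
  then have "pochhammer (a + 1) k = (a + real k) / a * pochhammer a k"
    using pochhammer_shift[of a k] by (simp add: eq_divide_eq mult.commute)
  then show ?thesis by (simp add: hyp_fps_nth)
qed

lemma hyp_fps_raise_b:
  assumes "b \<notin> \<int>"
  shows "fps_nth (hyp_fps a (b + 1) c) k = (b + real k) / b * fps_nth (hyp_fps a b c) k"
  by (metis hyp_fps_raise_a[OF assms] hyp_fps_commute)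

lemma hyp_fps_raise_c:
  assumes "c \<notin> \<int>"
  shows "fps_nth (hyp_fps a b (c + 1)) k = c / (c + real k) * fps_nth (hyp_fps a b c) k"
proof -
  have "c \<noteq> 0" "c + real k \<noteq> 0" using assms noninteger_add_of_nat[OF assms] by auto
  moreover have "pochhammer (c + 1) k = (c + real k) / c * pochhammer c k"
    using pochhammer_shift[of c k] \<open>c \<noteq> 0\<close> by (simp add: eq_divide_eq mult.commute)
  ultimately show ?thesis by (simp add: hyp_fps_nth ac_simps)
qed

lemma nonint_plus1 [simp]: "a + 1 \<in> \<int> \<longleftrightarrow> (a::real) \<in> \<int>"
  by (metis Ints_1 Ints_add Ints_diff add_diff_cancel_right')

lemma nonint_minus1 [simp]: "a - 1 \<in> \<int> \<longleftrightarrow> (a::real) \<in> \<int>"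
  by (metis nonint_plus1 diff_add_cancel)

definition gauss_deriv :: "real \<Rightarrow> real \<Rightarrow> real \<Rightarrow> real \<Rightarrow> real" where
  "gauss_deriv a b c z = eval_fps (fps_deriv (hyp_fps a b c)) z"

context
  fixes a b c z :: real
  assumes nonint: "a \<notin> \<int>" "b \<notin> \<int>" "c \<notin> \<int>" and z: "\<bar>z\<bar> < 1"
begin

lemma gauss_2F1_has_derivative:
  "(gauss_2F1 a b c has_real_derivative gauss_deriv a b c z) (at z)"
proof -
  have "gauss_2F1 a b c = eval_fps (hyp_fps a b c)"
    by (rule ext) (simp add: gauss_2F1_def)
  then show ?thesis
    using has_field_derivative_eval_fps[of z "hyp_fps a b c"] conv_radius_hyp_fps[OF nonint] z
    by (simp add: gauss_deriv_def)
qed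

private lemma nz: "a + real k \<noteq> 0" "b + real k \<noteq> 0" "c + real k \<noteq> 0"
  "a - 1 + real k \<noteq> 0" "b - 1 + real k \<noteq> 0" "c - 1 + real k \<noteq> 0"
  using nonint by (intro noninteger_add_of_nat; simp)+

private lemma nz0: "a \<noteq> 0" "b \<noteq> 0" "c \<noteq> 0" "a - 1 \<noteq> 0" "b - 1 \<noteq> 0" "c - 1 \<noteq> 0"
  using nz[of 0] by simp_all

text \<open>The recurrence removes the coefficient of index n + 2, so an instance only has to
  compare multiples of two neighbouring coefficients.\<close>

private lemma relation:
  assumes "a' \<notin> \<int>" "b' \<notin> \<int>" "c' \<notin> \<int>"
    and "p0 * a * b / c + q0 = k"
    and "\<And>n. p0 * ((a + real n + 1) * (b + real n + 1) / (c + real n + 1)) * fps_nth (hyp_fps a b c) (Suc n)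
           + p1 * (real n + 1) * fps_nth (hyp_fps a b c) (Suc n)
           + p2 * real n * fps_nth (hyp_fps a b c) n + q0 * fps_nth (hyp_fps a b c) (Suc n)
           + q1 * fps_nth (hyp_fps a b c) n = k * fps_nth (hyp_fps a' b' c') (Suc n)"
  shows "(p0 + p1 * z + p2 * z\<^sup>2) * gauss_deriv a b c z + (q0 + q1 * z) * gauss_2F1 a b c z
           = k * gauss_2F1 a' b' c' z"
  unfolding gauss_deriv_def gauss_2F1_def
proof (rule eval_fps_linear_relation)
  fix n
  have "p0 * (real n + 2) * fps_nth (hyp_fps a b c) (Suc (Suc n)) =
        p0 * ((a + real n + 1) * (b + real n + 1) / (c + real n + 1)) * fps_nth (hyp_fps a b c) (Suc n)"
    unfolding hyp_fps_Suc'[OF nonint(3), of a b "Suc n"]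
    using noninteger_add_of_nat[OF nonint(3), of "Suc n"]
    by (simp add: divide_simps ac_simps)
  with assms(5)[of n] show "p0 * (real n + 2) * fps_nth (hyp_fps a b c) (Suc (Suc n))
     + p1 * (real n + 1) * fps_nth (hyp_fps a b c) (Suc n)
     + p2 * real n * fps_nth (hyp_fps a b c) n + q0 * fps_nth (hyp_fps a b c) (Suc n)
     + q1 * fps_nth (hyp_fps a b c) n = k * fps_nth (hyp_fps a' b' c') (Suc n)" by simp
next
  have "fps_nth (hyp_fps a b c) 1 = a * b / c" by (simp add: hyp_fps_nth)
  then show "p0 * fps_nth (hyp_fps a b c) 1 + q0 * fps_nth (hyp_fps a b c) 0 = k * fps_nth (hyp_fps a' b' c') 0"
    using assms(4) by (simp add: mult.assoc)
qed (use assms(1-3) z conv_radius_hyp_fps nonint in simp_all)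

lemma gauss_raise_a: "z * gauss_deriv a b c z + a * gauss_2F1 a b c z = a * gauss_2F1 (a + 1) b c z"
proof -
  have "(0 + 1 * z + 0 * z\<^sup>2) * gauss_deriv a b c z + (a + 0 * z) * gauss_2F1 a b c z =
     a * gauss_2F1 (a + 1) b c z"
    by (rule relation; (unfold hyp_fps_raise_a[OF nonint(1)])?)
      (use nonint nz0 in \<open>simp_all add: field_simps\<close>)
  then show ?thesis by simp
qed

lemma gauss_lower_c:
  "z * gauss_deriv a b c z + (c - 1) * gauss_2F1 a b c z = (c - 1) * gauss_2F1 a b (c - 1) z"
proof -
  have "fps_nth (hyp_fps a b (c - 1)) k = (c - 1 + real k) / (c - 1) * fps_nth (hyp_fps a b c) k" for k
    using hyp_fps_raise_c[of "c - 1" a b k] nonint nz[of k] nz0 by (simp)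
  then have r: "(c - 1) * fps_nth (hyp_fps a b (c - 1)) k = (c - 1 + real k) * fps_nth (hyp_fps a b c) k" for k
    using nz0 by simp
  have "(0 + 1 * z + 0 * z\<^sup>2) * gauss_deriv a b c z + (c - 1 + 0 * z) * gauss_2F1 a b c z =
     (c - 1) * gauss_2F1 a b (c - 1) z"
    by (rule relation; (unfold r)?) (use nonint in \<open>simp_all add: algebra_simps\<close>)
  then show ?thesis by simp
qed

text \<open>Equivalently, the derivative of \<open>(1-z)^(a+b-c) F\<close>, which by Euler's
  transformation is the Gauss function with parameters c-a, c-b, c. Comparing coefficients avoids
  the transformation.\<close>

lemma gauss_raise_c:
  "(1 - z) * gauss_deriv a b c z - (a + b - c) * gauss_2F1 a b c z =
     (c - a) * (c - b) / c * gauss_2F1 a b (c + 1) z"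
proof -
  have "(1 + (-1) * z + 0 * z\<^sup>2) * gauss_deriv a b c z + (- (a + b - c) + 0 * z) * gauss_2F1 a b c z =
     (c - a) * (c - b) / c * gauss_2F1 a b (c + 1) z"
  proof (rule relation)
    fix n
    have "c + real (Suc n) \<noteq> 0" by (rule nz)
    then show "1 * ((a + real n + 1) * (b + real n + 1) / (c + real n + 1)) * fps_nth (hyp_fps a b c) (Suc n)
           + (-1) * (real n + 1) * fps_nth (hyp_fps a b c) (Suc n)
           + 0 * real n * fps_nth (hyp_fps a b c) n + (- (a + b - c)) * fps_nth (hyp_fps a b c) (Suc n)
           + 0 * fps_nth (hyp_fps a b c) n = (c - a) * (c - b) / c * fps_nth (hyp_fps a b (c + 1)) (Suc n)"
      unfolding hyp_fps_raise_c[OF nonint(3)]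
      using nz0(3) by (simp add: divide_simps) (simp add: algebra_simps)
  qed (use nonint nz0(3) in \<open>auto simp: field_simps\<close>)
  then show ?thesis by (simp add: algebra_simps)
qed

text \<open>Equivalently, the derivative of \<open>(1-z)^a F\<close>, which by Pfaff's
  transformation is a Gauss function in z/(z-1).\<close>

lemma gauss_raise_a_c:
  "(1 - z) * gauss_deriv a b c z - a * gauss_2F1 a b c z =
     - a * (c - b) / c * gauss_2F1 (a + 1) b (c + 1) z"
proof -
  have "(1 + (-1) * z + 0 * z\<^sup>2) * gauss_deriv a b c z + (- a + 0 * z) * gauss_2F1 a b c z =
     - a * (c - b) / c * gauss_2F1 (a + 1) b (c + 1) z"
  proof (rule relation)
    fix n
    have "c + real (Suc n) \<noteq> 0" by (rule nz)
    moreover have "c + 1 \<notin> \<int>" using nonint by simp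
    ultimately show "1 * ((a + real n + 1) * (b + real n + 1) / (c + real n + 1)) * fps_nth (hyp_fps a b c) (Suc n)
           + (-1) * (real n + 1) * fps_nth (hyp_fps a b c) (Suc n)
           + 0 * real n * fps_nth (hyp_fps a b c) n + (- a) * fps_nth (hyp_fps a b c) (Suc n)
           + 0 * fps_nth (hyp_fps a b c) n = - a * (c - b) / c * fps_nth (hyp_fps (a + 1) b (c + 1)) (Suc n)"
      unfolding hyp_fps_raise_c[OF nonint(3)] hyp_fps_raise_a[OF nonint(1)]
      using nz0(1,3) by (simp add: divide_simps) (simp add: algebra_simps)
  qed (use nonint nz0(3) in \<open>auto simp: field_simps\<close>)
  then show ?thesis by simp
qed

private lemma lower_b:
  "fps_nth (hyp_fps a (b - 1) c) k = (b - 1) / (b - 1 + real k) * fps_nth (hyp_fps a b c) k"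
  using hyp_fps_raise_b[of "b - 1" a c k] nonint nz[of k] nz0 by (simp)

text \<open>The recurrence read downwards. Operators with a term in z^2 bring in the coefficient of
  index n; expressing it by its successor makes each remaining relation an identity between rational
  multiples of one coefficient. The division needs non-integral a and b.\<close>

private lemma Suc_eq:
  "fps_nth (hyp_fps a b c) n =
     (c + real n) * (real n + 1) / ((a + real n) * (b + real n)) * fps_nth (hyp_fps a b c) (Suc n)"
  using hyp_fps_Suc[OF nonint(3), of n a b] nz[of n] nz0
  by (simp add: divide_simps ac_simps)

lemma gauss_lower_b:
  "z * (1 - z) * gauss_deriv a b c z =
     (c - b) * gauss_2F1 a (b - 1) c z + (b - c + a * z) * gauss_2F1 a b c z"
proof -
  have "(0 + 1 * z + (-1) * z\<^sup>2) * gauss_deriv a b c z + ((c - b) + (-a) * z) * gauss_2F1 a b c z =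
     (c - b) * gauss_2F1 a (b - 1) c z"
  proof (rule relation)
    fix n
    have *: "b - 1 + real (Suc n) \<noteq> 0" by (rule nz)
    show "0 * ((a + real n + 1) * (b + real n + 1) / (c + real n + 1)) * fps_nth (hyp_fps a b c) (Suc n)
           + 1 * (real n + 1) * fps_nth (hyp_fps a b c) (Suc n)
           + (-1) * real n * fps_nth (hyp_fps a b c) n + (c - b) * fps_nth (hyp_fps a b c) (Suc n)
           + (-a) * fps_nth (hyp_fps a b c) n = (c - b) * fps_nth (hyp_fps a (b - 1) c) (Suc n)"
      unfolding lower_b Suc_eq[of n]
      using nz[of n] nz0 * by (simp add: divide_simps) (simp add: algebra_simps)
  qed (use nonint in auto)
  then show ?thesis by (simp add: power2_eq_square algebra_simps)
qed

text \<open>Up to the weight, the derivative of \<open>z^(c-1) (1-z)^(a-c+1) F\<close>.\<close>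

lemma gauss_lower_b_c:
  "z * (1 - z) * gauss_deriv a b c z + (c - 1 - a * z) * gauss_2F1 a b c z =
     (c - 1) * gauss_2F1 a (b - 1) (c - 1) z"
proof -
  have c: "fps_nth (hyp_fps a' b' (c - 1)) k = (c - 1 + real k) / (c - 1) * fps_nth (hyp_fps a' b' c) k" for k a' b'
    using hyp_fps_raise_c[of "c - 1" a' b' k] nonint nz[of k] nz0 by (simp)
  have "(0 + 1 * z + (-1) * z\<^sup>2) * gauss_deriv a b c z + ((c - 1) + (-a) * z) * gauss_2F1 a b c z =
     (c - 1) * gauss_2F1 a (b - 1) (c - 1) z"
  proof (rule relation)
    fix n
    have *: "b - 1 + real (Suc n) \<noteq> 0" "c - 1 + real (Suc n) \<noteq> 0" by (rule nz)+
    show "0 * ((a + real n + 1) * (b + real n + 1) / (c + real n + 1)) * fps_nth (hyp_fps a b c) (Suc n)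
           + 1 * (real n + 1) * fps_nth (hyp_fps a b c) (Suc n)
           + (-1) * real n * fps_nth (hyp_fps a b c) n + (c - 1) * fps_nth (hyp_fps a b c) (Suc n)
           + (-a) * fps_nth (hyp_fps a b c) n = (c - 1) * fps_nth (hyp_fps a (b - 1) (c - 1)) (Suc n)"
      unfolding lower_b c Suc_eq[of n]
      using nz[of n] nz0 * by (simp add: divide_simps) (simp add: algebra_simps)
  qed (use nonint in auto)
  then show ?thesis by (simp add: power2_eq_square algebra_simps)
qed

text \<open>A degree shift of a Legendre function moves both upper parameters -\<nu> and \<nu> + 1,
  whose sum is 1. The coefficient of index n enters with factor \<open>-2 (n + b)\<close>, which
  cancels the denominator b + n from \<open>Suc_eq\<close>; this determines the operator up to
  scale.\<close>

lemma gauss_lower_a_raise_b: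
  assumes ab: "a + b = 1"
  shows "2 * z * (1 - z) * gauss_deriv a b c z + (c - 1 + b * (1 - 2 * z)) * gauss_2F1 a b c z =
         (b - 1 + c) * gauss_2F1 (a - 1) (b + 1) c z"
proof -
  have ra: "fps_nth (hyp_fps (a - 1) b' c) k = (a - 1) / (a - 1 + real k) * fps_nth (hyp_fps a b' c) k" for k b'
    using hyp_fps_raise_a[of "a - 1" b' c k] nonint nz[of k] nz0 by (simp)
  have "(0 + 2 * z + (-2) * z\<^sup>2) * gauss_deriv a b c z + ((c - 1 + b) + (- 2 * b) * z) * gauss_2F1 a b c z =
     (b - 1 + c) * gauss_2F1 (a - 1) (b + 1) c z"
  proof (rule relation)
    fix n
    have *: "a - 1 + real (Suc n) \<noteq> 0" by (rule nz)
    have a: "a = 1 - b" using ab by simp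
    show "0 * ((a + real n + 1) * (b + real n + 1) / (c + real n + 1)) * fps_nth (hyp_fps a b c) (Suc n)
           + 2 * (real n + 1) * fps_nth (hyp_fps a b c) (Suc n)
           + (-2) * real n * fps_nth (hyp_fps a b c) n + (c - 1 + b) * fps_nth (hyp_fps a b c) (Suc n)
           + (- 2 * b) * fps_nth (hyp_fps a b c) n = (b - 1 + c) * fps_nth (hyp_fps (a - 1) (b + 1) c) (Suc n)"
      unfolding ra hyp_fps_raise_b[OF nonint(2)] Suc_eq[of n]
      using nz[of n] nz0 * by (simp add: divide_simps) (simp add: a algebra_simps)
  qed (use nonint in auto)
  then show ?thesis by (simp add: power2_eq_square algebra_simps)
qed

text \<open>The same comparison of coefficients, now with the derivative series in the role of
  \<open>F\<close> and the series itself in the role of \<open>G\<close>.\<close>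

lemma gauss_ode:
  "\<exists>D. (gauss_deriv a b c has_real_derivative D) (at z) \<and>
       z * (1 - z) * D + (c - (a + b + 1) * z) * gauss_deriv a b c z = a * b * gauss_2F1 a b c z"
proof -
  let ?F = "hyp_fps a b c"
  have r: "ereal \<bar>z\<bar> < fps_conv_radius ?F" using z conv_radius_hyp_fps[OF nonint] by simp
  then have r': "ereal \<bar>z\<bar> < fps_conv_radius (fps_deriv ?F)"
    by (rule less_le_trans) (rule fps_conv_radius_deriv)
  have "gauss_deriv a b c = eval_fps (fps_deriv ?F)" by (rule ext) (simp add: gauss_deriv_def)
  then have d: "(gauss_deriv a b c has_real_derivative eval_fps (fps_deriv (fps_deriv ?F)) z) (at z)"
    using has_field_derivative_eval_fps[of z "fps_deriv ?F"] r' by simp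
  have "(0 + 1 * z + (-1) * z\<^sup>2) * eval_fps (fps_deriv (fps_deriv ?F)) z
       + (c + (- (a + b + 1)) * z) * eval_fps (fps_deriv ?F) z = a * b * eval_fps ?F z"
  proof (rule eval_fps_linear_relation[OF r' r])
    show "0 * fps_nth (fps_deriv ?F) 1 + c * fps_nth (fps_deriv ?F) 0 = a * b * fps_nth ?F 0"
      using nz0(3) by (simp add: hyp_fps_nth)
    fix n
    have *: "c + real (Suc n) \<noteq> 0" by (rule nz)
    have s: "fps_nth ?F (Suc (Suc n)) = (a + real (Suc n)) * (b + real (Suc n)) /
        ((c + real (Suc n)) * (real (Suc n) + 1)) * fps_nth ?F (Suc n)"
      by (rule hyp_fps_Suc'[OF nonint(3)])
    show "0 * (real n + 2) * fps_nth (fps_deriv ?F) (Suc (Suc n))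
        + 1 * (real n + 1) * fps_nth (fps_deriv ?F) (Suc n) + (-1) * real n * fps_nth (fps_deriv ?F) n
        + c * fps_nth (fps_deriv ?F) (Suc n) + (- (a + b + 1)) * fps_nth (fps_deriv ?F) n
        = a * b * fps_nth ?F (Suc n)"
      using * by (simp add: s divide_simps) (simp add: algebra_simps)
  qed
  then have "z * (1 - z) * eval_fps (fps_deriv (fps_deriv ?F)) z
     + (c - (a + b + 1) * z) * gauss_deriv a b c z = a * b * gauss_2F1 a b c z"
    by (simp add: gauss_deriv_def gauss_2F1_def power2_eq_square algebra_simps)
  with d show ?thesis by blast
qed

end

lemma gauss_2F1_0 [simp]: "gauss_2F1 a b c 0 = 1"
  by (simp add: gauss_2F1_def eval_fps_at_0)

section \<open>Ladder relations for the Ferrers function\<close>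

text \<open>With \<open>t = (1 - cos \<theta>) / 2\<close>, the operator sin \<theta> d/d\<theta> is
  \<open>2 t (1 - t) d/dt\<close>, and on the algebraic prefactor it acts as multiplication by
  -\<mu>. Each relation is therefore a Gauss relation times the prefactor. One derivative D is
  provided for all four, so that a single computation of D in the variable u serves every
  step.\<close>

lemma ferrers_cos_ladder:
  fixes \<nu> \<mu> \<theta> :: real
  assumes "\<nu> \<notin> \<int>" "\<mu> \<notin> \<int>" and \<theta>: "0 < \<theta>" "\<theta> < pi"
  obtains D where "((\<lambda>\<theta>. ferrers_P \<nu> \<mu> (cos \<theta>)) has_real_derivative D) (at \<theta>)"
    and "sin \<theta> * D + (\<nu> + 1) * cos \<theta> * ferrers_P \<nu> \<mu> (cos \<theta>) =
           (\<nu> + 1 - \<mu>) * ferrers_P (\<nu> + 1) \<mu> (cos \<theta>)"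
    and "sin \<theta> * D - \<nu> * cos \<theta> * ferrers_P \<nu> \<mu> (cos \<theta>) =
           - (\<nu> + \<mu>) * ferrers_P (\<nu> - 1) \<mu> (cos \<theta>)"
    and "sin \<theta> * D - \<mu> * cos \<theta> * ferrers_P \<nu> \<mu> (cos \<theta>) =
           sin \<theta> * ferrers_P \<nu> (\<mu> + 1) (cos \<theta>)"
    and "sin \<theta> * D + \<mu> * cos \<theta> * ferrers_P \<nu> \<mu> (cos \<theta>) =
           - (\<nu> - \<mu> + 1) * (\<nu> + \<mu>) * (sin \<theta> * ferrers_P \<nu> (\<mu> - 1) (cos \<theta>))"
proof -
  define X where "X = (\<lambda>\<theta> :: real. (1 + cos \<theta>) / (1 - cos \<theta>))"
  define t where "t = (1 - cos \<theta>) / 2"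
  define W where "W = X \<theta> powr (\<mu> / 2)"
  define F where "F = gauss_2F1 (- \<nu>) (\<nu> + 1) (1 - \<mu>) t"
  define F' where "F' = gauss_deriv (- \<nu>) (\<nu> + 1) (1 - \<mu>) t"
  define g where "g = 1 / Gamma (1 - \<mu>)"
  have s: "sin \<theta> > 0" using \<theta> by (rule sin_gt_zero)
  have sc: "(sin \<theta>)\<^sup>2 = 1 - (cos \<theta>)\<^sup>2" by (simp add: sin_squared_eq)
  have c: "1 - cos \<theta> > 0" "1 + cos \<theta> > 0"
    using cos_monotone_0_pi[of 0 \<theta>] cos_monotone_0_pi[of \<theta> pi] \<theta> by auto
  have ss: "(sin \<theta>)\<^sup>2 = (1 - cos \<theta>) * (1 + cos \<theta>)"
    unfolding sc by (simp add: power2_eq_square algebra_simps)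
  have X: "X \<theta> > 0" unfolding X_def using c by simp
  have t: "\<bar>t\<bar> < 1" using c by (auto simp: t_def)
  have nonint: "- \<nu> \<notin> \<int>" "\<nu> + 1 \<notin> \<int>" "1 - \<mu> \<notin> \<int>"
    using assms by (auto simp: minus_in_Ints_iff)
  have dX: "(X has_real_derivative - 2 / sin \<theta> * X \<theta>) (at \<theta>)"
  proof -
    have "(X has_real_derivative
        (- sin \<theta> * (1 - cos \<theta>) - (1 + cos \<theta>) * sin \<theta>) / ((1 - cos \<theta>) * (1 - cos \<theta>))) (at \<theta>)"
      unfolding X_def using c by (auto intro!: derivative_eq_intros)
    moreover have "(- sin \<theta> * (1 - cos \<theta>) - (1 + cos \<theta>) * sin \<theta>) / ((1 - cos \<theta>) * (1 - cos \<theta>)) =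
        - 2 / sin \<theta> * X \<theta>"
    proof -
      have "(1 + cos \<theta>) = (sin \<theta>)\<^sup>2 / (1 - cos \<theta>)"
        using c by (simp add: sc field_simps power2_eq_square)
      then show ?thesis using c s by (simp add: X_def divide_simps power2_eq_square) (use sc in algebra)
    qed
    ultimately show ?thesis by simp
  qed
  have dW: "((\<lambda>\<theta>. X \<theta> powr (\<mu> / 2)) has_real_derivative - \<mu> / sin \<theta> * W) (at \<theta>)"
    unfolding W_def
    using has_real_derivative_powr'[OF dX, of "\<lambda>_. \<mu> / 2" 0] X s
    by (simp add: field_simps)
  have dF: "((\<lambda>\<theta>. gauss_2F1 (- \<nu>) (\<nu> + 1) (1 - \<mu>) ((1 - cos \<theta>) / 2)) has_real_derivative
      F' * (sin \<theta> / 2)) (at \<theta>)"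
    unfolding F'_def t_def
    by (rule DERIV_chain2[OF gauss_2F1_has_derivative[OF nonint]])
      (use t in \<open>auto intro!: derivative_eq_intros simp: t_def\<close>)
  define D where "D = g * (- \<mu> / sin \<theta> * W * F + W * (F' * (sin \<theta> / 2)))"
  have P: "ferrers_P \<nu> \<mu> (cos \<theta>) = g * W * F"
    by (simp add: ferrers_P_def g_def W_def F_def X_def t_def)
  have sD: "sin \<theta> * D = g * W * (2 * t * (1 - t) * F' - \<mu> * F)"
  proof -
    have "2 * t * (1 - t) = (sin \<theta>)\<^sup>2 / 2"
      unfolding sc by (simp add: t_def field_simps power2_eq_square)
    moreover have "sin \<theta> * D = g * W * ((sin \<theta>)\<^sup>2 / 2 * F' - \<mu> * F)"
      using s by (simp add: D_def field_simps power2_eq_square)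
    ultimately show ?thesis by simp
  qed
  have cos: "cos \<theta> = 1 - 2 * t" by (simp add: t_def field_simps)
  show ?thesis
  proof (rule that)
    show "((\<lambda>\<theta>. ferrers_P \<nu> \<mu> (cos \<theta>)) has_real_derivative D) (at \<theta>)"
      unfolding ferrers_P_def
      using DERIV_cmult[OF DERIV_mult[OF dW dF], of g]
      by (simp add: D_def g_def X_def F_def t_def W_def mult.assoc add.commute mult.commute)
  next
    have "ferrers_P (\<nu> + 1) \<mu> (cos \<theta>) = g * W * gauss_2F1 (- \<nu> - 1) (\<nu> + 1 + 1) (1 - \<mu>) t"
    proof -
      have "- (\<nu> + 1) = - \<nu> - 1" by simp
      then show ?thesis by (simp only: ferrers_P_def g_def W_def X_def t_def)
    qed
    moreover have "2 * t * (1 - t) * F' + (1 - \<mu> - 1 + (\<nu> + 1) * (1 - 2 * t)) * F =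
      (\<nu> + 1 - 1 + (1 - \<mu>)) * gauss_2F1 (- \<nu> - 1) (\<nu> + 1 + 1) (1 - \<mu>) t"
      unfolding F_def F'_def by (rule gauss_lower_a_raise_b[OF nonint t]) simp
    ultimately show "sin \<theta> * D + (\<nu> + 1) * cos \<theta> * ferrers_P \<nu> \<mu> (cos \<theta>) =
           (\<nu> + 1 - \<mu>) * ferrers_P (\<nu> + 1) \<mu> (cos \<theta>)"
      unfolding sD P unfolding cos by algebra
  next
    have "ferrers_P (\<nu> - 1) \<mu> (cos \<theta>) = g * W * gauss_2F1 (\<nu> + 1 - 1) (- \<nu> + 1) (1 - \<mu>) t"
    proof -
      have "- (\<nu> - 1) = - \<nu> + 1" "\<nu> - 1 + 1 = \<nu> + 1 - 1" by simp_all
      then show ?thesis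
        by (simp only: ferrers_P_def g_def W_def X_def t_def gauss_2F1_commute[of "- \<nu> + 1"])
    qed
    \<comment> \<open>Exchanging the upper parameters is the symmetry \<nu> to -\<nu> - 1, which
      turns the raising relation into the lowering one.\<close>
    moreover have "2 * t * (1 - t) * F' + (1 - \<mu> - 1 + (- \<nu>) * (1 - 2 * t)) * F =
      (- \<nu> - 1 + (1 - \<mu>)) * gauss_2F1 (\<nu> + 1 - 1) (- \<nu> + 1) (1 - \<mu>) t"
    proof -
      have "gauss_deriv (- \<nu>) (\<nu> + 1) (1 - \<mu>) = gauss_deriv (\<nu> + 1) (- \<nu>) (1 - \<mu>)"
        unfolding gauss_deriv_def by (metis hyp_fps_commute)
      then show ?thesis
        unfolding F_def F'_def gauss_2F1_commute[of "- \<nu>" "\<nu> + 1"]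
        using gauss_lower_a_raise_b[OF nonint(2,1,3) t] by simp
    qed
    ultimately show "sin \<theta> * D - \<nu> * cos \<theta> * ferrers_P \<nu> \<mu> (cos \<theta>) =
           - (\<nu> + \<mu>) * ferrers_P (\<nu> - 1) \<mu> (cos \<theta>)"
      unfolding sD P unfolding cos by algebra
  next
    have "sqrt (X \<theta>) = (1 + cos \<theta>) / sin \<theta>"
    proof (rule real_sqrt_unique)
      show "((1 + cos \<theta>) / sin \<theta>)\<^sup>2 = X \<theta>"
        using c unfolding X_def power_divide ss by (simp add: power2_eq_square)
    qed (use c s in simp)
    then have "X \<theta> powr ((\<mu> + 1) / 2) = W * ((1 + cos \<theta>) / sin \<theta>)"
      using X by (simp add: W_def add_divide_distrib powr_add powr_half_sqrt)
    \<comment> \<open>The factor -\<mu> is the constant c - 1 of \<open>gauss_lower_c\<close>. This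
      is why the relation for \<mu> + 1 carries no constant.\<close>
    moreover have "1 / Gamma (1 - (\<mu> + 1)) = - \<mu> * g"
    proof -
      have "\<mu> \<noteq> 0" using assms by auto
      moreover have "- \<mu> \<notin> \<int>\<^sub>\<le>\<^sub>0" using assms by (metis minus_in_Ints_iff nonpos_Ints_Int subsetD nonpos_Ints_subset_Ints)
      ultimately show ?thesis
        using Gamma_plus1[of "- \<mu>"] by (simp add: g_def field_simps)
    qed
    ultimately have "ferrers_P \<nu> (\<mu> + 1) (cos \<theta>) =
        - \<mu> * g * (W * ((1 + cos \<theta>) / sin \<theta>)) * gauss_2F1 (- \<nu>) (\<nu> + 1) (1 - \<mu> - 1) t"
      by (simp add: ferrers_P_def X_def t_def)
    then have "sin \<theta> * ferrers_P \<nu> (\<mu> + 1) (cos \<theta>) =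
        g * W * (1 + cos \<theta>) * ((1 - \<mu> - 1) * gauss_2F1 (- \<nu>) (\<nu> + 1) (1 - \<mu> - 1) t)"
      using s by simp
    also have "\<dots> = g * W * (1 + cos \<theta>) * (t * F' + (1 - \<mu> - 1) * F)"
      unfolding F_def F'_def gauss_lower_c[OF nonint t] ..
    finally show "sin \<theta> * D - \<mu> * cos \<theta> * ferrers_P \<nu> \<mu> (cos \<theta>) =
           sin \<theta> * ferrers_P \<nu> (\<mu> + 1) (cos \<theta>)"
      unfolding sD P unfolding cos by algebra
  next
    have "sqrt (X \<theta>) = sin \<theta> / (1 - cos \<theta>)"
    proof (rule real_sqrt_unique)
      show "(sin \<theta> / (1 - cos \<theta>))\<^sup>2 = X \<theta>"
        using c unfolding X_def power_divide ss by (simp add: power2_eq_square)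
    qed (use c s in simp)
    then have "X \<theta> powr ((\<mu> - 1) / 2) = W * ((1 - cos \<theta>) / sin \<theta>)"
      unfolding W_def diff_divide_distrib[of \<mu>] powr_diff using X by (simp add: powr_half_sqrt)
    moreover have "1 - \<mu> \<noteq> 0" using nonint(3) by auto
    moreover have "1 / Gamma (1 - (\<mu> - 1)) = g / (1 - \<mu>)"
    proof -
      have "1 - \<mu> \<notin> \<int>\<^sub>\<le>\<^sub>0" using nonint(3) nonpos_Ints_subset_Ints by blast
      then show ?thesis
        using Gamma_plus1[of "1 - \<mu>"] by (simp add: g_def field_simps)
    qed
    ultimately have "ferrers_P \<nu> (\<mu> - 1) (cos \<theta>) =
        g / (1 - \<mu>) * (W * ((1 - cos \<theta>) / sin \<theta>)) * gauss_2F1 (- \<nu>) (\<nu> + 1) (1 - \<mu> + 1) t"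
      by (simp add: ferrers_P_def X_def t_def)
    then have sP: "sin \<theta> * ferrers_P \<nu> (\<mu> - 1) (cos \<theta>) =
        g * W * (1 - cos \<theta>) * (gauss_2F1 (- \<nu>) (\<nu> + 1) (1 - \<mu> + 1) t / (1 - \<mu>))"
      using s by simp
    have coeff: "(1 - \<mu> - - \<nu>) * (1 - \<mu> - (\<nu> + 1)) = - (\<nu> - \<mu> + 1) * (\<nu> + \<mu>)"
      by algebra
    have "- (\<nu> - \<mu> + 1) * (\<nu> + \<mu>) * (sin \<theta> * ferrers_P \<nu> (\<mu> - 1) (cos \<theta>)) =
        g * W * (1 - cos \<theta>) * ((1 - \<mu> - - \<nu>) * (1 - \<mu> - (\<nu> + 1)) / (1 - \<mu>) *
          gauss_2F1 (- \<nu>) (\<nu> + 1) (1 - \<mu> + 1) t)"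
      unfolding sP coeff by simp
    also have "\<dots> = g * W * (1 - cos \<theta>) * ((1 - t) * F' - (- \<nu> + (\<nu> + 1) - (1 - \<mu>)) * F)"
      unfolding F_def F'_def gauss_raise_c[OF nonint t] ..
    finally show "sin \<theta> * D + \<mu> * cos \<theta> * ferrers_P \<nu> \<mu> (cos \<theta>) =
           - (\<nu> - \<mu> + 1) * (\<nu> + \<mu>) * (sin \<theta> * ferrers_P \<nu> (\<mu> - 1) (cos \<theta>))"
      unfolding sD P unfolding cos by algebra
  qed
qed

section \<open>The trigonometric parametrization\<close>

text \<open>The two statements of the theorem differ by the sign \<open>s\<close> of the square root: for
  \<open>s = 1\<close> the functions below are \<open>B\<^sub>+\<close> and \<open>B\<^sub>- / B\<^sub>+\<close>, for \<open>s = - 1\<close> they are \<open>B\<^sub>-\<close> and \<open>B\<^sub>+ / B\<^sub>-\<close>.\<close>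

definition B_sgn :: "real \<Rightarrow> real \<Rightarrow> real" where
  "B_sgn s \<theta> = cos (\<theta> / 3) + s * sqrt ((4 * (cos (\<theta> / 3))\<^sup>2 - 1) / 3)"

definition u_sgn :: "real \<Rightarrow> real \<Rightarrow> real" where
  "u_sgn s \<theta> = B_sgn (- s) \<theta> / B_sgn s \<theta>"

context
  fixes s \<theta> :: real
  assumes s: "s\<^sup>2 = 1" and \<theta>: "0 < \<theta>" "\<theta> < pi"
begin

private abbreviation (input) "cos3 \<equiv> cos (\<theta> / 3)"
private abbreviation (input) "S \<equiv> sin (\<theta> / 3)"
private abbreviation (input) "q \<equiv> sqrt ((4 * cos3\<^sup>2 - 1) / 3)"

private lemma S_pos: "S > 0"
  using \<theta> by (intro sin_gt_zero) auto

private lemma c_gt: "cos3 > 1 / 2"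
  using cos_monotone_0_pi[of "\<theta> / 3" "pi / 3"] \<theta> by (simp add: cos_60)

private lemma cS: "cos3\<^sup>2 + S\<^sup>2 = 1"
  by simp

private lemma q_pos: "q > 0" and q_sq: "q\<^sup>2 = (4 * cos3\<^sup>2 - 1) / 3"
proof -
  have "(1 / 2)\<^sup>2 < cos3\<^sup>2" using c_gt by (intro power_strict_mono) auto
  then show "q > 0" "q\<^sup>2 = (4 * cos3\<^sup>2 - 1) / 3"
    by (auto simp: power2_eq_square)
qed

private lemma triple: "cos \<theta> = 4 * cos3 ^ 3 - 3 * cos3" "sin \<theta> = 3 * S * q\<^sup>2"
proof -
  have th: "\<theta> = 2 * (\<theta> / 3) + \<theta> / 3" by simp
  have "cos \<theta> = cos (2 * (\<theta> / 3)) * cos3 - sin (2 * (\<theta> / 3)) * S"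
    using cos_add[of "2 * (\<theta> / 3)" "\<theta> / 3"] by simp
  also have "\<dots> = 4 * cos3 ^ 3 - 3 * cos3"
    unfolding cos_double sin_double using cS by algebra
  finally show "cos \<theta> = 4 * cos3 ^ 3 - 3 * cos3" .
  have "sin \<theta> = sin (2 * (\<theta> / 3)) * cos3 + cos (2 * (\<theta> / 3)) * S"
    using sin_add[of "2 * (\<theta> / 3)" "\<theta> / 3"] by simp
  also have "\<dots> = S * (4 * cos3\<^sup>2 - 1)"
    unfolding cos_double sin_double using cS by algebra
  finally show "sin \<theta> = 3 * S * q\<^sup>2" unfolding q_sq by simp
qed

private lemma s_cases: "s = 1 \<or> s = - 1"
  using s by (simp add: power2_eq_1_iff)

text \<open>Together with the sum \<open>2 cos (\<theta> / 3)\<close>, this product expresses every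
  symmetric polynomial in the two branches through \<open>cos (\<theta> / 3)\<close>; both
  identities below are obtained in this way.\<close>

lemma B_sgn_mult: "B_sgn s \<theta> * B_sgn (- s) \<theta> = (sin (\<theta> / 3))\<^sup>2 / 3"
proof -
  have "B_sgn s \<theta> * B_sgn (- s) \<theta> = cos3\<^sup>2 - s\<^sup>2 * q\<^sup>2"
    by (simp only: B_sgn_def) algebra
  then show ?thesis unfolding s q_sq by (simp add: sin_squared_eq field_simps)
qed

lemma B_sgn_pos: "B_sgn s \<theta> > 0" and B_sgn_neg_pos: "B_sgn (- s) \<theta> > 0"
proof -
  have "B_sgn 1 \<theta> > 0"
    unfolding B_sgn_def mult_1 using c_gt q_pos by (intro add_pos_pos) simp_all
  moreover have "B_sgn s \<theta> * B_sgn (- s) \<theta> > 0"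
    unfolding B_sgn_mult using S_pos by simp
  ultimately show "B_sgn s \<theta> > 0" "B_sgn (- s) \<theta> > 0"
    using s_cases by (auto simp: zero_less_mult_iff)
qed

text \<open>The form is (sum)^2 + 12 (product), hence 4 cos^2 + 4 sin^2 at \<theta>/3. It is the
  homogenization of \<open>p_f\<close> and fixes the scale of B in terms of u.\<close>

lemma B_sgn_quadratic:
  "(B_sgn s \<theta>)\<^sup>2 + 14 * B_sgn s \<theta> * B_sgn (- s) \<theta> + (B_sgn (- s) \<theta>)\<^sup>2 = 4"
proof -
  have "B_sgn s \<theta> + B_sgn (- s) \<theta> = 2 * cos3" by (simp add: B_sgn_def)
  with B_sgn_mult cS show ?thesis by algebra
qed

lemma cos_eq_B_sgn:
  "cos \<theta> = (B_sgn s \<theta> + B_sgn (- s) \<theta>) *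
     ((B_sgn s \<theta>)\<^sup>2 - 34 * B_sgn s \<theta> * B_sgn (- s) \<theta> + (B_sgn (- s) \<theta>)\<^sup>2) / 8"
proof -
  have sum: "B_sgn s \<theta> + B_sgn (- s) \<theta> = 2 * cos3" by (simp add: B_sgn_def)
  have "(B_sgn s \<theta>)\<^sup>2 - 34 * B_sgn s \<theta> * B_sgn (- s) \<theta> + (B_sgn (- s) \<theta>)\<^sup>2 =
    (B_sgn s \<theta> + B_sgn (- s) \<theta>)\<^sup>2 - 36 * (B_sgn s \<theta> * B_sgn (- s) \<theta>)" by algebra
  also have "\<dots> = 16 * cos3\<^sup>2 - 12" unfolding sum B_sgn_mult using cS by algebra
  finally show ?thesis
    by (simp only: sum triple) (simp add: power2_eq_square power3_eq_cube algebra_simps)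
qed

lemma B_sgn_neq: "B_sgn s \<theta> \<noteq> B_sgn (- s) \<theta>"
  using q_pos s_cases by (auto simp: B_sgn_def)

text \<open>The triple angle formula makes \<open>sin \<theta>\<close> a multiple of
  \<open>q^2\<close>, which clears the reciprocal of the square root. What is left is a polynomial
  in \<open>s * q\<close> and \<open>cos3\<close>, the half-difference and half-sum of the two
  branches.\<close>

lemma B_sgn_derivative:
  obtains D where "(B_sgn s has_real_derivative D) (at \<theta>)"
    and "sin \<theta> * D = - (B_sgn s \<theta> * B_sgn (- s) \<theta> * (B_sgn s \<theta> - B_sgn (- s) \<theta>) *
           (7 * B_sgn s \<theta> + B_sgn (- s) \<theta>) / 4)"
proof
  have dc: "((\<lambda>\<theta>. cos (\<theta> / 3)) has_real_derivative - S / 3) (at \<theta>)"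
    by (auto intro!: derivative_eq_intros)
  have dr: "((\<lambda>\<theta>. (4 * (cos (\<theta> / 3))\<^sup>2 - 1) / 3) has_real_derivative - 8 * cos3 * S / 9) (at \<theta>)"
    by (auto intro!: derivative_eq_intros)
  have dq: "((\<lambda>\<theta>. sqrt ((4 * (cos (\<theta> / 3))\<^sup>2 - 1) / 3)) has_real_derivative
      inverse q / 2 * (- 8 * cos3 * S / 9)) (at \<theta>)"
    by (rule DERIV_chain2[OF DERIV_real_sqrt dr]) (use q_pos in simp)
  have "((\<lambda>\<theta>. cos (\<theta> / 3) + s * sqrt ((4 * (cos (\<theta> / 3))\<^sup>2 - 1) / 3)) has_real_derivative
      - S / 3 + s * (inverse q / 2 * (- 8 * cos3 * S / 9))) (at \<theta>)"
    by (intro DERIV_add DERIV_cmult dc dq)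
  then show "(B_sgn s has_real_derivative - S / 3 + s * (inverse q / 2 * (- 8 * cos3 * S / 9))) (at \<theta>)"
    by (simp add: B_sgn_def[abs_def])
  have "sin \<theta> * (- S / 3 + s * (inverse q / 2 * (- 8 * cos3 * S / 9))) =
      - (S\<^sup>2 / 3) * (3 * q\<^sup>2 + 4 * s * q * cos3)"
    unfolding triple using q_pos by (simp add: field_simps power2_eq_square)
  also have "\<dots> = - (S\<^sup>2 / 3) * ((s * q) * (3 * (s * q) + 4 * cos3))"
    using s by algebra
  \<comment> \<open>With x and y free, half-difference and half-sum can be substituted for
    \<open>s * q\<close> and \<open>cos3\<close> without touching the square root on the
    left.\<close>
  finally have "sin \<theta> * (- S / 3 + s * (inverse q / 2 * (- 8 * cos3 * S / 9))) =
      - (S\<^sup>2 / 3) * (x * (3 * x + 4 * y))" if "x = s * q" "y = cos3" for x y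
    using that by simp
  note eq = this
  have x: "(B_sgn s \<theta> - B_sgn (- s) \<theta>) / 2 = s * q"
    and y: "(B_sgn s \<theta> + B_sgn (- s) \<theta>) / 2 = cos3" by (simp_all add: B_sgn_def)
  show "sin \<theta> * (- S / 3 + s * (inverse q / 2 * (- 8 * cos3 * S / 9))) =
     - (B_sgn s \<theta> * B_sgn (- s) \<theta> * (B_sgn s \<theta> - B_sgn (- s) \<theta>) *
           (7 * B_sgn s \<theta> + B_sgn (- s) \<theta>) / 4)"
    unfolding eq[OF x y] B_sgn_mult by (simp add: field_simps)
qed

end

lemma u_sgn_derivative:
  fixes s \<theta> :: real
  assumes s: "s\<^sup>2 = 1" and \<theta>: "0 < \<theta>" "\<theta> < pi"
  obtains D where "(u_sgn s has_real_derivative D) (at \<theta>)"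
    and "sin \<theta> * D = u_sgn s \<theta> * (1 - u_sgn s \<theta>) * B_sgn s \<theta>"
proof -
  let ?b = "B_sgn s \<theta>" and ?b' = "B_sgn (- s) \<theta>"
  have b: "?b > 0" by (rule B_sgn_pos[OF s \<theta>])
  obtain D where D: "(B_sgn s has_real_derivative D) (at \<theta>)"
    "sin \<theta> * D = - (?b * ?b' * (?b - ?b') * (7 * ?b + ?b') / 4)"
    by (rule B_sgn_derivative[OF s \<theta>])
  have s': "(- s)\<^sup>2 = 1" using s by simp
  obtain D' where D': "(B_sgn (- s) has_real_derivative D') (at \<theta>)"
    "sin \<theta> * D' = - (?b' * ?b * (?b' - ?b) * (7 * ?b' + ?b) / 4)"
    using B_sgn_derivative[OF s' \<theta>] by auto
  have "(u_sgn s has_real_derivative (D' * ?b - ?b' * D) / (?b * ?b)) (at \<theta>)"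
    unfolding u_sgn_def[abs_def] by (rule DERIV_divide[OF D'(1) D(1)]) (use b in simp)
  moreover have "sin \<theta> * ((D' * ?b - ?b' * D) / (?b * ?b)) = u_sgn s \<theta> * (1 - u_sgn s \<theta>) * ?b"
  proof -
    have "sin \<theta> * (D' * ?b - ?b' * D) = ?b * ?b' * (?b - ?b') * (?b\<^sup>2 + 14 * ?b * ?b' + ?b'\<^sup>2) / 4"
    proof -
      have "sin \<theta> * (D' * ?b - ?b' * D) = (sin \<theta> * D') * ?b - ?b' * (sin \<theta> * D)" by algebra
      then show ?thesis unfolding D(2) D'(2) by (simp add: field_simps power2_eq_square)
    qed
    \<comment> \<open>The quotient rule reproduces the homogenized \<open>p_f\<close>, whose
      constant value 4 cancels the denominator.\<close>
    also have "\<dots> = ?b * ?b' * (?b - ?b')"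
      unfolding B_sgn_quadratic[OF s \<theta>] by simp
    finally have "sin \<theta> * ((D' * ?b - ?b' * D) / (?b * ?b)) = ?b * ?b' * (?b - ?b') / (?b * ?b)"
      by simp
    then show ?thesis using b by (simp add: u_sgn_def field_simps)
  qed
  ultimately show ?thesis by (rule that)
qed

context
  fixes s \<theta> :: real
  assumes s: "s\<^sup>2 = 1" and \<theta>: "0 < \<theta>" "\<theta> < pi"
begin

private lemma B': "B_sgn (- s) \<theta> = u_sgn s \<theta> * B_sgn s \<theta>"
  using B_sgn_pos[OF s \<theta>] by (simp add: u_sgn_def)

lemma u_sgn_pos: "u_sgn s \<theta> > 0" and u_sgn_neq_1: "u_sgn s \<theta> \<noteq> 1"
  using B_sgn_pos[OF s \<theta>] B_sgn_neg_pos[OF s \<theta>] B_sgn_neq[OF s \<theta>]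
  by (auto simp: u_sgn_def)

lemma p_f_u_sgn: "(B_sgn s \<theta>)\<^sup>2 * p_f (u_sgn s \<theta>) = 4"
  using B_sgn_quadratic[OF s \<theta>] unfolding B' p_f_def
  by (simp add: power2_eq_square algebra_simps)

lemma p_e_u_sgn: "cos \<theta> = B_sgn s \<theta> ^ 3 * p_e (u_sgn s \<theta>) / 8"
  using cos_eq_B_sgn[OF s \<theta>] unfolding B' p_e_def by algebra

text \<open>Pythagoras with 1 written as \<open>(B^2 p_f / 4)^3\<close>: the difference
  \<open>p_f^3 - p_e^2 = 108 p_v\<close> appears over 64.\<close>

lemma sin_sq_u_sgn:
  "(sin \<theta>)\<^sup>2 = 27 / 16 * u_sgn s \<theta> * (1 - u_sgn s \<theta>) ^ 4 * B_sgn s \<theta> ^ 6"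
proof -
  have "(sin \<theta>)\<^sup>2 = 1 - (cos \<theta>)\<^sup>2" by (simp add: sin_squared_eq)
  also have "\<dots> = ((B_sgn s \<theta>)\<^sup>2 * p_f (u_sgn s \<theta>) / 4) ^ 3 - (B_sgn s \<theta> ^ 3 * p_e (u_sgn s \<theta>) / 8)\<^sup>2"
    unfolding p_f_u_sgn p_e_u_sgn[symmetric] by simp
  also have "\<dots> = 27 / 16 * u_sgn s \<theta> * (1 - u_sgn s \<theta>) ^ 4 * B_sgn s \<theta> ^ 6"
    unfolding p_f_def p_e_def
    by (simp add: field_simps power2_eq_square power3_eq_cube power4_eq_xxxx eval_nat_numeral)
  finally show ?thesis .
qed

lemma sin_B_sgn_derivative:
  obtains D where "(B_sgn s has_real_derivative D) (at \<theta>)"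
    and "sin \<theta> * D = - (B_sgn s \<theta> ^ 4 / 4 * (7 + u_sgn s \<theta>) * u_sgn s \<theta> * (1 - u_sgn s \<theta>))"
proof -
  obtain D where "(B_sgn s has_real_derivative D) (at \<theta>)"
    "sin \<theta> * D = - (B_sgn s \<theta> * B_sgn (- s) \<theta> * (B_sgn s \<theta> - B_sgn (- s) \<theta>) *
           (7 * B_sgn s \<theta> + B_sgn (- s) \<theta>) / 4)"
    by (rule B_sgn_derivative[OF s \<theta>])
  then show ?thesis
    by (intro that) (unfold B', simp_all add: field_simps power4_eq_xxxx)
qed

end

text \<open>With \<open>B = B_sgn s \<theta>\<close> and \<open>u = u_sgn s \<theta>\<close>, the operator \<open>sin \<theta> (d/d\<theta>) + l cos \<theta>\<close> maps
  \<open>(sin \<theta>)\<^sup>-\<^sup>a B\<^sup>e \<rho> u\<close> to \<open>(sin \<theta>)\<^sup>-\<^sup>a B\<^sup>e\<^sup>+\<^sup>3 (ladder_op a e l \<rho> u) / 8\<close>.\<close>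

definition ladder_op :: "real \<Rightarrow> real \<Rightarrow> real \<Rightarrow> (real \<Rightarrow> real) \<Rightarrow> real \<Rightarrow> real" where
  "ladder_op a e l \<rho> u = 2 * u * (1 - u) * p_f u * deriv \<rho> u
     + ((l - a) * p_e u - 2 * e * (7 + u) * u * (1 - u)) * \<rho> u"

lemma theta_ladder:
  assumes s: "s\<^sup>2 = 1" and \<theta>: "0 < \<theta>" "\<theta> < pi"
    and \<rho>: "\<rho> field_differentiable at (u_sgn s \<theta>)"
    and Y: "\<And>t. 0 < t \<Longrightarrow> t < pi \<Longrightarrow>
              Y t = C * sin t powr (- a) * B_sgn s t powr e * \<rho> (u_sgn s t)"
    and D: "(Y has_real_derivative D) (at \<theta>)"
  shows "sin \<theta> * D + l * cos \<theta> * Y \<theta> =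
           C / 8 * sin \<theta> powr (- a) * B_sgn s \<theta> powr (e + 3) * ladder_op a e l \<rho> (u_sgn s \<theta>)"
proof -
  let ?u = "u_sgn s \<theta>" and ?B = "B_sgn s \<theta>"
  define sp where "sp = sin \<theta> powr (- a)"
  define Bp where "Bp = ?B powr e"
  have sin: "sin \<theta> > 0" using \<theta> by (rule sin_gt_zero)
  have B: "?B > 0" by (rule B_sgn_pos[OF s \<theta>])
  obtain B' where B': "(B_sgn s has_real_derivative B') (at \<theta>)"
    "sin \<theta> * B' = - (?B ^ 4 / 4 * (7 + ?u) * ?u * (1 - ?u))"
    by (rule sin_B_sgn_derivative[OF s \<theta>])
  obtain u' where u': "(u_sgn s has_real_derivative u') (at \<theta>)" "sin \<theta> * u' = ?u * (1 - ?u) * ?B"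
    by (rule u_sgn_derivative[OF s \<theta>])
  have d\<rho>: "((\<lambda>t. \<rho> (u_sgn s t)) has_real_derivative deriv \<rho> ?u * u') (at \<theta>)"
    using \<rho> u'(1) by (intro DERIV_chain2[of \<rho>]) (auto simp: DERIV_deriv_iff_field_differentiable)
  have dsp: "((\<lambda>t. sin t powr (- a)) has_real_derivative - a * cos \<theta> / sin \<theta> * sp) (at \<theta>)"
    using has_real_derivative_powr'[OF DERIV_sin[of \<theta>], of "\<lambda>_. - a" 0] sin
    by (simp add: sp_def field_simps)
  have dBp: "((\<lambda>t. B_sgn s t powr e) has_real_derivative e * B' / ?B * Bp) (at \<theta>)"
    using has_real_derivative_powr'[OF B'(1), of "\<lambda>_. e" 0] B
    by (simp add: Bp_def field_simps)
  define E where "E = C * ((- a * cos \<theta> / sin \<theta> * sp * Bp + e * B' / ?B * Bp * sp) * \<rho> ?u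
      + deriv \<rho> ?u * u' * (sp * Bp))"
  have "((\<lambda>t. C * (sin t powr (- a) * B_sgn s t powr e * \<rho> (u_sgn s t))) has_real_derivative E) (at \<theta>)"
    using DERIV_cmult[OF DERIV_mult[OF DERIV_mult[OF dsp dBp] d\<rho>], of C]
    by (simp add: E_def sp_def Bp_def)
  moreover have "\<forall>\<^sub>F t in nhds \<theta>. Y t = C * (sin t powr (- a) * B_sgn s t powr e * \<rho> (u_sgn s t))"
    using eventually_nhds_in_open[of "{0<..<pi}" \<theta>] \<theta>
    by (auto elim!: eventually_mono simp: Y mult.assoc)
  ultimately have "(Y has_real_derivative E) (at \<theta>)"
    by (subst DERIV_cong_ev[OF refl _ refl])
  then have "D = E" using D by (rule DERIV_unique[rotated])
  have "sin \<theta> * E = C * sp * Bp * ((- a * cos \<theta> + e * (sin \<theta> * B') / ?B) * \<rho> ?u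
      + deriv \<rho> ?u * (sin \<theta> * u'))"
    using sin B by (simp add: E_def field_simps)
  also have "e * (sin \<theta> * B') / ?B = - e * (?B ^ 3 / 4 * (7 + ?u) * ?u * (1 - ?u))"
    unfolding B'(2) using B by (simp add: power4_eq_xxxx power3_eq_cube)
  \<comment> \<open>Inserting \<open>1 = B^2 p_f / 4\<close> raises this term from degree 1 to
    degree 3 in B, so that all terms share the factor \<open>B^3 / 8\<close>.\<close>
  also have "sin \<theta> * u' = ?u * (1 - ?u) * ?B ^ 3 * p_f ?u / 4"
  proof -
    have "?B ^ 3 * p_f ?u = ?B * (?B\<^sup>2 * p_f ?u)" by (simp add: power2_eq_square power3_eq_cube)
    then have "?B ^ 3 * p_f ?u = 4 * ?B" unfolding p_f_u_sgn[OF s \<theta>] by simp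
    then show ?thesis unfolding u'(2) by (simp add: mult.assoc)
  qed
  finally have sE: "sin \<theta> * E = C * sp * Bp * ((- a * (?B ^ 3 * p_e ?u / 8)
       - e * (?B ^ 3 / 4 * (7 + ?u) * ?u * (1 - ?u))) * \<rho> ?u
      + deriv \<rho> ?u * (?u * (1 - ?u) * ?B ^ 3 * p_f ?u / 4))"
    unfolding p_e_u_sgn[OF s \<theta>] by simp
  have Y\<theta>: "Y \<theta> = C * sp * Bp * \<rho> ?u" using Y \<theta> by (simp add: sp_def Bp_def)
  have "sin \<theta> * D + l * cos \<theta> * Y \<theta> = C / 8 * sp * (Bp * ?B ^ 3) * ladder_op a e l \<rho> ?u"
    unfolding \<open>D = E\<close> sE Y\<theta> p_e_u_sgn[OF s \<theta>] ladder_op_def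
    by (simp add: field_simps)
  moreover have "Bp * ?B ^ 3 = ?B powr (e + 3)"
    using B by (simp add: Bp_def powr_add)
  ultimately show ?thesis by (simp add: sp_def)
qed

section \<open>The base case on the interval\<close>

lemma nonintI:
  assumes "real_of_int q * x = real_of_int p" "\<not> q dvd p"
  shows "x \<notin> \<int>"
proof
  assume "x \<in> \<int>"
  then obtain z where "x = real_of_int z" by (rule Ints_cases)
  with assms(1) have "q * z = p" by (simp flip: of_int_mult)
  with assms(2) show False by auto
qed

text \<open>Replaces an initial condition: 0 is a singular point of the equations to which this is
  applied, and only a one-sided limit is available there.\<close>

lemma eq_limit_at_right_0_if_derivative_0:
  fixes f :: "real \<Rightarrow> real"
  assumes "\<And>t. 0 < t \<Longrightarrow> t < a \<Longrightarrow> (f has_real_derivative 0) (at t)"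
    and "(f \<longlongrightarrow> L) (at_right 0)" and x: "0 < x" "x < a"
  shows "f x = L"
proof -
  have "\<exists>k. \<forall>t\<in>{0<..<a}. f t = k"
    by (rule has_field_derivative_zero_constant)
      (simp_all add: assms(1) has_field_derivative_at_within)
  then have c: "f t = f x" if "0 < t" "t < a" for t
    using that x by (metis greaterThanLessThan_iff)
  have "\<forall>\<^sub>F t in at_right 0. f t = f x"
    using eventually_at_right_real[of 0 a] x by (auto elim!: eventually_mono intro: c)
  then have "(f \<longlongrightarrow> f x) (at_right 0)"
    by (simp add: tendsto_eventually)
  with assms(2) show ?thesis
    by (metis tendsto_unique trivial_limit_at_right_real)
qed

lemma B_sgn_tendsto_0: "(B_sgn s \<longlongrightarrow> 1 + s) (at_right 0)"
proof -
  have "(B_sgn s \<longlongrightarrow> cos (0 / 3) + s * sqrt ((4 * (cos (0 / 3))\<^sup>2 - 1) / 3)) (at_right 0)"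
    unfolding B_sgn_def[abs_def] by (intro tendsto_intros) auto
  then show ?thesis by simp
qed

text \<open>The algebraic solution for both orders at n = m = 0. The constant k normalizes it at
  \<theta> = 0: for s = -1 numerator and denominator vanish like \<theta>^2/54 and \<theta>^2/2,
  whose quotient is 1/27.\<close>

lemma gauss_B_sgn:
  fixes s \<theta> k :: real
  assumes s: "s = 1 \<and> k = 1 \<or> s = - 1 \<and> k = 27" and \<theta>: "0 < \<theta>" "\<theta> < pi"
  shows "gauss_2F1 (1/6) (5/6) (1 - s / 4) ((1 - cos \<theta>) / 2) =
           (k * B_sgn s \<theta> / (1 + s * cos \<theta>)) powr (1/4)"
proof -
  have s2: "s\<^sup>2 = 1" and s2': "(- s)\<^sup>2 = 1" and k: "k > 0" using s by auto
  \<comment> \<open>\<open>\<beta>\<close> and \<open>L\<close> are sin t times the logarithmic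
    derivatives of \<open>B_sgn s\<close> and \<open>y2\<close>; the denominator of \<open>Z\<close>
    contributes \<open>s (sin t)^2 / (1 + s cos t) = s - cos t\<close>.\<close>
  define \<beta> where "\<beta> = (\<lambda>t. - (B_sgn (- s) t * (B_sgn s t - B_sgn (- s) t) * (7 * B_sgn s t + B_sgn (- s) t) / 4))"
  define L where "L = (\<lambda>t. (\<beta> t + s - cos t) / 4)"
  define Z where "Z = (\<lambda>t. k * B_sgn s t / (1 + s * cos t))"
  define y1 where "y1 = (\<lambda>t. gauss_2F1 (1/6) (5/6) (1 - s / 4) ((1 - cos t) / 2))"
  define y1' where "y1' = (\<lambda>t. gauss_deriv (1/6) (5/6) (1 - s / 4) ((1 - cos t) / 2))"
  define y2 where "y2 = (\<lambda>t. Z t powr (1/4))"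
  \<comment> \<open>\<open>w\<close> is \<open>sin t\<close> times the Wronskian of \<open>y1\<close> and \<open>y2\<close>; it satisfies \<open>w' = s w / (2 sin t)\<close>, so
    \<open>w M\<close> is constant, and it tends to \<open>0\<close> at \<open>0\<close>.\<close>
  define w where "w = (\<lambda>t. y2 t * (y1 t * L t - (sin t)\<^sup>2 / 2 * y1' t))"
  define M where "M = (\<lambda>t. tan (t / 2) powr (- s / 2))"
  have nonint: "(1/6::real) \<notin> \<int>" "(5/6::real) \<notin> \<int>" "1 - s / 4 \<notin> \<int>"
    using s by (auto intro: nonintI[of 6 _ 1] nonintI[of 6 _ 5] nonintI[of 4 _ 3] nonintI[of 4 _ 5])
  have cos_bounds: "- 1 < cos t" "cos t < 1" if "0 < t" "t < pi" for t
    using cos_monotone_0_pi[of 0 t] cos_monotone_0_pi[of t pi] that by auto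
  have one_s_cos: "1 + s * cos t > 0" if "0 < t" "t < pi" for t
    using cos_bounds[OF that] s by auto
  have small: "\<bar>(1 - cos t) / 2\<bar> < 1" if "0 < t" "t < pi" for t
    using cos_bounds[OF that] by auto
  have Z_pos: "Z t > 0" if "0 < t" "t < pi" for t
    unfolding Z_def using k B_sgn_pos[OF s2 that] one_s_cos[OF that] by simp
  have y2_pos: "y2 t > 0" if "0 < t" "t < pi" for t
    unfolding y2_def using Z_pos[OF that] by simp
  have dy2: "(y2 has_real_derivative y2 t * L t / sin t) (at t)" if t: "0 < t" "t < pi" for t
  proof -
    have sin: "sin t > 0" using t by (rule sin_gt_zero)
    obtain D where D: "(B_sgn s has_real_derivative D) (at t)"
      "sin t * D = - (B_sgn s t * B_sgn (- s) t * (B_sgn s t - B_sgn (- s) t) * (7 * B_sgn s t + B_sgn (- s) t) / 4)"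
      by (rule B_sgn_derivative[OF s2 t])
    have "(Z has_real_derivative (k * D * (1 + s * cos t) - k * B_sgn s t * (- s * sin t)) /
        ((1 + s * cos t) * (1 + s * cos t))) (at t)"
      unfolding Z_def using one_s_cos[OF t] D(1) by (auto intro!: derivative_eq_intros)
    moreover have "(k * D * (1 + s * cos t) - k * B_sgn s t * (- s * sin t)) /
        ((1 + s * cos t) * (1 + s * cos t)) = Z t * (4 * L t) / sin t"
    proof -
      have D_eq: "D = B_sgn s t * \<beta> t / sin t" using D(2) sin by (simp add: \<beta>_def field_simps)
      have s_sin: "s * sin t = (s - cos t) * (1 + s * cos t) / sin t"
      proof -
        have "(s - cos t) * (1 + s * cos t) = s * (sin t)\<^sup>2"
          using s2 unfolding sin_squared_eq by algebra
        then show ?thesis using sin by (simp add: power2_eq_square)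
      qed
      have "k * D * (1 + s * cos t) - k * B_sgn s t * (- s * sin t) =
          k * D * (1 + s * cos t) + k * B_sgn s t * (s * sin t)" by simp
      also have "\<dots> = k * B_sgn s t * (1 + s * cos t) * (4 * L t) / sin t"
        unfolding s_sin unfolding D_eq L_def using sin by (simp add: divide_simps) (simp add: algebra_simps)
      finally show ?thesis using one_s_cos[OF t] by (simp add: Z_def) (simp add: mult.commute)
    qed
    ultimately have "(Z has_real_derivative Z t * (4 * L t) / sin t) (at t)" by simp
    from has_real_derivative_powr'[OF this, of "\<lambda>_. 1/4" 0] Z_pos[OF t]
    show ?thesis by (simp add: y2_def)
  qed
  have dy1: "(y1 has_real_derivative y1' t * (sin t / 2)) (at t)" if t: "0 < t" "t < pi" for t
    unfolding y1_def y1'_def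
    by (rule DERIV_chain2[where g = "\<lambda>t. (1 - cos t) / 2", OF gauss_2F1_has_derivative[OF nonint small[OF t]]])
      (auto intro!: derivative_eq_intros)
  have dw: "(w has_real_derivative s / 2 * w t / sin t) (at t)" if t: "0 < t" "t < pi" for t
  proof -
    have sin: "sin t > 0" using t by (rule sin_gt_zero)
    let ?b = "B_sgn s t" and ?b' = "B_sgn (- s) t"
    obtain D where D: "(B_sgn s has_real_derivative D) (at t)"
      "sin t * D = - (?b * ?b' * (?b - ?b') * (7 * ?b + ?b') / 4)"
      by (rule B_sgn_derivative[OF s2 t])
    obtain D' where D': "(B_sgn (- s) has_real_derivative D') (at t)"
      "sin t * D' = - (?b' * ?b * (?b' - ?b) * (7 * ?b' + ?b) / 4)"
      using B_sgn_derivative[OF s2' t] by auto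
    define \<beta>' where "\<beta>' = - ((14 * ?b * ?b' - 6 * ?b'\<^sup>2) * D + (7 * ?b\<^sup>2 - 12 * ?b * ?b' - 3 * ?b'\<^sup>2) * D') / 4"
    have d\<beta>: "(\<beta> has_real_derivative \<beta>') (at t)"
      unfolding \<beta>_def \<beta>'_def using D(1) D'(1)
      by (auto intro!: derivative_eq_intros simp: power2_eq_square field_simps)
    have dL: "(L has_real_derivative (\<beta>' + sin t) / 4) (at t)"
      unfolding L_def using d\<beta> by (auto intro!: derivative_eq_intros)
    \<comment> \<open>All terms on the left are forms of degree 6 in the two branches. Their sum is
      a multiple of the cube of the quadratic form, which is constant.\<close>
    have homogeneous: "(\<beta> t - cos t)\<^sup>2 / 16 + sin t * \<beta>' / 4 + (sin t)\<^sup>2 / 9 = 1 / 16"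
    proof -
      have "sin t * \<beta>' = - ((14 * ?b * ?b' - 6 * ?b'\<^sup>2) * (sin t * D)
          + (7 * ?b\<^sup>2 - 12 * ?b * ?b' - 3 * ?b'\<^sup>2) * (sin t * D')) / 4"
        by (simp add: \<beta>'_def algebra_simps)
      moreover have "(sin t)\<^sup>2 = 27 / 16 * ?b * ?b' * (?b - ?b') ^ 4"
      proof -
        have b': "?b' = u_sgn s t * ?b" using B_sgn_pos[OF s2 t] by (simp add: u_sgn_def)
        then have "?b - ?b' = ?b * (1 - u_sgn s t)" by (simp add: algebra_simps)
        then show ?thesis
          unfolding sin_sq_u_sgn[OF s2 t] by (simp add: b' power_mult_distrib eval_nat_numeral)
      qed
      ultimately have "(\<beta> t - cos t)\<^sup>2 / 16 + sin t * \<beta>' / 4 + (sin t)\<^sup>2 / 9 =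
          ((?b\<^sup>2 + 14 * ?b * ?b' + ?b'\<^sup>2) / 4) ^ 3 / 16"
        unfolding D(2) D'(2) cos_eq_B_sgn[OF s2 t] \<beta>_def
        by (simp add: field_simps power2_eq_square power3_eq_cube power4_eq_xxxx)
      then show ?thesis unfolding B_sgn_quadratic[OF s2 t] by simp
    qed
    \<comment> \<open>The hypergeometric equation for \<open>y2\<close>, written as the Riccati
      equation of its logarithmic derivative; 5/36 is the product of the upper parameters 1/6 and
      5/6.\<close>
    have riccati: "(L t)\<^sup>2 + sin t * ((\<beta>' + sin t) / 4) - s / 2 * L t = 5 / 36 * (sin t)\<^sup>2"
    proof -
      have "16 * ((L t)\<^sup>2 - s / 2 * L t) = (\<beta> t - cos t)\<^sup>2 - s\<^sup>2"
        by (simp add: L_def power2_eq_square field_simps)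
      then show ?thesis using homogeneous unfolding s2 by (simp add: field_simps power2_eq_square)
    qed
    obtain E where E: "(gauss_deriv (1/6) (5/6) (1 - s / 4) has_real_derivative E) (at ((1 - cos t) / 2))"
      and ode: "(1 - cos t) / 2 * (1 - (1 - cos t) / 2) * E
         + ((1 - s / 4) - (1/6 + 5/6 + 1) * ((1 - cos t) / 2)) * y1' t = 1/6 * (5/6) * y1 t"
      using gauss_ode[OF nonint small[OF t]] unfolding y1_def y1'_def by blast
    have dy1': "(y1' has_real_derivative E * (sin t / 2)) (at t)"
      unfolding y1'_def by (rule DERIV_chain2[where g = "\<lambda>t. (1 - cos t) / 2", OF E]) (auto intro!: derivative_eq_intros)
    have ode': "(sin t)\<^sup>2 / 4 * E = 5/36 * y1 t - (cos t - s / 4) * y1' t"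
    proof -
      have e: "(1 - cos t) / 2 * (1 - (1 - cos t) / 2) = (sin t)\<^sup>2 / 4"
        unfolding sin_squared_eq by (simp add: power2_eq_square field_simps)
      show ?thesis using ode unfolding e by (simp add: field_simps)
    qed
    have dsq: "((\<lambda>t. (sin t)\<^sup>2 / 2) has_real_derivative sin t * cos t) (at t)"
      by (auto intro!: derivative_eq_intros)
    have "(w has_real_derivative y2 t * L t / sin t * (y1 t * L t - (sin t)\<^sup>2 / 2 * y1' t)
        + (y1' t * (sin t / 2) * L t + (\<beta>' + sin t) / 4 * y1 t
           - (sin t * cos t * y1' t + E * (sin t / 2) * ((sin t)\<^sup>2 / 2))) * y2 t) (at t)"
      unfolding w_def
      by (rule DERIV_mult[OF dy2[OF t] DERIV_diff[OF DERIV_mult[OF dy1[OF t] dL] DERIV_mult[OF dsq dy1']]])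
    moreover have "y2 t * L t / sin t * (y1 t * L t - (sin t)\<^sup>2 / 2 * y1' t)
        + (y1' t * (sin t / 2) * L t + (\<beta>' + sin t) / 4 * y1 t
           - (sin t * cos t * y1' t + E * (sin t / 2) * ((sin t)\<^sup>2 / 2))) * y2 t
        = s / 2 * w t / sin t"
    proof -
      let ?lhs = "y2 t * L t * (y1 t * L t - (sin t)\<^sup>2 / 2 * y1' t)
        + ((sin t)\<^sup>2 / 2 * y1' t * L t + (sin t * ((\<beta>' + sin t) / 4)) * y1 t
           - ((sin t)\<^sup>2 * cos t * y1' t + (sin t)\<^sup>2 * ((sin t)\<^sup>2 / 4 * E))) * y2 t"
      have "?lhs = s / 2 * w t"
      proof -
        have "?lhs = y2 t * (y1 t * ((L t)\<^sup>2 + sin t * ((\<beta>' + sin t) / 4) - 5 / 36 * (sin t)\<^sup>2)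
            - s / 4 * (sin t)\<^sup>2 * y1' t)"
          unfolding ode' by (simp add: power2_eq_square algebra_simps)
        also have "(L t)\<^sup>2 + sin t * ((\<beta>' + sin t) / 4) - 5 / 36 * (sin t)\<^sup>2 = s / 2 * L t"
          using riccati by simp
        finally show ?thesis by (simp add: w_def algebra_simps)
      qed
      moreover have "y2 t * L t / sin t * (y1 t * L t - (sin t)\<^sup>2 / 2 * y1' t)
        + (y1' t * (sin t / 2) * L t + (\<beta>' + sin t) / 4 * y1 t
           - (sin t * cos t * y1' t + E * (sin t / 2) * ((sin t)\<^sup>2 / 2))) * y2 t = ?lhs / sin t"
        using sin by (simp add: field_simps power2_eq_square)
      ultimately show ?thesis by (simp only:)
    qed
    ultimately show ?thesis by simp
  qed
  \<comment> \<open>\<open>tan (t / 2)\<close> has logarithmic derivative \<open>1 / sin t\<close>,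
    so its power -s/2 is the integrating factor for w.\<close>
  have M_pos: "M t > 0" and dM: "(M has_real_derivative - s / 2 * M t / sin t) (at t)"
    if t: "0 < t" "t < pi" for t
  proof -
    have sc: "sin (t / 2) > 0" "cos (t / 2) > 0"
      using t by (auto intro!: sin_gt_zero cos_gt_zero)
    then have tan: "tan (t / 2) > 0" by (simp add: tan_def)
    have "((\<lambda>t. tan (t / 2)) has_real_derivative inverse ((cos (t / 2))\<^sup>2) * (1 / 2)) (at t)"
      using sc by (intro DERIV_chain2[OF DERIV_tan]) (auto intro!: derivative_eq_intros)
    moreover have "inverse ((cos (t / 2))\<^sup>2) * (1 / 2) = tan (t / 2) / sin t"
      using sc sin_double[of "t / 2"] by (simp add: tan_def field_simps power2_eq_square)
    ultimately have "((\<lambda>t. tan (t / 2)) has_real_derivative tan (t / 2) / sin t) (at t)" by simp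
    from has_real_derivative_powr'[OF this, of "\<lambda>_. - s / 2" 0] tan
    show "(M has_real_derivative - s / 2 * M t / sin t) (at t)" by (simp add: M_def mult.commute)
    show "M t > 0" using tan by (simp add: M_def)
  qed
  have t0: "((\<lambda>t::real. (1 - cos t) / 2) \<longlongrightarrow> 0) (at_right 0)" by real_asymp
  have y1_lim: "(y1 \<longlongrightarrow> 1) (at_right 0)"
    unfolding y1_def
    using isCont_tendsto_compose[OF DERIV_isCont[OF gauss_2F1_has_derivative[OF nonint, of 0]] t0] by simp
  obtain G where "(gauss_deriv (1/6) (5/6) (1 - s / 4) has_real_derivative G) (at 0)"
    using gauss_ode[OF nonint, of 0] by auto
  from isCont_tendsto_compose[OF DERIV_isCont[OF this] t0]
  have y1'_lim: "(y1' \<longlongrightarrow> gauss_deriv (1/6) (5/6) (1 - s / 4) 0) (at_right 0)"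
    unfolding y1'_def .
  have near: "\<forall>\<^sub>F t in at_right 0. 0 < t \<and> t < pi"
    using eventually_at_right_real[of 0 pi] by (auto elim!: eventually_mono)
  have Z_lim: "(Z \<longlongrightarrow> 1) (at_right 0)"
  proof (cases "s = 1")
    case True
    then have "k = 1" using s by auto
    have "(Z \<longlongrightarrow> k * (1 + s) / (1 + s * cos 0)) (at_right 0)"
      unfolding Z_def by (intro tendsto_intros B_sgn_tendsto_0) (simp add: True)
    then show ?thesis by (simp add: True \<open>k = 1\<close>)
  next
    case False
    then have sk: "s = - 1" "k = 27" using s by auto
    \<comment> \<open>For s = -1 the quotient \<open>Z\<close> is of type 0/0; the product of the
      branches rewrites \<open>B_sgn (-1)\<close> as \<open>(sin (t/3))^2 / 3\<close> over the
      branch that stays positive.\<close>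
    have "((\<lambda>t::real. (sin (t / 3))\<^sup>2 / (1 - cos t)) \<longlongrightarrow> (1 / 3)\<^sup>2 * 2) (at_right 0)"
      by real_asymp
    then have "((\<lambda>t::real. (sin (t / 3))\<^sup>2 / (1 - cos t)) \<longlongrightarrow> 2 / 9) (at_right 0)"
      by (simp add: power2_eq_square)
    from tendsto_divide[OF tendsto_mult[OF tendsto_const this, of 9] B_sgn_tendsto_0, of 1]
    have "((\<lambda>t. 9 * ((sin (t / 3))\<^sup>2 / (1 - cos t)) / B_sgn 1 t) \<longlongrightarrow> 1) (at_right 0)" by simp
    moreover have "\<forall>\<^sub>F t in at_right 0. Z t = 9 * ((sin (t / 3))\<^sup>2 / (1 - cos t)) / B_sgn 1 t"
      using near
    proof eventually_elim
      case (elim t)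
      then have t: "0 < t" "t < pi" by auto
      have "B_sgn 1 t > 0" by (rule B_sgn_pos) (use t in auto)
      moreover have "B_sgn 1 t * B_sgn (- 1) t = (sin (t / 3))\<^sup>2 / 3"
        by (rule B_sgn_mult) (use t in auto)
      ultimately have "B_sgn (- 1) t = (sin (t / 3))\<^sup>2 / 3 / B_sgn 1 t" by (simp add: field_simps)
      then show ?case by (simp add: Z_def sk)
    qed
    ultimately show ?thesis by (subst tendsto_cong)
  qed
  have y2_lim: "(y2 \<longlongrightarrow> 1) (at_right 0)"
    using tendsto_powr[OF Z_lim tendsto_const, of "1/4"] by (simp add: y2_def)
  have \<beta>_lim: "(\<beta> \<longlongrightarrow> - ((1 + - s) * ((1 + s) - (1 + - s)) * (7 * (1 + s) + (1 + - s)) / 4)) (at_right 0)"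
    unfolding \<beta>_def by (intro tendsto_intros B_sgn_tendsto_0) auto
  \<comment> \<open>For s = 1, M grows like t^(-1/2) and the limit rests on L being of order t^2:
    \<open>\<beta>\<close> contains the vanishing branch, and \<open>s - cos t\<close> becomes
    \<open>1 - cos t\<close>. For s = -1, M tends to 0 and L stays bounded.\<close>
  have "((\<lambda>t. M t * L t) \<longlongrightarrow> 0) (at_right 0) \<and> ((\<lambda>t. M t * (sin t)\<^sup>2) \<longlongrightarrow> 0) (at_right 0)"
  proof (cases "s = 1")
    case True
    have 1: "((\<lambda>t. tan (t / 2) powr (- 1 / 2) * (sin (t / 3))\<^sup>2) \<longlongrightarrow> 0) (at_right (0::real))" by real_asymp
    have 2: "((\<lambda>t. tan (t / 2) powr (- 1 / 2) * (1 - cos t)) \<longlongrightarrow> 0) (at_right (0::real))" by real_asymp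
    have "((\<lambda>t. (- (tan (t / 2) powr (- 1 / 2) * (sin (t / 3))\<^sup>2) * (B_sgn 1 t - B_sgn (- 1) t) * (7 * B_sgn 1 t + B_sgn (- 1) t) / (12 * B_sgn 1 t)
        + tan (t / 2) powr (- 1 / 2) * (1 - cos t)) / 4) \<longlongrightarrow>
        (- 0 * (1 + 1 - (1 + - 1)) * (7 * (1 + 1) + (1 + - 1)) / (12 * (1 + 1)) + 0) / 4) (at_right 0)"
      by (intro tendsto_intros B_sgn_tendsto_0 1 2) auto
    moreover have "\<forall>\<^sub>F t in at_right 0. M t * L t = (- (tan (t / 2) powr (- 1 / 2) * (sin (t / 3))\<^sup>2) * (B_sgn 1 t - B_sgn (- 1) t) * (7 * B_sgn 1 t + B_sgn (- 1) t) / (12 * B_sgn 1 t)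
        + tan (t / 2) powr (- 1 / 2) * (1 - cos t)) / 4"
      using near
    proof eventually_elim
      case (elim t)
      then have t: "0 < t" "t < pi" by auto
      have pos: "B_sgn 1 t > 0" by (rule B_sgn_pos) (use t in auto)
      have "B_sgn 1 t * B_sgn (- 1) t = (sin (t / 3))\<^sup>2 / 3"
        by (rule B_sgn_mult) (use t in auto)
      then have "(sin (t / 3))\<^sup>2 = 3 * B_sgn 1 t * B_sgn (- 1) t" by simp
      then show ?case using pos
        by (simp only: M_def L_def \<beta>_def True) (simp add: field_simps)
    qed
    ultimately have "((\<lambda>t. M t * L t) \<longlongrightarrow>
        (- 0 * (1 + 1 - (1 + - 1)) * (7 * (1 + 1) + (1 + - 1)) / (12 * (1 + 1)) + 0) / 4) (at_right 0)"
      by (subst tendsto_cong)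
    then have "((\<lambda>t. M t * L t) \<longlongrightarrow> 0) (at_right 0)" by simp
    moreover have "((\<lambda>t. tan (t / 2) powr (- 1 / 2) * (sin t)\<^sup>2) \<longlongrightarrow> 0) (at_right (0::real))" by real_asymp
    ultimately show ?thesis by (simp add: M_def True)
  next
    case False
    then have s1: "s = - 1" using s by auto
    have "((\<lambda>t. tan (t / 2) powr (1 / 2)) \<longlongrightarrow> 0) (at_right (0::real))" by real_asymp
    then have M0: "(M \<longlongrightarrow> 0) (at_right 0)" by (simp add: M_def s1)
    have L_lim: "(L \<longlongrightarrow> (- ((1 + - s) * ((1 + s) - (1 + - s)) * (7 * (1 + s) + (1 + - s)) / 4) + s - cos 0) / 4) (at_right 0)"
      unfolding L_def by (intro tendsto_intros \<beta>_lim) auto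
    have sin_lim: "((\<lambda>t. (sin t)\<^sup>2) \<longlongrightarrow> 0) (at_right (0::real))" by real_asymp
    show ?thesis
      using tendsto_mult[OF M0 L_lim] tendsto_mult[OF M0 sin_lim] by simp
  qed
  then have M_L: "((\<lambda>t. M t * L t) \<longlongrightarrow> 0) (at_right 0)" and M_sin: "((\<lambda>t. M t * (sin t)\<^sup>2) \<longlongrightarrow> 0) (at_right 0)"
    by auto
  have "((\<lambda>t. y2 t * (y1 t * (M t * L t) - (M t * (sin t)\<^sup>2) / 2 * y1' t)) \<longlongrightarrow>
      1 * (1 * 0 - 0 / 2 * gauss_deriv (1/6) (5/6) (1 - s / 4) 0)) (at_right 0)"
    by (intro tendsto_intros y1_lim y2_lim y1'_lim M_L M_sin) auto
  then have wM_lim: "((\<lambda>t. w t * M t) \<longlongrightarrow> 0) (at_right 0)"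
    by (simp add: w_def algebra_simps)
  have wM: "w t * M t = 0" if "0 < t" "t < pi" for t
  proof (rule eq_limit_at_right_0_if_derivative_0[OF _ wM_lim that])
    fix t :: real assume t: "0 < t" "t < pi"
    show "((\<lambda>t. w t * M t) has_real_derivative 0) (at t)"
      using DERIV_mult[OF dw[OF t] dM[OF t]] by simp
  qed
  have w0: "y1 t * L t = (sin t)\<^sup>2 / 2 * y1' t" if "0 < t" "t < pi" for t
    using wM[OF that] M_pos[OF that] y2_pos[OF that] by (simp add: w_def)
  have quot_lim: "((\<lambda>t. y1 t / y2 t) \<longlongrightarrow> 1) (at_right 0)"
    using tendsto_divide[OF y1_lim y2_lim] by simp
  have "y1 \<theta> / y2 \<theta> = 1"
  proof (rule eq_limit_at_right_0_if_derivative_0[OF _ quot_lim \<theta>])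
    fix t :: real assume t: "0 < t" "t < pi"
    have sin: "sin t > 0" using t by (rule sin_gt_zero)
    have "y1' t * (sin t / 2) * y2 t - y1 t * (y2 t * L t / sin t) = y2 t / sin t * ((sin t)\<^sup>2 / 2 * y1' t - y1 t * L t)"
      using sin by (simp add: field_simps power2_eq_square)
    also have "\<dots> = 0" using w0[OF t] by simp
    finally show "((\<lambda>t. y1 t / y2 t) has_real_derivative 0) (at t)"
      using DERIV_divide[OF dy1[OF t] dy2[OF t]] y2_pos[OF t] by simp
  qed
  then show ?thesis using y2_pos[OF \<theta>] by (simp add: y1_def y2_def Z_def)
qed

text \<open>The fourth root of \<open>1 + s cos \<theta>\<close> in the denominator changes the
  exponent 1/8 of this factor in the Ferrers prefactor into -1/8. The other factor
  \<open>1 - s cos \<theta>\<close> already has exponent -1/8, and together they are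
  \<open>sin \<theta> powr (-1/4)\<close>.\<close>

lemma ferrers_P_base:
  fixes s \<theta> k :: real
  assumes s: "s = 1 \<and> k = 1 \<or> s = - 1 \<and> k = 27" and \<theta>: "0 < \<theta>" "\<theta> < pi"
  shows "ferrers_P (- 1/6) (s / 4) (cos \<theta>) =
           k powr (1/4) * inverse (Gamma (1 - s / 4)) * sin \<theta> powr (- 1/4) * B_sgn s \<theta> powr (1/4)"
proof -
  have sin: "sin \<theta> > 0" using \<theta> by (rule sin_gt_zero)
  have s2: "s\<^sup>2 = 1" and k: "k > 0" using s by auto
  have B: "B_sgn s \<theta> > 0" by (rule B_sgn_pos[OF s2 \<theta>])
  have c: "1 - cos \<theta> > 0" "1 + cos \<theta> > 0"
    using cos_monotone_0_pi[of 0 \<theta>] cos_monotone_0_pi[of \<theta> pi] \<theta> by auto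
  have sin_powr: "sin \<theta> powr (- 1/4) = (1 - cos \<theta>) powr (- 1/8) * (1 + cos \<theta>) powr (- 1/8)"
  proof -
    have "(sin \<theta>)\<^sup>2 = (1 - cos \<theta>) * (1 + cos \<theta>)"
      unfolding sin_squared_eq by (simp add: power2_eq_square algebra_simps)
    then have "((1 - cos \<theta>) * (1 + cos \<theta>)) powr (- 1/8) = (sin \<theta> powr 2) powr (- 1/8)"
      using sin by (simp add: powr_numeral)
    then show ?thesis using c by (simp add: powr_powr powr_mult)
  qed
  have quot: "((1 + cos \<theta>) / (1 - cos \<theta>)) powr (s / 8) = (1 + cos \<theta>) powr (s / 8) * (1 - cos \<theta>) powr (- s / 8)"
    using c by (simp add: powr_divide powr_minus_divide)
  have prefactor: "((1 + cos \<theta>) / (1 - cos \<theta>)) powr (s / 8) * (k * B_sgn s \<theta> / (1 + s * cos \<theta>)) powr (1/4) =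
      k powr (1/4) * sin \<theta> powr (- 1/4) * B_sgn s \<theta> powr (1/4)"
  proof (cases "s = 1")
    case True
    have e: "(1 + cos \<theta>) powr (1/8) / (1 + cos \<theta>) powr (1/4) = (1 + cos \<theta>) powr (- 1/8)"
      using c by (simp flip: powr_diff)
    show ?thesis
      unfolding quot sin_powr e[symmetric] using c k B by (simp add: True powr_mult powr_divide)
  next
    case False
    then have "s = - 1" using s by auto
    moreover have e: "(1 - cos \<theta>) powr (1/8) / (1 - cos \<theta>) powr (1/4) = (1 - cos \<theta>) powr (- 1/8)"
      using c by (simp flip: powr_diff)
    ultimately show ?thesis
      unfolding quot sin_powr e[symmetric] using c k B by (simp add: powr_mult powr_divide)
  qed
  have "ferrers_P (- 1/6) (s / 4) (cos \<theta>) = inverse (Gamma (1 - s / 4)) *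
      (((1 + cos \<theta>) / (1 - cos \<theta>)) powr (s / 8) * gauss_2F1 (1/6) (5/6) (1 - s / 4) ((1 - cos \<theta>) / 2))"
    by (simp add: ferrers_P_def inverse_eq_divide)
  then show ?thesis unfolding gauss_B_sgn[OF s \<theta>] prefactor by simp
qed

section \<open>Octahedral functions near the origin\<close>

text \<open>Small enough for crude estimates to give \<bar>R_oct u\<bar> < 1 and positivity of
  \<open>p_e\<close>, \<open>p_f\<close> and \<open>1 - u\<close>.\<close>

definition near_zero :: "real set" where
  "near_zero = {- 1/1000<..<1/1000}"

context
  fixes u :: real
  assumes u: "u \<in> near_zero"
begin

lemma near_zero_bounds:
  "p_e u > 9 / 10" "p_f u > 9 / 10" "1 - u > 9 / 10" "\<bar>R_oct u\<bar> < 1"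
proof -
  have b: "- (1/1000) < u" "u < 1/1000" using u by (auto simp: near_zero_def)
  have u2: "0 \<le> u\<^sup>2" "u\<^sup>2 \<le> 1/1000" using b
    using power2_le_iff_abs_le[of "1/1000" u] by (auto simp: power2_eq_square)
  show "1 - u > 9 / 10" using b by linarith
  show "p_f u > 9 / 10" unfolding p_f_def using b u2 by linarith
  have "p_e u = 1 - 33 * u - 33 * u\<^sup>2 + u * u\<^sup>2"
    by (simp add: p_e_def power2_eq_square algebra_simps)
  moreover have "\<bar>u * u\<^sup>2\<bar> \<le> 1/1000 * (1/1000)"
    unfolding abs_mult using b u2 by (intro mult_mono) auto
  ultimately show pe: "p_e u > 9 / 10" using b u2 by linarith
  have "\<bar>p_v u\<bar> \<le> 1/1000 * (1001/1000) ^ 4"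
    unfolding p_v_def abs_mult power_abs[symmetric] using b by (intro mult_mono power_mono) auto
  then have "108 * \<bar>p_v u\<bar> < (9 / 10)\<^sup>2" by (simp add: power2_eq_square eval_nat_numeral)
  also have "\<dots> < (p_e u)\<^sup>2" using pe by (intro power_strict_mono) auto
  finally show "\<bar>R_oct u\<bar> < 1" using pe by (simp add: R_oct_def abs_mult)
qed

lemma one_minus_R_oct: "1 - R_oct u = p_f u ^ 3 / (p_e u)\<^sup>2"
  using R_oct_altdef[of u] near_zero_bounds by simp

text \<open>The factors show the ramification of \<open>R_oct\<close>: order 4 at 1, order 3 at the
  zeros of \<open>p_f\<close>, order 2 at the zeros of \<open>p_e\<close>. They result from
  \<open>(1 - 5 u) p_e - 2 u (1 - u) p_e' = p_f^2\<close>.\<close>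

lemma R_oct_derivative:
  "(R_oct has_real_derivative - 108 * (1 - u) ^ 3 * (p_f u)\<^sup>2 / p_e u ^ 3) (at u)"
proof -
  have pe: "p_e u > 0" using near_zero_bounds by simp
  have dv: "(p_v has_real_derivative (1 - u) ^ 3 * (1 - 5 * u)) (at u)"
    unfolding p_v_def[abs_def] by (auto intro!: derivative_eq_intros simp: eval_nat_numeral algebra_simps)
  have de: "(p_e has_real_derivative (- 33 - 66 * u + 3 * u\<^sup>2)) (at u)"
    unfolding p_e_def[abs_def] by (auto intro!: derivative_eq_intros simp: power2_eq_square algebra_simps)
  have "(R_oct has_real_derivative ((- 108 * ((1 - u) ^ 3 * (1 - 5 * u))) * (p_e u)\<^sup>2
      - (- 108 * p_v u) * (2 * p_e u * (- 33 - 66 * u + 3 * u\<^sup>2))) / ((p_e u)\<^sup>2 * (p_e u)\<^sup>2)) (at u)"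
    unfolding R_oct_def[abs_def] using pe
    by (intro DERIV_divide DERIV_cmult dv)
      (auto intro!: derivative_eq_intros de)
  moreover have "((- 108 * ((1 - u) ^ 3 * (1 - 5 * u))) * (p_e u)\<^sup>2
      - (- 108 * p_v u) * (2 * p_e u * (- 33 - 66 * u + 3 * u\<^sup>2))) / ((p_e u)\<^sup>2 * (p_e u)\<^sup>2)
      = - 108 * (1 - u) ^ 3 * (p_f u)\<^sup>2 / p_e u ^ 3"
  proof -
    have "(1 - 5 * u) * p_e u - 2 * (u * (1 - u)) * (- 33 - 66 * u + 3 * u\<^sup>2) = (p_f u)\<^sup>2"
      by (simp add: p_e_def p_f_def power2_eq_square algebra_simps)
    then have e: "(- 108 * ((1 - u) ^ 3 * (1 - 5 * u))) * (p_e u)\<^sup>2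
      - (- 108 * p_v u) * (2 * p_e u * (- 33 - 66 * u + 3 * u\<^sup>2)) = - 108 * (1 - u) ^ 3 * p_e u * (p_f u)\<^sup>2"
      unfolding p_v_def by algebra
    show ?thesis unfolding e using pe by (simp add: power2_eq_square power3_eq_cube mult_ac)
  qed
  ultimately show ?thesis by simp
qed

lemma p_e_derivative: "(p_e has_real_derivative (- 33 - 66 * u + 3 * u\<^sup>2)) (at u)"
  unfolding p_e_def[abs_def] by (auto intro!: derivative_eq_intros simp: power2_eq_square algebra_simps)

lemma p_e_powr_derivative:
  "((\<lambda>u. p_e u powr r) has_real_derivative r * p_e u powr (r - 1) * (- 33 - 66 * u + 3 * u\<^sup>2)) (at u)"
  using has_real_derivative_powr'[OF p_e_derivative, of "\<lambda>_. r" 0] near_zero_bounds(1)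
  by (simp add: powr_diff field_simps)

end

text \<open>With x = \<open>R_oct u\<close>, the field 2x(1-x) d/dx is
  \<open>2 u (1 - u) p_f / p_e\<close> times d/du, the leading part of \<open>ladder_op\<close> over
  \<open>p_e\<close>. The exponent is e = -6\<alpha> because
  \<open>cos \<theta> = B^3 p_e / 8\<close> makes \<open>p_e^(2\<alpha>)\<close> the counterpart of
  \<open>B^(-6\<alpha>)\<close>.\<close>

lemma near_zero_ladder:
  assumes nonint: "\<alpha> \<notin> \<int>" "\<alpha> + 1/2 \<notin> \<int>" "c \<notin> \<int>"
    and u: "u \<in> near_zero" "u \<noteq> 0"
    and \<rho>: "\<rho> field_differentiable at u"
    and eq: "\<And>v. v \<in> near_zero \<Longrightarrow> v \<noteq> 0 \<Longrightarrow>
       gauss_2F1 \<alpha> (\<alpha> + 1/2) c (R_oct v) = p_e v powr (2 * \<alpha>) * \<rho> v"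
  shows "p_e u powr (2 * \<alpha> - 1) * ladder_op a (- 6 * \<alpha>) l \<rho> u =
     2 * R_oct u * (1 - R_oct u) * gauss_deriv \<alpha> (\<alpha> + 1/2) c (R_oct u)
     + (l - a - 2 * \<alpha> * R_oct u) * gauss_2F1 \<alpha> (\<alpha> + 1/2) c (R_oct u)"
proof -
  note bounds = near_zero_bounds[OF u(1)]
  let ?x = "R_oct u" and ?F' = "gauss_deriv \<alpha> (\<alpha> + 1/2) c (R_oct u)"
  define Q where "Q = p_e u powr (2 * \<alpha> - 1)"
  define pe' where "pe' = - 33 - 66 * u + 3 * u\<^sup>2"
  define R' where "R' = - 108 * (1 - u) ^ 3 * (p_f u)\<^sup>2 / p_e u ^ 3"
  have pe: "p_e u > 0" and pf: "p_f u > 0" and u1: "1 - u > 0" using bounds by auto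
  have Q: "p_e u powr (2 * \<alpha>) = Q * p_e u"
    using pe by (simp add: Q_def powr_diff)
  have dG: "((\<lambda>v. gauss_2F1 \<alpha> (\<alpha> + 1/2) c (R_oct v)) has_real_derivative ?F' * R') (at u)"
    unfolding R'_def by (rule DERIV_chain2[OF gauss_2F1_has_derivative[OF nonint bounds(4)] R_oct_derivative[OF u(1)]])
  have d\<rho>: "((\<lambda>v. p_e v powr (2 * \<alpha>) * \<rho> v) has_real_derivative
      2 * \<alpha> * Q * pe' * \<rho> u + deriv \<rho> u * (Q * p_e u)) (at u)"
    unfolding Q[symmetric] unfolding Q_def pe'_def
    by (rule DERIV_mult[OF p_e_powr_derivative[OF u(1)]])
      (use \<rho> in \<open>simp add: DERIV_deriv_iff_field_differentiable\<close>)
  have ev: "\<forall>\<^sub>F v in nhds u. gauss_2F1 \<alpha> (\<alpha> + 1/2) c (R_oct v) = p_e v powr (2 * \<alpha>) * \<rho> v"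
  proof -
    have "open (near_zero - {0})" by (auto simp: near_zero_def intro: open_Diff)
    from eventually_nhds_in_open[OF this, of u] u show ?thesis
      by (auto elim!: eventually_mono intro: eq)
  qed
  have deriv: "?F' * R' = 2 * \<alpha> * Q * pe' * \<rho> u + deriv \<rho> u * (Q * p_e u)"
    using dG d\<rho> unfolding DERIV_cong_ev[OF refl ev refl] by (rule DERIV_unique)
  have "2 * ?x * (1 - ?x) = R' * (2 * u * (1 - u) * p_f u / p_e u)"
    unfolding one_minus_R_oct[OF u(1)] unfolding R'_def R_oct_def p_v_def
    using pe by (simp add: field_simps power2_eq_square eval_nat_numeral)
  then have "2 * ?x * (1 - ?x) * ?F' = (?F' * R') * (2 * u * (1 - u) * p_f u / p_e u)"
    by simp
  also have "\<dots> = Q * (4 * \<alpha> * u * (1 - u) * (p_f u * pe') / p_e u * \<rho> u + 2 * u * (1 - u) * p_f u * deriv \<rho> u)"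
    unfolding deriv using pe by (simp add: field_simps)
  \<comment> \<open>Division with remainder by \<open>p_e\<close>: the quotient yields the term with
    7 + u in \<open>ladder_op\<close>, and the remainder, multiplied by u(1-u), is proportional to
    \<open>p_v\<close> and yields \<open>R_oct\<close>.\<close>
  also have "p_f u * pe' = 3 * (7 + u) * p_e u - 54 * (1 - u) ^ 3"
    unfolding p_f_def p_e_def pe'_def by (simp add: power2_eq_square power3_eq_cube algebra_simps)
  also have "4 * \<alpha> * u * (1 - u) * (3 * (7 + u) * p_e u - 54 * (1 - u) ^ 3) / p_e u =
      12 * \<alpha> * u * (1 - u) * (7 + u) + 2 * \<alpha> * ?x * p_e u"
    unfolding R_oct_def p_v_def using pe by (simp add: field_simps power2_eq_square eval_nat_numeral)
  finally have *: "2 * ?x * (1 - ?x) * ?F' =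
      Q * ((12 * \<alpha> * u * (1 - u) * (7 + u) + 2 * \<alpha> * ?x * p_e u) * \<rho> u + 2 * u * (1 - u) * p_f u * deriv \<rho> u)" .
  show ?thesis
    unfolding * eq[OF u] Q Q_def[symmetric] ladder_op_def by (simp add: algebra_simps)
qed

lemma gauss_deriv_0: "gauss_deriv a b c 0 = a * b / c"
  by (simp add: gauss_deriv_def eval_fps_at_0 hyp_fps_nth)

text \<open>In this and the next lemma v, f, P, E stand for 1 - u, \<open>p_f\<close>,
  \<open>p_e\<close> and the derivative of \<open>p_e\<close>. Treating them as independent clears
  denominators without expanding any polynomial; the one genuine identity in u is
  \<open>riccati_numerator\<close>.\<close>

lemma riccati_quotient_rule:
  fixes A B v f f' :: real
  assumes "v \<noteq> 0" "f \<noteq> 0"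
  shows "(A * (1296 * v ^ 3 * f\<^sup>2) - B * (1296 * (v ^ 3 * (2 * f * f') - 3 * v\<^sup>2 * f\<^sup>2))) /
           ((1296 * v ^ 3 * f\<^sup>2) * (1296 * v ^ 3 * f\<^sup>2)) =
         A / (1296 * v ^ 3 * f\<^sup>2) + B * (3 * f - 2 * v * f') / (1296 * v ^ 4 * f ^ 3)"
  using assms by (simp add: divide_simps) (simp add: power2_eq_square eval_nat_numeral algebra_simps)

lemma riccati_common_denominator: fixes u v f f' P E :: real
  assumes nz: "v \<noteq> 0" "f \<noteq> 0" "P \<noteq> 0"
  shows "u * v * f / P * (((6 * u - 66) * P\<^sup>2 + 2 * P * E\<^sup>2) / (1296 * v ^ 3 * f\<^sup>2)
       + E * P\<^sup>2 * (3 * f - 2 * v * f') / (1296 * v ^ 4 * f ^ 3)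
       + (E * P\<^sup>2 / (1296 * v ^ 3 * f\<^sup>2))\<^sup>2 * (- 108 * v ^ 3 * f\<^sup>2 / P ^ 3))
     + (3/4 - 17/12 * (- 108 * (u * v ^ 4) / P\<^sup>2)) * (E * P\<^sup>2 / (1296 * v ^ 3 * f\<^sup>2)) + 11/576 =
   (u * v * f * ((6 * u - 66) * P + 23/12 * E\<^sup>2) + u * E * P * (3 * f - 2 * v * f') + 3/4 * E * P\<^sup>2 + 153 * u * v ^ 4 * E
      + 99/4 * v ^ 3 * f\<^sup>2) / (1296 * v ^ 3 * f\<^sup>2)" 
  using nz by (simp add: divide_simps) (simp add: power2_eq_square eval_nat_numeral algebra_simps)

lemma riccati_numerator: fixes u ::real
  shows "u * (1-u) * p_f u * ((6 * u - 66) * p_e u + 23/12 * (- 33 - 66 * u + 3 * u\<^sup>2)\<^sup>2) + u * (- 33 - 66 * u + 3 * u\<^sup>2) * p_e u * (3 * p_f u - 2 * (1-u) * (14+2*u)) + 3/4 * (- 33 - 66 * u + 3 * u\<^sup>2) * (p_e u)\<^sup>2 + 153 * u * (1-u) ^ 4 * (- 33 - 66 * u + 3 * u\<^sup>2)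
      + 99/4 * (1-u) ^ 3 * (p_f u)\<^sup>2=0"
  unfolding p_e_def p_f_def by (simp add: field_simps power2_eq_square eval_nat_numeral)

lemma gauss_R_oct:
  assumes "u \<in> near_zero"
  shows "gauss_2F1 (- 1/24) (11/24) (3/4) (R_oct u) = p_e u powr (- 1/12)"
proof -
  let ?F = "gauss_2F1 (- 1/24) (11/24) (3/4)" and ?F' = "gauss_deriv (- 1/24) (11/24) (3/4)"
  have nonint: "(- 1/24::real) \<notin> \<int>" "(11/24::real) \<notin> \<int>" "(3/4::real) \<notin> \<int>"
    by (auto intro: nonintI[of 24 _ "- 1"] nonintI[of 24 _ 11] nonintI[of 4 _ 3])
  define R' where "R' = (\<lambda>u. - 108 * (1 - u) ^ 3 * (p_f u)\<^sup>2 / p_e u ^ 3)"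
  define y where "y = (\<lambda>u. p_e u powr (- 1/12))"
  \<comment> \<open>The derivative of log y with respect to x = \<open>R_oct u\<close>, that is
    -1/12 of the logarithmic derivative of \<open>p_e\<close> divided by \<open>R'\<close>; hence
    1296 = 12 * 108. Then w is the Wronskian in the variable x.\<close>
  define h where "h = (\<lambda>u. (- 33 - 66 * u + 3 * u\<^sup>2) * (p_e u)\<^sup>2 / (1296 * (1 - u) ^ 3 * (p_f u)\<^sup>2))"
  define w where "w = (\<lambda>u. ?F (R_oct u) * (y u * h u) - y u * ?F' (R_oct u))"
  \<comment> \<open>Abel's identity makes \<open>x\<^sup>3\<^sup>/\<^sup>4 (1 - x)\<^sup>2\<^sup>/\<^sup>3 w\<close> constant; its twelfth power avoids
    fractional powers of \<open>x = R_oct u\<close>, which changes sign at \<open>u = 0\<close>.\<close>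
  define N where "N = (\<lambda>u. R_oct u ^ 9 * (1 - R_oct u) ^ 8 * w u ^ 12)"
  have zero: "(0::real) \<in> near_zero" by (simp add: near_zero_def)
  have y_pos: "y u > 0" if "u \<in> near_zero" for u
    using near_zero_bounds(1)[OF that] by (simp add: y_def)
  have dF: "((\<lambda>u. ?F (R_oct u)) has_real_derivative ?F' (R_oct u) * R' u) (at u)" if u: "u \<in> near_zero" for u
    unfolding R'_def by (rule DERIV_chain2[OF gauss_2F1_has_derivative[OF nonint near_zero_bounds(4)[OF u]] R_oct_derivative[OF u]])
  have dR: "(R_oct has_real_derivative R' u) (at u)" if u: "u \<in> near_zero" for u
    unfolding R'_def by (rule R_oct_derivative[OF u])
  have dy: "(y has_real_derivative y u * h u * R' u) (at u)" if u: "u \<in> near_zero" for u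
  proof -
    note b = near_zero_bounds[OF u]
    have "- 1/12 * p_e u powr (- 1/12 - 1) * (- 33 - 66 * u + 3 * u\<^sup>2) = y u * h u * R' u"
      unfolding y_def h_def R'_def powr_diff using b by (simp add: divide_simps power2_eq_square power3_eq_cube)
    with p_e_powr_derivative[OF u, of "- 1/12"] show ?thesis by (simp add: y_def)
  qed
  have dw: "\<exists>w'. (w has_real_derivative w') (at u) \<and>
      R_oct u * (1 - R_oct u) * w' = - R' u * (3/4 - 17/12 * R_oct u) * w u" if u: "u \<in> near_zero" for u
  proof -
    note b = near_zero_bounds[OF u]
    have nz: "p_e u \<noteq> 0" "p_f u \<noteq> 0" "1 - u \<noteq> 0" using b by auto
    let ?x = "R_oct u"
    define e1 where "e1 = - 33 - 66 * u + 3 * u\<^sup>2"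
    define h' where "h' = ((6 * u - 66) * (p_e u)\<^sup>2 + 2 * p_e u * e1\<^sup>2) / (1296 * (1 - u) ^ 3 * (p_f u)\<^sup>2)
       + e1 * (p_e u)\<^sup>2 * (3 * p_f u - 2 * (1 - u) * (14 + 2 * u)) / (1296 * (1 - u) ^ 4 * p_f u ^ 3)"
    have df: "(p_f has_real_derivative 14 + 2 * u) (at u)"
      unfolding p_f_def[abs_def] by (auto intro!: derivative_eq_intros)
    have dnum: "((\<lambda>u. (- 33 - 66 * u + 3 * u\<^sup>2) * (p_e u)\<^sup>2) has_real_derivative
        (6 * u - 66) * (p_e u)\<^sup>2 + 2 * p_e u * e1\<^sup>2) (at u)"
      unfolding e1_def by (auto intro!: derivative_eq_intros p_e_derivative[OF u] simp: power2_eq_square)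
    have dden: "((\<lambda>u. 1296 * (1 - u) ^ 3 * (p_f u)\<^sup>2) has_real_derivative
        1296 * ((1 - u) ^ 3 * (2 * p_f u * (14 + 2 * u)) - 3 * (1 - u)\<^sup>2 * (p_f u)\<^sup>2)) (at u)"
      by (auto intro!: derivative_eq_intros df simp: power2_eq_square)
    have "1296 * (1 - u) ^ 3 * (p_f u)\<^sup>2 \<noteq> 0" using nz by simp
    from DERIV_divide[OF dnum dden this]
    have dh: "(h has_real_derivative h') (at u)"
      unfolding h_def h'_def riccati_quotient_rule[OF nz(3,2)] e1_def .
    obtain F2 where F2: "(?F' has_real_derivative F2) (at ?x)"
      and ode: "?x * (1 - ?x) * F2 + (3/4 - (- 1/24 + 11/24 + 1) * ?x) * ?F' ?x = - 1/24 * (11/24) * ?F ?x"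
      using gauss_ode[OF nonint b(4)] by blast
    have dF': "((\<lambda>u. ?F' (R_oct u)) has_real_derivative F2 * R' u) (at u)"
      by (rule DERIV_chain2[OF F2 dR[OF u]])
    have x: "?x * (1 - ?x) = R' u * (u * (1 - u) * p_f u / p_e u)"
      unfolding one_minus_R_oct[OF u] unfolding R'_def R_oct_def p_v_def
      using nz by (simp add: field_simps power2_eq_square eval_nat_numeral)
    have riccati: "u * (1 - u) * p_f u / p_e u * (h' + (h u)\<^sup>2 * R' u) + (3/4 - 17/12 * ?x) * h u + 11/576 = 0"
      unfolding h_def h'_def R'_def R_oct_def p_v_def e1_def[symmetric]
        riccati_common_denominator[OF nz(3,2,1)]
      unfolding e1_def riccati_numerator by simp
    have "(w has_real_derivative (?F' ?x * R' u * (y u * h u) + (y u * h u * R' u * h u + h' * y u) * ?F ?x)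
        - (y u * h u * R' u * ?F' ?x + F2 * R' u * y u)) (at u)"
      unfolding w_def
      by (rule DERIV_diff[OF DERIV_mult[OF dF[OF u] DERIV_mult[OF dy[OF u] dh]] DERIV_mult[OF dy[OF u] dF']])
    moreover have "?x * (1 - ?x) * ((?F' ?x * R' u * (y u * h u) + (y u * h u * R' u * h u + h' * y u) * ?F ?x)
        - (y u * h u * R' u * ?F' ?x + F2 * R' u * y u)) = - R' u * (3/4 - 17/12 * ?x) * w u"
    proof -
      have "?x * (1 - ?x) * (h' + (h u)\<^sup>2 * R' u) = - R' u * ((3/4 - 17/12 * ?x) * h u + 11/576)"
        unfolding x using riccati by algebra
      moreover have "?x * (1 - ?x) * F2 = - 11/576 * ?F ?x - (3/4 - 17/12 * ?x) * ?F' ?x"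
        using ode by simp
      ultimately show ?thesis unfolding w_def by algebra
    qed
    ultimately show ?thesis by blast
  qed
  have dN: "(N has_real_derivative 0) (at u)" if u: "u \<in> near_zero" for u
  proof -
    obtain w' where w': "(w has_real_derivative w') (at u)"
      "R_oct u * (1 - R_oct u) * w' = - R' u * (3/4 - 17/12 * R_oct u) * w u" using dw[OF u] by blast
    have "(N has_real_derivative (9 * R_oct u ^ 8 * R' u * (1 - R_oct u) ^ 8
        - 8 * (1 - R_oct u) ^ 7 * R' u * R_oct u ^ 9) * w u ^ 12
        + 12 * w u ^ 11 * w' * (R_oct u ^ 9 * (1 - R_oct u) ^ 8)) (at u)"
      unfolding N_def by (auto intro!: derivative_eq_intros dR[OF u] w'(1))
    moreover have "(9 * R_oct u ^ 8 * R' u * (1 - R_oct u) ^ 8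
        - 8 * (1 - R_oct u) ^ 7 * R' u * R_oct u ^ 9) * w u ^ 12
        + 12 * w u ^ 11 * w' * (R_oct u ^ 9 * (1 - R_oct u) ^ 8)
        = R_oct u ^ 8 * (1 - R_oct u) ^ 7 * w u ^ 11 * ((9 * (1 - R_oct u) - 8 * R_oct u) * R' u * w u
          + 12 * (R_oct u * (1 - R_oct u) * w'))"
      by (simp add: eval_nat_numeral algebra_simps)
    also have "\<dots> = 0" unfolding w'(2) by (simp add: algebra_simps)
    ultimately show ?thesis by (simp only:)
  qed
  have "convex near_zero" by (simp add: near_zero_def)
  have w_0: "w u = 0" if u: "u \<in> near_zero" for u
  proof (cases "u = 0")
    case True
    \<comment> \<open>At u = 0 the vanishing of N says nothing about w, since x = 0. There both
      logarithmic derivatives equal -11/432.\<close>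
    then show ?thesis by (simp add: w_def h_def R_oct_def p_v_def p_e_def p_f_def gauss_deriv_0)
  next
    case False
    have "\<exists>k. \<forall>u\<in>near_zero. N u = k"
      by (rule has_field_derivative_zero_constant[OF \<open>convex near_zero\<close>])
        (rule has_field_derivative_at_within, rule dN)
    then have "N u = N 0" using u zero by auto
    then have "N u = 0" by (simp add: N_def R_oct_def p_v_def)
    moreover have "R_oct u \<noteq> 0"
      using near_zero_bounds(1,3)[OF u] False by (auto simp: R_oct_def p_v_def)
    moreover have "1 - R_oct u \<noteq> 0"
      using near_zero_bounds(4)[OF u] by auto
    ultimately show ?thesis by (simp add: N_def)
  qed
  have "((\<lambda>u. ?F (R_oct u) / y u) has_real_derivative 0) (at u)" if u: "u \<in> near_zero" for u
  proof -
    have "?F' (R_oct u) * R' u * y u - ?F (R_oct u) * (y u * h u * R' u) = - R' u * w u"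
      by (simp add: w_def algebra_simps)
    then have "?F' (R_oct u) * R' u * y u - ?F (R_oct u) * (y u * h u * R' u) = 0"
      using w_0[OF u] by simp
    moreover have "y u \<noteq> 0" using y_pos[OF u] by simp
    note DERIV_divide[OF dF[OF u] dy[OF u] this]
    ultimately show ?thesis by (simp only: div_0)
  qed
  then have "\<exists>k. \<forall>u\<in>near_zero. ?F (R_oct u) / y u = k"
    using has_field_derivative_zero_constant[OF \<open>convex near_zero\<close> has_field_derivative_at_within]
    by blast
  then obtain k where k: "\<And>u. u \<in> near_zero \<Longrightarrow> ?F (R_oct u) / y u = k" by blast
  have "?F (R_oct u) / y u = ?F (R_oct 0) / y 0"
    unfolding k[OF assms] k[OF zero] ..
  also have "\<dots> = 1" by (simp add: y_def R_oct_def p_v_def p_e_def)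
  finally show ?thesis using y_pos[OF assms] by (simp add: y_def)
qed

section \<open>Ladder steps in rational form\<close>

text \<open>The octahedral functions have poles only at \<open>0\<close>, \<open>1\<close>, \<open>\<infinity>\<close> and the (negative) zeros of \<open>p_f\<close>. In
  particular they are regular at the positive zero of \<open>p_e\<close>, where \<open>cos \<theta> = 0\<close>.\<close>

definition regular_set :: "real set" where
  "regular_set = {- 1/20<..} - {0, 1}"

definition rational_on_regular :: "(real \<Rightarrow> real) \<Rightarrow> bool" where
  "rational_on_regular f \<longleftrightarrow>
     (\<exists>p q. \<forall>u\<in>regular_set. poly q u \<noteq> 0 \<and> f u = poly p u / poly q u)"

lemma open_regular_set: "open regular_set"
  unfolding regular_set_def by (intro open_Diff) auto

lemma near_zero_regular: "u \<in> near_zero \<Longrightarrow> u \<noteq> 0 \<Longrightarrow> u \<in> regular_set"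
  by (auto simp: near_zero_def regular_set_def)

lemma u_sgn_regular: "s\<^sup>2 = 1 \<Longrightarrow> 0 < \<theta> \<Longrightarrow> \<theta> < pi \<Longrightarrow> u_sgn s \<theta> \<in> regular_set"
  using u_sgn_pos[of s \<theta>] u_sgn_neq_1[of s \<theta>] by (simp add: regular_set_def)

lemma p_f_regular: "p_f u \<noteq> 0" if "u \<in> regular_set"
proof -
  have "1 + 14 * u > 0" using that by (simp add: regular_set_def)
  moreover have "u\<^sup>2 \<ge> 0" by simp
  ultimately have "p_f u > 0" unfolding p_f_def by linarith
  then show ?thesis by simp
qed

lemma rational_on_regular_poly: "rational_on_regular (\<lambda>u. poly p u)"
  unfolding rational_on_regular_def by (intro exI[of _ p] exI[of _ 1]) simp

lemma rational_on_regular_add: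
  assumes "rational_on_regular f" "rational_on_regular g"
  shows "rational_on_regular (\<lambda>u. f u + g u)"
proof -
  obtain p q p' q' where "\<forall>u\<in>regular_set. poly q u \<noteq> 0 \<and> f u = poly p u / poly q u"
    "\<forall>u\<in>regular_set. poly q' u \<noteq> 0 \<and> g u = poly p' u / poly q' u"
    using assms unfolding rational_on_regular_def by blast
  then show ?thesis
    unfolding rational_on_regular_def
    by (intro exI[of _ "p * q' + p' * q"] exI[of _ "q * q'"]) (auto simp: field_simps)
qed

lemma rational_on_regular_mult:
  assumes "rational_on_regular f" "rational_on_regular g"
  shows "rational_on_regular (\<lambda>u. f u * g u)"
proof -
  obtain p q p' q' where "\<forall>u\<in>regular_set. poly q u \<noteq> 0 \<and> f u = poly p u / poly q u"
    "\<forall>u\<in>regular_set. poly q' u \<noteq> 0 \<and> g u = poly p' u / poly q' u"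
    using assms unfolding rational_on_regular_def by blast
  then show ?thesis
    unfolding rational_on_regular_def
    by (intro exI[of _ "p * p'"] exI[of _ "q * q'"]) auto
qed

lemma rational_on_regular_divide:
  assumes "rational_on_regular f" "\<And>u. u \<in> regular_set \<Longrightarrow> poly r u \<noteq> 0"
  shows "rational_on_regular (\<lambda>u. f u / poly r u)"
proof -
  obtain p q where "\<forall>u\<in>regular_set. poly q u \<noteq> 0 \<and> f u = poly p u / poly q u"
    using assms(1) unfolding rational_on_regular_def by blast
  then show ?thesis
    unfolding rational_on_regular_def
    by (intro exI[of _ p] exI[of _ "q * r"]) (auto simp: assms(2))
qed

lemma rational_on_regular_derivative:
  assumes "rational_on_regular f"
  shows "rational_on_regular (deriv f)"
    and "u \<in> regular_set \<Longrightarrow> f field_differentiable at u"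
proof -
  obtain p q where pq: "\<And>u. u \<in> regular_set \<Longrightarrow> poly q u \<noteq> 0"
    "\<And>u. u \<in> regular_set \<Longrightarrow> f u = poly p u / poly q u"
    using assms unfolding rational_on_regular_def by blast
  have d: "(f has_real_derivative
      (poly (pderiv p) u * poly q u - poly p u * poly (pderiv q) u) / (poly q u * poly q u)) (at u)"
    if u: "u \<in> regular_set" for u
  proof -
    have "\<forall>\<^sub>F v in nhds u. f v = poly p v / poly q v"
      using eventually_nhds_in_open[OF open_regular_set u] by (auto elim!: eventually_mono simp: pq(2))
    then show ?thesis
      using DERIV_divide[OF poly_DERIV poly_DERIV pq(1)[OF u]] by (subst DERIV_cong_ev[OF refl _ refl])
  qed
  show "u \<in> regular_set \<Longrightarrow> f field_differentiable at u"
    using d by (auto simp: field_differentiable_def)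
  show "rational_on_regular (deriv f)"
    unfolding rational_on_regular_def
    by (intro exI[of _ "pderiv p * q - p * pderiv q"] exI[of _ "q * q"])
      (use DERIV_imp_deriv[OF d] pq(1) in auto)
qed

lemma p_f_poly: "p_f u = poly [:1, 14, 1:] u"
  by (simp add: p_f_def power2_eq_square algebra_simps)

lemma p_e_poly: "p_e u = poly [:1, - 33, - 33, 1:] u"
  by (simp add: p_e_def power2_eq_square algebra_simps)

lemma rational_on_regular_ladder_op:
  assumes "rational_on_regular \<rho>"
  shows "rational_on_regular (ladder_op a e l \<rho>)"
proof -
  have "ladder_op a e l \<rho> = (\<lambda>u. poly ([:0, 2:] * [:1, - 1:] * [:1, 14, 1:]) u * deriv \<rho> u
      + poly (smult (l - a) [:1, - 33, - 33, 1:] - smult (2 * e) ([:7, 1:] * [:0, 1:] * [:1, - 1:])) u * \<rho> u)"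
    by (rule ext) (simp add: ladder_op_def p_f_poly p_e_poly algebra_simps)
  then show ?thesis
    by (simp only: rational_on_regular_add rational_on_regular_mult rational_on_regular_poly
        rational_on_regular_derivative(1) assms)
qed

lemma rational_on_regular_cmult:
  "rational_on_regular \<rho> \<Longrightarrow> rational_on_regular (\<lambda>u. k * \<rho> u)"
  using rational_on_regular_mult[OF rational_on_regular_poly[of "[:k:]"]] by simp

lemma rational_on_regular_divide_p_f:
  "rational_on_regular \<rho> \<Longrightarrow> rational_on_regular (\<lambda>u. \<rho> u / p_f u ^ 3)"
  using rational_on_regular_divide[of \<rho> "[:1, 14, 1:] ^ 3"] p_f_regular
  by (simp add: poly_power p_f_poly del: poly_pCons)

lemma rational_on_regular_divide_p_v:
  assumes "rational_on_regular \<rho>"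
  shows "rational_on_regular (\<lambda>u. \<rho> u / p_v u)"
proof -
  have pv: "p_v u = poly ([:0, 1:] * [:1, - 1:] ^ 4) u" for u by (simp add: p_v_def poly_power)
  show ?thesis
    unfolding pv by (rule rational_on_regular_divide[OF assms])
      (auto simp: regular_set_def pv[symmetric] p_v_def)
qed

section \<open>Ladder steps for the Ferrers functions on the interval\<close>

lemma eq_divide_if_mult_eq:
  fixes k :: real
  assumes "k \<noteq> 0" "k * x = C / 8 * p * q * r"
  shows "x = C / (8 * k) * p * q * r"
  using assms by (simp add: field_simps)

definition theta_rep ::
  "real \<Rightarrow> real \<Rightarrow> real \<Rightarrow> real \<Rightarrow> (real \<Rightarrow> real) \<Rightarrow> (real \<Rightarrow> real) \<Rightarrow> bool" where
  "theta_rep s a e C \<rho> Y \<longleftrightarrow>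
     (\<forall>\<theta>. 0 < \<theta> \<longrightarrow> \<theta> < pi \<longrightarrow>
        Y \<theta> = C * sin \<theta> powr (- a) * B_sgn s \<theta> powr e * \<rho> (u_sgn s \<theta>))"

lemma theta_rep_scale:
  "theta_rep s a e C \<rho> Y \<Longrightarrow> C = C' * k \<Longrightarrow> theta_rep s a e C' (\<lambda>u. k * \<rho> u) Y"
  by (simp add: theta_rep_def)

text \<open>Lowering n should lower the exponent of B by 3, but the operator raises it by 3. The
  surplus \<open>B^6\<close> equals \<open>64 / p_f^3\<close>.\<close>

lemma theta_rep_divide_p_f:
  assumes s: "s\<^sup>2 = 1" and rep: "theta_rep s a (e + 3) C \<rho> Y"
  shows "theta_rep s a (e - 3) (64 * C) (\<lambda>u. \<rho> u / p_f u ^ 3) Y"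
  unfolding theta_rep_def
proof (intro allI impI)
  fix \<theta> :: real assume \<theta>: "0 < \<theta>" "\<theta> < pi"
  let ?B = "B_sgn s \<theta>" and ?u = "u_sgn s \<theta>"
  have B: "?B > 0" by (rule B_sgn_pos[OF s \<theta>])
  have pf: "p_f ?u \<noteq> 0" by (rule p_f_regular[OF u_sgn_regular[OF s \<theta>]])
  have "e + 3 = (e - 3) + 6" by simp
  then have "?B powr (e + 3) = ?B powr (e - 3) * ?B ^ 6"
    using B by (simp only: powr_add) (simp add: powr_numeral)
  also have "?B ^ 6 = (?B\<^sup>2) ^ 3" by simp
  also have "?B\<^sup>2 = 4 / p_f ?u" using p_f_u_sgn[OF s \<theta>] pf by (simp add: field_simps)
  finally show "Y \<theta> = 64 * C * sin \<theta> powr (- a) * ?B powr (e - 3) * (\<rho> ?u / p_f ?u ^ 3)"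
    using rep \<theta> by (simp add: theta_rep_def power_divide)
qed

text \<open>Lowering m leaves a surplus of \<open>B^6\<close> and a sine exponent off by 2. Both are
  corrected at once by \<open>(sin \<theta>)^2 = 27/16 p_v B^6\<close>.\<close>

lemma theta_rep_divide_p_v:
  assumes s: "s\<^sup>2 = 1" and rep: "theta_rep s (a + 1) (e + 3) C \<rho> Y"
  shows "theta_rep s (a - 1) (e - 3) (16 / 27 * C) (\<lambda>u. \<rho> u / p_v u) Y"
  unfolding theta_rep_def
proof (intro allI impI)
  fix \<theta> :: real assume \<theta>: "0 < \<theta>" "\<theta> < pi"
  let ?B = "B_sgn s \<theta>" and ?u = "u_sgn s \<theta>"
  have B: "?B > 0" by (rule B_sgn_pos[OF s \<theta>])
  have sin: "sin \<theta> > 0" using \<theta> by (rule sin_gt_zero)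
  have pv: "p_v ?u \<noteq> 0" using u_sgn_regular[OF s \<theta>] by (simp add: regular_set_def p_v_def)
  have "e + 3 = (e - 3) + 6" by simp
  then have eB: "?B powr (e + 3) = ?B powr (e - 3) * ?B ^ 6"
    using B by (simp only: powr_add) (simp add: powr_numeral)
  have "- (a - 1) = - (a + 1) + 2" by simp
  then have "sin \<theta> powr (- (a - 1)) = sin \<theta> powr (- (a + 1)) * (sin \<theta>)\<^sup>2"
    using sin by (simp only: powr_add) (simp add: powr_numeral)
  then have eS: "sin \<theta> powr (- (a - 1)) = sin \<theta> powr (- (a + 1)) * (27 / 16 * p_v ?u * ?B ^ 6)"
    unfolding sin_sq_u_sgn[OF s \<theta>] p_v_def by (simp only: mult.assoc)
  have "Y \<theta> = C * sin \<theta> powr (- (a + 1)) * ?B powr (e + 3) * \<rho> ?u"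
    using rep \<theta> by (simp add: theta_rep_def)
  then show "Y \<theta> = 16 / 27 * C * sin \<theta> powr (- (a - 1)) * ?B powr (e - 3) * (\<rho> ?u / p_v ?u)"
    unfolding eS eB using pv by simp
qed

context
  fixes s \<nu> \<mu> a e C :: real and \<rho> :: "real \<Rightarrow> real"
  assumes s: "s\<^sup>2 = 1" and nonint: "\<nu> \<notin> \<int>" "\<mu> \<notin> \<int>"
    and \<rho>: "rational_on_regular \<rho>"
    and rep: "theta_rep s a e C \<rho> (\<lambda>\<theta>. ferrers_P \<nu> \<mu> (cos \<theta>))"
begin

private lemma ladder:
  assumes "0 < \<theta>" "\<theta> < pi"
    and "((\<lambda>\<theta>. ferrers_P \<nu> \<mu> (cos \<theta>)) has_real_derivative D) (at \<theta>)"
  shows "sin \<theta> * D + l * cos \<theta> * ferrers_P \<nu> \<mu> (cos \<theta>) =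
     C / 8 * sin \<theta> powr (- a) * B_sgn s \<theta> powr (e + 3) * ladder_op a e l \<rho> (u_sgn s \<theta>)"
  by (rule theta_ladder[OF s assms(1,2) _ _ assms(3)])
    (use rep rational_on_regular_derivative(2)[OF \<rho>] u_sgn_regular[OF s assms(1,2)]
      in \<open>auto simp: theta_rep_def\<close>)

lemma theta_rep_raise_nu:
  assumes "\<nu> + 1 - \<mu> \<noteq> 0"
  shows "theta_rep s a (e + 3) (C / (8 * (\<nu> + 1 - \<mu>))) (ladder_op a e (\<nu> + 1) \<rho>)
           (\<lambda>\<theta>. ferrers_P (\<nu> + 1) \<mu> (cos \<theta>))"
  unfolding theta_rep_def
proof (intro allI impI)
  fix \<theta> :: real assume \<theta>: "0 < \<theta>" "\<theta> < pi"
  obtain D where "((\<lambda>\<theta>. ferrers_P \<nu> \<mu> (cos \<theta>)) has_real_derivative D) (at \<theta>)"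
    "sin \<theta> * D + (\<nu> + 1) * cos \<theta> * ferrers_P \<nu> \<mu> (cos \<theta>) =
           (\<nu> + 1 - \<mu>) * ferrers_P (\<nu> + 1) \<mu> (cos \<theta>)"
    by (rule ferrers_cos_ladder[OF nonint \<theta>])
  with ladder[OF \<theta>, of D "\<nu> + 1"]
  have "(\<nu> + 1 - \<mu>) * ferrers_P (\<nu> + 1) \<mu> (cos \<theta>) =
     C / 8 * sin \<theta> powr (- a) * B_sgn s \<theta> powr (e + 3) * ladder_op a e (\<nu> + 1) \<rho> (u_sgn s \<theta>)" by simp
  then show "ferrers_P (\<nu> + 1) \<mu> (cos \<theta>) = C / (8 * (\<nu> + 1 - \<mu>)) * sin \<theta> powr (- a) *
      B_sgn s \<theta> powr (e + 3) * ladder_op a e (\<nu> + 1) \<rho> (u_sgn s \<theta>)"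
    using eq_divide_if_mult_eq[OF assms] by simp
qed

lemma theta_rep_lower_nu:
  assumes "\<nu> + \<mu> \<noteq> 0"
  shows "theta_rep s a (e + 3) (- C / (8 * (\<nu> + \<mu>))) (ladder_op a e (- \<nu>) \<rho>)
           (\<lambda>\<theta>. ferrers_P (\<nu> - 1) \<mu> (cos \<theta>))"
  unfolding theta_rep_def
proof (intro allI impI)
  fix \<theta> :: real assume \<theta>: "0 < \<theta>" "\<theta> < pi"
  obtain D where "((\<lambda>\<theta>. ferrers_P \<nu> \<mu> (cos \<theta>)) has_real_derivative D) (at \<theta>)"
    "sin \<theta> * D - \<nu> * cos \<theta> * ferrers_P \<nu> \<mu> (cos \<theta>) =
           - (\<nu> + \<mu>) * ferrers_P (\<nu> - 1) \<mu> (cos \<theta>)"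
    by (rule ferrers_cos_ladder[OF nonint \<theta>])
  with ladder[OF \<theta>, of D "- \<nu>"]
  have "- (\<nu> + \<mu>) * ferrers_P (\<nu> - 1) \<mu> (cos \<theta>) =
     C / 8 * sin \<theta> powr (- a) * B_sgn s \<theta> powr (e + 3) * ladder_op a e (- \<nu>) \<rho> (u_sgn s \<theta>)" by simp
  moreover have "- (\<nu> + \<mu>) \<noteq> 0" using assms by simp
  ultimately have "ferrers_P (\<nu> - 1) \<mu> (cos \<theta>) = C / (8 * - (\<nu> + \<mu>)) * sin \<theta> powr (- a) *
      B_sgn s \<theta> powr (e + 3) * ladder_op a e (- \<nu>) \<rho> (u_sgn s \<theta>)"
    by (intro eq_divide_if_mult_eq)
  then show "ferrers_P (\<nu> - 1) \<mu> (cos \<theta>) = - C / (8 * (\<nu> + \<mu>)) * sin \<theta> powr (- a) *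
      B_sgn s \<theta> powr (e + 3) * ladder_op a e (- \<nu>) \<rho> (u_sgn s \<theta>)"
    by (simp only: mult_minus_right minus_divide_right[symmetric] minus_divide_left)
qed

text \<open>The shifted function occurs multiplied by sin \<theta>, and this factor is absorbed into
  the sine power. Therefore a increases whether \<mu> is raised or lowered.\<close>

lemma theta_rep_raise_mu:
  "theta_rep s (a + 1) (e + 3) (C / 8) (ladder_op a e (- \<mu>) \<rho>) (\<lambda>\<theta>. ferrers_P \<nu> (\<mu> + 1) (cos \<theta>))"
  unfolding theta_rep_def
proof (intro allI impI)
  fix \<theta> :: real assume \<theta>: "0 < \<theta>" "\<theta> < pi"
  have sin: "sin \<theta> > 0" using \<theta> by (rule sin_gt_zero)
  then have sp: "sin \<theta> powr (- a) = sin \<theta> * sin \<theta> powr (- (a + 1))"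
    by (simp add: powr_diff powr_minus_divide)
  obtain D where "((\<lambda>\<theta>. ferrers_P \<nu> \<mu> (cos \<theta>)) has_real_derivative D) (at \<theta>)"
    "sin \<theta> * D - \<mu> * cos \<theta> * ferrers_P \<nu> \<mu> (cos \<theta>) = sin \<theta> * ferrers_P \<nu> (\<mu> + 1) (cos \<theta>)"
    by (rule ferrers_cos_ladder[OF nonint \<theta>])
  with ladder[OF \<theta>, of D "- \<mu>"]
  have "sin \<theta> * ferrers_P \<nu> (\<mu> + 1) (cos \<theta>) =
     C / 8 * sin \<theta> powr (- a) * B_sgn s \<theta> powr (e + 3) * ladder_op a e (- \<mu>) \<rho> (u_sgn s \<theta>)" by simp
  then show "ferrers_P \<nu> (\<mu> + 1) (cos \<theta>) = C / 8 * sin \<theta> powr (- (a + 1)) *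
      B_sgn s \<theta> powr (e + 3) * ladder_op a e (- \<mu>) \<rho> (u_sgn s \<theta>)"
    unfolding sp using sin by simp
qed

lemma theta_rep_lower_mu:
  assumes "\<nu> - \<mu> + 1 \<noteq> 0" "\<nu> + \<mu> \<noteq> 0"
  shows "theta_rep s (a + 1) (e + 3) (- C / (8 * ((\<nu> - \<mu> + 1) * (\<nu> + \<mu>)))) (ladder_op a e \<mu> \<rho>)
           (\<lambda>\<theta>. ferrers_P \<nu> (\<mu> - 1) (cos \<theta>))"
  unfolding theta_rep_def
proof (intro allI impI)
  fix \<theta> :: real assume \<theta>: "0 < \<theta>" "\<theta> < pi"
  have sin: "sin \<theta> > 0" using \<theta> by (rule sin_gt_zero)
  then have sp: "sin \<theta> powr (- a) = sin \<theta> * sin \<theta> powr (- (a + 1))"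
    by (simp add: powr_diff powr_minus_divide)
  define k where "k = (\<nu> - \<mu> + 1) * (\<nu> + \<mu>)"
  have k: "k \<noteq> 0" using assms by (simp add: k_def)
  obtain D where D: "((\<lambda>\<theta>. ferrers_P \<nu> \<mu> (cos \<theta>)) has_real_derivative D) (at \<theta>)"
    "sin \<theta> * D + \<mu> * cos \<theta> * ferrers_P \<nu> \<mu> (cos \<theta>) =
       - (\<nu> - \<mu> + 1) * (\<nu> + \<mu>) * (sin \<theta> * ferrers_P \<nu> (\<mu> - 1) (cos \<theta>))"
    by (rule ferrers_cos_ladder[OF nonint \<theta>])
  have "- k * (sin \<theta> * ferrers_P \<nu> (\<mu> - 1) (cos \<theta>)) =
     C / 8 * sin \<theta> powr (- a) * B_sgn s \<theta> powr (e + 3) * ladder_op a e \<mu> \<rho> (u_sgn s \<theta>)"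
    unfolding ladder[OF \<theta> D(1), symmetric] D(2) k_def by (simp only: mult_minus_left)
  then have "sin \<theta> * (- k * ferrers_P \<nu> (\<mu> - 1) (cos \<theta>)) = sin \<theta> * (C / 8 * sin \<theta> powr (- (a + 1)) *
      B_sgn s \<theta> powr (e + 3) * ladder_op a e \<mu> \<rho> (u_sgn s \<theta>))"
    unfolding sp by (simp only: mult_ac)
  then have "- k * ferrers_P \<nu> (\<mu> - 1) (cos \<theta>) = C / 8 * sin \<theta> powr (- (a + 1)) *
      B_sgn s \<theta> powr (e + 3) * ladder_op a e \<mu> \<rho> (u_sgn s \<theta>)"
    using sin by (metis less_irrefl mult_left_cancel)
  with k have "ferrers_P \<nu> (\<mu> - 1) (cos \<theta>) = C / (8 * - k) * sin \<theta> powr (- (a + 1)) *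
      B_sgn s \<theta> powr (e + 3) * ladder_op a e \<mu> \<rho> (u_sgn s \<theta>)"
    by (intro eq_divide_if_mult_eq) simp_all
  then show "ferrers_P \<nu> (\<mu> - 1) (cos \<theta>) = - C / (8 * ((\<nu> - \<mu> + 1) * (\<nu> + \<mu>))) * sin \<theta> powr (- (a + 1)) *
      B_sgn s \<theta> powr (e + 3) * ladder_op a e \<mu> \<rho> (u_sgn s \<theta>)"
    by (simp only: k_def mult_minus_right minus_divide_right[symmetric] minus_divide_left)
qed

end

section \<open>Ladder steps for the germ at the origin\<close>

lemma eq_mult_divide_if_quotients:
  fixes X :: real
  assumes "Qm * L = r / e * X" "Qm = Qp / e" "r \<noteq> 0" "e \<noteq> 0"
  shows "X = Qp * (L / r)"
  using assms by (simp add: field_simps)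

text \<open>The origin is excluded because a step that divides by \<open>p_v\<close> produces the
  value of a division by 0 there. The correct value is recovered by continuity in
  \<open>r_oct_eqI\<close>.\<close>

definition near_zero_rep :: "real \<Rightarrow> real \<Rightarrow> (real \<Rightarrow> real) \<Rightarrow> bool" where
  "near_zero_rep \<alpha> c \<rho> \<longleftrightarrow>
     (\<forall>u\<in>near_zero - {0}. gauss_2F1 \<alpha> (\<alpha> + 1/2) c (R_oct u) = p_e u powr (2 * \<alpha>) * \<rho> u)"

context
  fixes \<alpha> c :: real and \<rho> :: "real \<Rightarrow> real"
  assumes nonint: "\<alpha> \<notin> \<int>" "\<alpha> + 1/2 \<notin> \<int>" "c \<notin> \<int>" "c - (\<alpha> + 1/2) \<noteq> 0"
    and \<rho>: "rational_on_regular \<rho>"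
    and rep: "near_zero_rep \<alpha> c \<rho>"
begin

private lemma near_ladder:
  assumes "u \<in> near_zero" "u \<noteq> 0"
  shows "p_e u powr (2 * \<alpha> - 1) * ladder_op a (- 6 * \<alpha>) l \<rho> u =
     2 * R_oct u * (1 - R_oct u) * gauss_deriv \<alpha> (\<alpha> + 1/2) c (R_oct u)
     + (l - a - 2 * \<alpha> * R_oct u) * gauss_2F1 \<alpha> (\<alpha> + 1/2) c (R_oct u)"
  by (rule near_zero_ladder[OF nonint(1-3) assms])
    (use rep rational_on_regular_derivative(2)[OF \<rho>] near_zero_regular[OF assms]
      in \<open>auto simp: near_zero_rep_def\<close>)

private lemma param_nonzero: "\<alpha> \<noteq> 0" "c \<noteq> 0" "c - 1 \<noteq> 0"
  using nonint by auto

text \<open>The upper parameters differ by 1/2, so moving \<alpha> by a half step is, up to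
  exchanging them, a unit shift of a single parameter. Here \<open>gauss_lower_b\<close> applies,
  and the condition on l - a makes its zeroth-order term agree with that of
  \<open>ladder_op\<close>.\<close>

lemma near_zero_rep_raise_n:
  assumes "l - a = 2 * (c - (\<alpha> + 1/2))"
  shows "near_zero_rep (\<alpha> - 1/2) c (\<lambda>u. 1 / (2 * (c - (\<alpha> + 1/2))) * ladder_op a (- 6 * \<alpha>) l \<rho> u)"
  unfolding near_zero_rep_def
proof
  fix u assume "u \<in> near_zero - {0}"
  then have u: "u \<in> near_zero" "u \<noteq> 0" by auto
  have "p_e u powr (2 * \<alpha> - 1) * ladder_op a (- 6 * \<alpha>) l \<rho> u =
      2 * (c - (\<alpha> + 1/2)) * gauss_2F1 \<alpha> (\<alpha> + 1/2 - 1) c (R_oct u)"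
    using near_ladder[OF u, of a l] gauss_lower_b[OF nonint(1-3) near_zero_bounds(4)[OF u(1)]]
    unfolding assms by (simp add: algebra_simps)
  moreover have "gauss_2F1 \<alpha> (\<alpha> + 1/2 - 1) c = gauss_2F1 (\<alpha> - 1/2) (\<alpha> - 1/2 + 1/2) c"
    by (simp add: gauss_2F1_commute[of \<alpha>])
  moreover have e: "2 * (\<alpha> - 1/2) = 2 * \<alpha> - 1" by simp
  ultimately show "gauss_2F1 (\<alpha> - 1/2) (\<alpha> - 1/2 + 1/2) c (R_oct u) = p_e u powr (2 * (\<alpha> - 1/2)) *
      (1 / (2 * (c - (\<alpha> + 1/2))) * ladder_op a (- 6 * \<alpha>) l \<rho> u)"
    unfolding e using nonint(4) by (simp add: field_simps)
qed

text \<open>The condition on l - a makes 1 - x with x = \<open>R_oct u\<close> split off; being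
  \<open>p_f^3 / p_e^2\<close>, it supplies the division by \<open>p_f^3\<close> that the Ferrers
  side also needs.\<close>

lemma near_zero_rep_lower_n:
  assumes "l - a = 2 * \<alpha>"
  shows "near_zero_rep (\<alpha> + 1/2) c (\<lambda>u. 1 / (2 * \<alpha>) * (ladder_op a (- 6 * \<alpha>) l \<rho> u / p_f u ^ 3))"
  unfolding near_zero_rep_def
proof
  fix u assume "u \<in> near_zero - {0}"
  then have u: "u \<in> near_zero" "u \<noteq> 0" by auto
  note b = near_zero_bounds[OF u(1)]
  have "p_e u powr (2 * \<alpha> - 1) * ladder_op a (- 6 * \<alpha>) l \<rho> u =
      2 * (1 - R_oct u) * (\<alpha> * gauss_2F1 (\<alpha> + 1) (\<alpha> + 1/2) c (R_oct u))"
    unfolding near_ladder[OF u] gauss_raise_a[OF nonint(1-3) b(4), symmetric] assms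
    by (simp add: algebra_simps)
  moreover have "gauss_2F1 (\<alpha> + 1) (\<alpha> + 1/2) c = gauss_2F1 (\<alpha> + 1/2) (\<alpha> + 1/2 + 1/2) c"
    using gauss_2F1_commute[of "\<alpha> + 1" "\<alpha> + 1/2" "c"] by (simp add: add.assoc)
  moreover have "p_e u powr (2 * \<alpha> - 1) = p_e u powr (2 * (\<alpha> + 1/2)) / (p_e u)\<^sup>2"
    using b by (simp add: powr_diff powr_add power2_eq_square distrib_left)
  ultimately have "gauss_2F1 (\<alpha> + 1/2) (\<alpha> + 1/2 + 1/2) c (R_oct u) = p_e u powr (2 * (\<alpha> + 1/2)) *
      (ladder_op a (- 6 * \<alpha>) l \<rho> u / (2 * \<alpha> * p_f u ^ 3))"
    unfolding one_minus_R_oct[OF u(1)] using param_nonzero b by (intro eq_mult_divide_if_quotients[where e = "(p_e u)\<^sup>2"]) auto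
  then show "gauss_2F1 (\<alpha> + 1/2) (\<alpha> + 1/2 + 1/2) c (R_oct u) = p_e u powr (2 * (\<alpha> + 1/2)) *
      (1 / (2 * \<alpha>) * (ladder_op a (- 6 * \<alpha>) l \<rho> u / p_f u ^ 3))"
    by simp
qed

lemma near_zero_rep_raise_m:
  assumes "l - a = 2 * (c - 1)"
  shows "near_zero_rep (\<alpha> - 1/2) (c - 1) (\<lambda>u. 1 / (2 * (c - 1)) * ladder_op a (- 6 * \<alpha>) l \<rho> u)"
  unfolding near_zero_rep_def
proof
  fix u assume "u \<in> near_zero - {0}"
  then have u: "u \<in> near_zero" "u \<noteq> 0" by auto
  have "p_e u powr (2 * \<alpha> - 1) * ladder_op a (- 6 * \<alpha>) l \<rho> u =
      2 * ((c - 1) * gauss_2F1 \<alpha> (\<alpha> + 1/2 - 1) (c - 1) (R_oct u))"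
    unfolding near_ladder[OF u] gauss_lower_b_c[OF nonint(1-3) near_zero_bounds(4)[OF u(1)], symmetric] assms
    by (simp add: algebra_simps)
  moreover have "gauss_2F1 \<alpha> (\<alpha> + 1/2 - 1) (c - 1) = gauss_2F1 (\<alpha> - 1/2) (\<alpha> - 1/2 + 1/2) (c - 1)"
    by (simp add: gauss_2F1_commute[of \<alpha>])
  moreover have e: "2 * (\<alpha> - 1/2) = 2 * \<alpha> - 1" by simp
  ultimately show "gauss_2F1 (\<alpha> - 1/2) (\<alpha> - 1/2 + 1/2) (c - 1) (R_oct u) = p_e u powr (2 * (\<alpha> - 1/2)) *
      (1 / (2 * (c - 1)) * ladder_op a (- 6 * \<alpha>) l \<rho> u)"
    unfolding e using param_nonzero by (simp add: field_simps)
qed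

text \<open>For l = a the factor x = \<open>R_oct u\<close> splits off, whence the division by
  \<open>p_v\<close> and the constant 216 = 2 * 108.\<close>

lemma near_zero_rep_lower_m:
  "near_zero_rep (\<alpha> + 1/2) (c + 1)
     (\<lambda>u. c / (216 * \<alpha> * (c - (\<alpha> + 1/2))) * (ladder_op a (- 6 * \<alpha>) a \<rho> u / p_v u))"
  unfolding near_zero_rep_def
proof
  fix u assume "u \<in> near_zero - {0}"
  then have u: "u \<in> near_zero" "u \<noteq> 0" by auto
  note b = near_zero_bounds[OF u(1)]
  have pv: "p_v u \<noteq> 0" using u b by (auto simp: p_v_def)
  have "p_e u powr (2 * \<alpha> - 1) * ladder_op a (- 6 * \<alpha>) a \<rho> u = 2 * R_oct u *
      ((1 - R_oct u) * gauss_deriv \<alpha> (\<alpha> + 1/2) c (R_oct u) - \<alpha> * gauss_2F1 \<alpha> (\<alpha> + 1/2) c (R_oct u))"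
    unfolding near_ladder[OF u] by (simp add: algebra_simps)
  also have "\<dots> = 2 * R_oct u * (- \<alpha> * (c - (\<alpha> + 1/2)) / c * gauss_2F1 (\<alpha> + 1) (\<alpha> + 1/2) (c + 1) (R_oct u))"
    unfolding gauss_raise_a_c[OF nonint(1-3) b(4)] ..
  also have "\<dots> = 216 * \<alpha> * (c - (\<alpha> + 1/2)) / c * p_v u / (p_e u)\<^sup>2 * gauss_2F1 (\<alpha> + 1) (\<alpha> + 1/2) (c + 1) (R_oct u)"
    by (simp add: R_oct_def mult_ac)
  finally have "p_e u powr (2 * \<alpha> - 1) * ladder_op a (- 6 * \<alpha>) a \<rho> u =
     216 * \<alpha> * (c - (\<alpha> + 1/2)) / c * p_v u / (p_e u)\<^sup>2 * gauss_2F1 (\<alpha> + 1) (\<alpha> + 1/2) (c + 1) (R_oct u)" .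
  moreover have "gauss_2F1 (\<alpha> + 1) (\<alpha> + 1/2) (c + 1) = gauss_2F1 (\<alpha> + 1/2) (\<alpha> + 1/2 + 1/2) (c + 1)"
    using gauss_2F1_commute[of "\<alpha> + 1" "\<alpha> + 1/2" "(c + 1)"] by (simp add: add.assoc)
  moreover have "p_e u powr (2 * \<alpha> - 1) = p_e u powr (2 * (\<alpha> + 1/2)) / (p_e u)\<^sup>2"
    using b by (simp add: powr_diff powr_add power2_eq_square distrib_left)
  ultimately have "gauss_2F1 (\<alpha> + 1/2) (\<alpha> + 1/2 + 1/2) (c + 1) (R_oct u) = p_e u powr (2 * (\<alpha> + 1/2)) *
      (ladder_op a (- 6 * \<alpha>) a \<rho> u / (216 * \<alpha> * (c - (\<alpha> + 1/2)) / c * p_v u))"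
    using param_nonzero nonint(4) b pv by (intro eq_mult_divide_if_quotients[where e = "(p_e u)\<^sup>2"]) auto
  then show "gauss_2F1 (\<alpha> + 1/2) (\<alpha> + 1/2 + 1/2) (c + 1) (R_oct u) = p_e u powr (2 * (\<alpha> + 1/2)) *
      (c / (216 * \<alpha> * (c - (\<alpha> + 1/2))) * (ladder_op a (- 6 * \<alpha>) a \<rho> u / p_v u))"
    by simp
qed

end

section \<open>Induction over the lattice\<close>

lemma rising_fact_plus1:
  assumes "d \<notin> \<int>"
  shows "rising_fact d (k + 1) = rising_fact d k * (d + real_of_int k)"
proof (cases "k \<ge> 0")
  case True
  then have "nat (k + 1) = Suc (nat k)" by simp
  then show ?thesis using True by (simp add: rising_fact_def pochhammer_Suc)
next
  case False
  \<comment> \<open>The offset lets i start at 0, so that k = -1 with the empty product at k + 1 is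
    included.\<close>
  define i where "i = nat (- (k + 1))"
  have k: "nat (- k) = Suc i" "k = - int (Suc i)" using False by (auto simp: i_def)
  have "k + 1 = - int i" using False by (simp add: i_def)
  then have "rising_fact d (k + 1) = inverse (pochhammer (d - real i) i)"
    by (simp add: rising_fact_def)
  moreover have "rising_fact d k = inverse ((d - real (Suc i)) * pochhammer (d - real i) i)"
  proof -
    have "d - real (Suc i) + 1 = d - real i" by simp
    then show ?thesis using False by (simp only: rising_fact_def k(1) pochhammer_rec if_False)
  qed
  moreover have "d - real (Suc i) \<noteq> 0" using assms by auto
  moreover have "d + real_of_int k = d - real (Suc i)" by (simp add: k(2))
  ultimately show ?thesis by (simp del: of_nat_Suc)
qed

lemma rising_fact_nonzero:
  assumes "d \<notin> \<int>"
  shows "rising_fact d k \<noteq> 0"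
proof -
  have "d - real i \<notin> \<int>" for i
    using assms by (metis Ints_add Ints_of_nat diff_add_cancel)
  then show ?thesis by (simp add: rising_fact_def pochhammer_nonzero_if_nonint assms)
qed

lemma nonint_shift: "x \<notin> \<int> \<Longrightarrow> x + real_of_int k \<noteq> 0"
  by (metis Ints_minus Ints_of_int add.inverse_inverse eq_neg_iff_add_eq_0)

lemma nonint_consts:
  "(1/4::real) \<notin> \<int>" "(5/4::real) \<notin> \<int>" "(5/12::real) \<notin> \<int>" "(13/12::real) \<notin> \<int>"
  "(7/12::real) \<notin> \<int>" "(1/12::real) \<notin> \<int>" "(3/4::real) \<notin> \<int>"
  by (auto intro: nonintI[of 4 _ 1] nonintI[of 4 _ 5] nonintI[of 4 _ 3] nonintI[of 12 _ 5]
      nonintI[of 12 _ 13] nonintI[of 12 _ 7] nonintI[of 12 _ 1])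

lemma nonzero_shifts:
  fixes n m :: int
  shows "1/4 + real_of_int m \<noteq> 0" "5/4 + real_of_int m \<noteq> 0" "3/4 - real_of_int m \<noteq> 0"
    "5/12 + real_of_int m - real_of_int n \<noteq> 0" "7/12 + real_of_int n - real_of_int m \<noteq> 0"
    "13/12 + real_of_int n + real_of_int m \<noteq> 0" "1/12 + real_of_int n + real_of_int m \<noteq> 0"
  using nonint_shift[OF nonint_consts(1), of m] nonint_shift[OF nonint_consts(2), of m]
    nonint_shift[OF nonint_consts(7), of "- m"] nonint_shift[OF nonint_consts(3), of "m - n"]
    nonint_shift[OF nonint_consts(5), of "n - m"] nonint_shift[OF nonint_consts(4), of "n + m"]
    nonint_shift[OF nonint_consts(6), of "n + m"] by (simp_all add: algebra_simps)

lemma d_oct_nonzero: "d_oct n m \<noteq> 0"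
  by (simp add: d_oct_def rising_fact_nonzero nonint_consts)

lemma d_oct_raise_n:
  "d_oct (n + 1) m * (7/12 + real_of_int n - real_of_int m) =
     d_oct n m * (13/12 + real_of_int n + real_of_int m)"
proof -
  define K where "K = 7/12 + real_of_int n - real_of_int m"
  have e1: "rising_fact (5/12) (m - n) =
      rising_fact (5/12) (m - (n + 1)) * (- K)"
    unfolding K_def using rising_fact_plus1[OF nonint_consts(3), of "m - (n + 1)"] by (simp add: algebra_simps)
  have e2: "rising_fact (13/12) (m + (n + 1)) =
      rising_fact (13/12) (m + n) * (13/12 + real_of_int n + real_of_int m)"
    using rising_fact_plus1[OF nonint_consts(4), of "m + n"] by (simp add: algebra_simps)
  have e3: "(- 1 :: real) powi (m + (n + 1)) = - ((- 1) powi (m + n))"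
    by (simp add: add.assoc[symmetric] power_int_add_1)
  show ?thesis unfolding d_oct_def e1 e2 e3 K_def[symmetric] by simp
qed

lemma d_oct_raise_m:
  "d_oct n (m + 1) * ((1/4 + real_of_int m) * (5/4 + real_of_int m)) =
     - 27 * d_oct n m * ((5/12 + real_of_int m - real_of_int n) * (13/12 + real_of_int n + real_of_int m))"
proof -
  have "rising_fact (5/12) (m + 1 - n) =
      rising_fact (5/12) (m - n) * (5/12 + real_of_int m - real_of_int n)"
    using rising_fact_plus1[OF nonint_consts(3), of "m - n"] by (simp add: algebra_simps)
  moreover have "rising_fact (13/12) (m + 1 + n) =
      rising_fact (13/12) (m + n) * (13/12 + real_of_int n + real_of_int m)"
    using rising_fact_plus1[OF nonint_consts(4), of "m + n"] by (simp add: algebra_simps)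
  moreover have "(- 1 :: real) powi (m + 1 + n) = - ((- 1) powi (m + n))"
    using power_int_add_1[of "- 1 :: real" "m + n"] by (simp add: algebra_simps)
  moreover have "(3 :: real) powi (3 * (m + 1)) = 27 * 3 powi (3 * m)"
    by (simp add: distrib_left power_int_add)
  ultimately show ?thesis
    using nonzero_shifts(1,2)[of m]
    by (simp add: d_oct_def rising_fact_plus1 nonint_consts rising_fact_nonzero)
qed

text \<open>Dividing the second constant by \<open>d_oct n m\<close> lets the same rational function occur in both
  Ferrers formulas.\<close>

definition plus_const :: "int \<Rightarrow> int \<Rightarrow> real" where
  "plus_const n m = 2 powi (- 2 * m - 3 * n) * inverse (Gamma (3/4 - real_of_int m))"

definition minus_const :: "int \<Rightarrow> int \<Rightarrow> real" where
  "minus_const n m = 2 powi (- 2 * m - 3 * n) * 3 powr (3/4 + 3 * real_of_int m) *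
     inverse (Gamma (5/4 + real_of_int m)) / d_oct n m"

lemma two_powi_shift:
  "(2::real) powi (- 2 * m - 3 * (n + 1)) = 2 powi (- 2 * m - 3 * n) / 8"
  "(2::real) powi (- 2 * (m + 1) - 3 * n) = 2 powi (- 2 * m - 3 * n) / 4"
proof -
  have p: "(2::real) powi (k - 3) = 2 powi k / 8" "(2::real) powi (k - 2) = 2 powi k / 4" for k
    using power_int_diff[of "2::real" k 3] power_int_diff[of "2::real" k 2] by simp_all
  have "- 2 * m - 3 * (n + 1) = (- 2 * m - 3 * n) - 3" "- 2 * (m + 1) - 3 * n = (- 2 * m - 3 * n) - 2"
    by simp_all
  then show "(2::real) powi (- 2 * m - 3 * (n + 1)) = 2 powi (- 2 * m - 3 * n) / 8"
    "(2::real) powi (- 2 * (m + 1) - 3 * n) = 2 powi (- 2 * m - 3 * n) / 4"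
    by (simp_all only: p)
qed

lemma plus_const_raise_n: "plus_const (n + 1) m = plus_const n m / 8"
  unfolding plus_const_def two_powi_shift by simp

lemma plus_const_raise_m: "plus_const n (m + 1) = - plus_const n m * (1/4 + real_of_int m) / 4"
proof -
  define x where "x = - (1/4) - real_of_int m"
  have x: "3/4 - real_of_int (m + 1) = x" "3/4 - real_of_int m = x + 1" "1/4 + real_of_int m = - x" "x \<noteq> 0"
    using nonzero_shifts(1)[of m] by (simp_all add: x_def)
  have "x \<notin> \<int>\<^sub>\<le>\<^sub>0"
    using nonintI[of 4 x "- 1 - 4 * m"] nonpos_Ints_subset_Ints by (auto simp: x_def)
  then have "Gamma (x + 1) = x * Gamma x" by (rule Gamma_plus1)
  then show ?thesis
    unfolding plus_const_def two_powi_shift x(1-3) using x(4) by simp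
qed

text \<open>The factors 13/12 + n + m and 7/12 + n - m are the ladder constants
  \<open>\<nu> + 1 - \<mu>\<close> for \<mu> = -1/4 - m and \<mu> = 1/4 + m. The recurrence of
  \<open>d_oct\<close> compensates exactly their quotient.\<close>

lemma minus_const_raise_n:
  "minus_const (n + 1) m * (13/12 + real_of_int n + real_of_int m) =
     minus_const n m * (7/12 + real_of_int n - real_of_int m) / 8"
proof -
  define x where "x = 13/12 + real_of_int n + real_of_int m"
  define y where "y = 7/12 + real_of_int n - real_of_int m"
  have xy: "x \<noteq> 0" "y \<noteq> 0" using nonzero_shifts(5,6)[of n m] by (simp_all add: x_def y_def)
  then have "d_oct (n + 1) m = d_oct n m * x / y"
    using d_oct_raise_n[of n m] by (simp add: eq_divide_eq x_def y_def)
  then show ?thesis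
    unfolding minus_const_def two_powi_shift x_def[symmetric] y_def[symmetric]
    using xy d_oct_nonzero[of n m] by (simp add: mult_ac)
qed

text \<open>Raising m lowers the order -1/4 - m, so the two factors are, up to sign, the constants
  \<open>\<nu> - \<mu> + 1\<close> and \<open>\<nu> + \<mu>\<close> of that step. The 27 from the
  power of 3 and the factor 5/4 + m from Gamma cancel against \<open>d_oct\<close>.\<close>

lemma minus_const_raise_m:
  "minus_const n (m + 1) * ((5/12 + real_of_int m - real_of_int n) * (13/12 + real_of_int n + real_of_int m)) =
     - minus_const n m * (1/4 + real_of_int m) / 4"
proof -
  have "5/4 + real_of_int m \<notin> \<int>\<^sub>\<le>\<^sub>0"
    using nonintI[of 4 "5/4 + real_of_int m" "5 + 4 * m"] nonpos_Ints_subset_Ints by auto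
  then have G: "Gamma (5/4 + real_of_int (m + 1)) = (5/4 + real_of_int m) * Gamma (5/4 + real_of_int m)"
    using Gamma_plus1[of "5/4 + real_of_int m"] by (simp add: algebra_simps)
  have "3/4 + 3 * real_of_int (m + 1) = 3/4 + 3 * real_of_int m + 3" by simp
  then have p: "(3::real) powr (3/4 + 3 * real_of_int (m + 1)) = 3 powr (3/4 + 3 * real_of_int m) * 27"
    by (simp only: powr_add) (simp add: powr_numeral)
  define K where "K = (5/12 + real_of_int m - real_of_int n) * (13/12 + real_of_int n + real_of_int m)"
  have K: "K \<noteq> 0" using nonzero_shifts(4)[of m n] nonzero_shifts(6)[of n m] by (simp add: K_def)
  define y where "y = 1/4 + real_of_int m"
  define z where "z = 5/4 + real_of_int m"
  have yz: "y \<noteq> 0" "z \<noteq> 0" using nonzero_shifts(1,2)[of m] by (simp_all add: y_def z_def)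
  then have d: "d_oct n (m + 1) = - 27 * d_oct n m * K / (y * z)"
    using d_oct_raise_m[of n m] unfolding K_def[symmetric] y_def[symmetric] z_def[symmetric]
    by (metis mult_eq_0_iff nonzero_eq_divide_eq)
  show ?thesis
    unfolding minus_const_def two_powi_shift G p d K_def[symmetric] y_def[symmetric] z_def[symmetric]
    using yz d_oct_nonzero[of n m] K by (simp add: inverse_eq_divide) (simp add: mult_ac)
qed

text \<open>Each item compares the scalar of a Ferrers step with that of the corresponding step of
  the germ; once they agree through \<open>theta_rep_scale\<close>, the same rational function
  serves both.\<close>

lemma const_ratio:
  fixes M M' x y :: real
  assumes "x \<noteq> 0" "y \<noteq> 0"
  shows "M' * x = M * y / 8 \<Longrightarrow> M / (8 * x) = M' * (1 / y)"
    and "M * y = M' * - x / 8 \<Longrightarrow> 64 * (- M / (8 * - x)) = M' * (- 1 / y)"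
    and "M' * x = - M * y / 4 \<Longrightarrow> - M / (8 * - x) = M' * (- 1 / (2 * y))"
    and "M = M' / 8 \<Longrightarrow> 64 * (- M / (8 * y)) = M' * (- 1 / y)"
    and "M' = - M * y / 4 \<Longrightarrow> M / 8 = M' * (- 1 / (2 * y))"
  using assms by (simp_all add: field_simps)

lemma const_ratio_lower_m:
  fixes M M' c K :: real
  assumes "K \<noteq> 0"
  shows "M = M' * c / 4 \<Longrightarrow> 16 / 27 * (- M / (8 * K)) = M' * (- c / (54 * K))"
    and "M * K = - M' * c / 4 \<Longrightarrow> 16 / 27 * (M / 8) = M' * (- c / (54 * K))"
  using assms by (simp_all add: field_simps)

section \<open>The four lattice steps, simultaneously for the germ and both Ferrers
  functions\<close>

definition octahedral_rep :: "int \<Rightarrow> int \<Rightarrow> (real \<Rightarrow> real) \<Rightarrow> bool" where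
  "octahedral_rep n m \<rho> \<longleftrightarrow>
     rational_on_regular \<rho> \<and>
     near_zero_rep (- 1/24 - real_of_int m / 2 - real_of_int n / 2) (3/4 - real_of_int m) \<rho> \<and>
     theta_rep 1 (1/4 + real_of_int m) (1/4 + 3 * real_of_int m + 3 * real_of_int n) (plus_const n m) \<rho>
       (\<lambda>\<theta>. ferrers_P (- 1/6 + real_of_int n) (1/4 + real_of_int m) (cos \<theta>)) \<and>
     theta_rep (- 1) (1/4 + real_of_int m) (1/4 + 3 * real_of_int m + 3 * real_of_int n) (minus_const n m) \<rho>
       (\<lambda>\<theta>. ferrers_P (- 1/6 + real_of_int n) (- 1/4 - real_of_int m) (cos \<theta>))"

context
  fixes n m :: int and \<rho> :: "real \<Rightarrow> real"
  assumes rep: "octahedral_rep n m \<rho>"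
begin

private abbreviation (input) "\<nu> \<equiv> - 1/6 + real_of_int n"
private abbreviation (input) "a \<equiv> 1/4 + real_of_int m"
private abbreviation (input) "e \<equiv> 1/4 + 3 * real_of_int m + 3 * real_of_int n"
private abbreviation (input) "\<alpha> \<equiv> - 1/24 - real_of_int m / 2 - real_of_int n / 2"
private abbreviation (input) "c \<equiv> 3/4 - real_of_int m"

private lemma nonint: "\<nu> \<notin> \<int>" "a \<notin> \<int>" "- 1/4 - real_of_int m \<notin> \<int>" "\<alpha> \<notin> \<int>" "\<alpha> + 1/2 \<notin> \<int>" "c \<notin> \<int>"
proof -
  show "\<nu> \<notin> \<int>" by (rule nonintI[of 6 _ "- 1 + 6 * n"]) (simp, presburger)
  show "a \<notin> \<int>" by (rule nonintI[of 4 _ "1 + 4 * m"]) (simp, presburger)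
  show "- 1/4 - real_of_int m \<notin> \<int>" by (rule nonintI[of 4 _ "- 1 - 4 * m"]) (simp, presburger)
  show "\<alpha> \<notin> \<int>" by (rule nonintI[of 24 _ "- 1 - 12 * m - 12 * n"]) (simp, presburger)
  show "\<alpha> + 1/2 \<notin> \<int>" by (rule nonintI[of 24 _ "11 - 12 * m - 12 * n"]) (simp, presburger)
  show "c \<notin> \<int>" by (rule nonintI[of 4 _ "3 - 4 * m"]) (simp, presburger)
qed

private lemma c_\<alpha>: "c - (\<alpha> + 1/2) \<noteq> 0"
  using nonzero_shifts(5)[of n m] by (simp add: field_simps)

private lemma e_eq: "- 6 * \<alpha> = e"
  by simp

private lemma parts:
  "rational_on_regular \<rho>" "near_zero_rep \<alpha> c \<rho>"
  "theta_rep 1 a e (plus_const n m) \<rho> (\<lambda>\<theta>. ferrers_P \<nu> a (cos \<theta>))"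
  "theta_rep (- 1) a e (minus_const n m) \<rho> (\<lambda>\<theta>. ferrers_P \<nu> (- 1/4 - real_of_int m) (cos \<theta>))"
  using rep by (simp_all only: octahedral_rep_def)

private lemmas near = nonint(4,5,6) c_\<alpha> parts(1,2)

private lemma plus: "(1::real)\<^sup>2 = 1" and minus: "(- 1::real)\<^sup>2 = 1"
  by simp_all

lemma octahedral_rep_raise_n:
  "octahedral_rep (n + 1) m (\<lambda>u. 1 / (7/12 + real_of_int n - real_of_int m) * ladder_op a e (5/6 + real_of_int n) \<rho> u)"
  unfolding octahedral_rep_def
proof (intro conjI)
  let ?k = "7/12 + real_of_int n - real_of_int m"
  have k: "?k \<noteq> 0" by (rule nonzero_shifts)
  show "rational_on_regular (\<lambda>u. 1 / ?k * ladder_op a e (5/6 + real_of_int n) \<rho> u)"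
    by (intro rational_on_regular_cmult rational_on_regular_ladder_op parts)
  \<comment> \<open>The constant of the Gauss relation coincides with the Ferrers constant
    \<open>\<nu> + 1 - \<mu>\<close> at \<mu> = 1/4 + m, and l = \<nu> + 1 meets the condition of
    the germ; so one operator serves both sides.\<close>
  have e1: "2 * (c - (\<alpha> + 1/2)) = ?k"
    and e2: "\<alpha> - 1/2 = - 1/24 - real_of_int m / 2 - real_of_int (n + 1) / 2"
    and p: "5/6 + real_of_int n - a = 2 * (c - (\<alpha> + 1/2))"
    by (simp_all add: field_simps)
  show "near_zero_rep (- 1/24 - real_of_int m / 2 - real_of_int (n + 1) / 2) c
      (\<lambda>u. 1 / ?k * ladder_op a e (5/6 + real_of_int n) \<rho> u)"
    using near_zero_rep_raise_n[OF near p] unfolding e_eq e1 e2 .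
  have \<nu>: "\<nu> + 1 = - 1/6 + real_of_int (n + 1)" and l: "- 1/6 + real_of_int (n + 1) = 5/6 + real_of_int n"
    and e: "e + 3 = 1/4 + 3 * real_of_int m + 3 * real_of_int (n + 1)"
    and k1: "\<nu> + 1 - a = ?k" and k2: "\<nu> + 1 - (- 1/4 - real_of_int m) = 13/12 + real_of_int n + real_of_int m"
    by simp_all
  have nz: "\<nu> + 1 - a \<noteq> 0" "\<nu> + 1 - (- 1/4 - real_of_int m) \<noteq> 0"
    unfolding k1 k2 by (rule nonzero_shifts)+
  show "theta_rep 1 a (1/4 + 3 * real_of_int m + 3 * real_of_int (n + 1)) (plus_const (n + 1) m)
      (\<lambda>u. 1 / ?k * ladder_op a e (5/6 + real_of_int n) \<rho> u)
      (\<lambda>\<theta>. ferrers_P (- 1/6 + real_of_int (n + 1)) a (cos \<theta>))"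
    using theta_rep_raise_nu[OF plus nonint(1,2) parts(1,3) nz(1)]
    unfolding k1 unfolding \<nu> e unfolding l
    by (rule theta_rep_scale) (simp add: plus_const_raise_n)
  show "theta_rep (- 1) a (1/4 + 3 * real_of_int m + 3 * real_of_int (n + 1)) (minus_const (n + 1) m)
      (\<lambda>u. 1 / ?k * ladder_op a e (5/6 + real_of_int n) \<rho> u)
      (\<lambda>\<theta>. ferrers_P (- 1/6 + real_of_int (n + 1)) (- 1/4 - real_of_int m) (cos \<theta>))"
    using theta_rep_raise_nu[OF minus nonint(1,3) parts(1,4) nz(2)]
    unfolding k2 unfolding \<nu> e unfolding l
    by (rule theta_rep_scale) (rule const_ratio(1)[OF nonzero_shifts(6) k minus_const_raise_n])
qed

lemma octahedral_rep_lower_n: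
  "octahedral_rep (n - 1) m (\<lambda>u. - 1 / (1/12 + real_of_int n + real_of_int m) *
     (ladder_op a e (1/6 - real_of_int n) \<rho> u / p_f u ^ 3))"
  unfolding octahedral_rep_def
proof (intro conjI)
  let ?k = "1/12 + real_of_int n + real_of_int m"
  have k: "?k \<noteq> 0" by (rule nonzero_shifts)
  show "rational_on_regular (\<lambda>u. - 1 / ?k * (ladder_op a e (1/6 - real_of_int n) \<rho> u / p_f u ^ 3))"
    by (intro rational_on_regular_cmult rational_on_regular_divide_p_f rational_on_regular_ladder_op parts)
  have "1 / (2 * \<alpha>) = - 1 / ?k" "\<alpha> + 1/2 = - 1/24 - real_of_int m / 2 - real_of_int (n - 1) / 2"
    using k by (simp_all add: field_simps)
  moreover have "1/6 - real_of_int n - a = 2 * \<alpha>" by simp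
  ultimately show "near_zero_rep (- 1/24 - real_of_int m / 2 - real_of_int (n - 1) / 2) c
      (\<lambda>u. - 1 / ?k * (ladder_op a e (1/6 - real_of_int n) \<rho> u / p_f u ^ 3))"
    using near_zero_rep_lower_n[OF near, of "1/6 - real_of_int n" a] unfolding e_eq by metis
  have \<nu>: "\<nu> - 1 = - 1/6 + real_of_int (n - 1)" and l: "- \<nu> = 1/6 - real_of_int n"
    and e: "e - 3 = 1/4 + 3 * real_of_int m + 3 * real_of_int (n - 1)"
    and k1: "\<nu> + a = ?k"
    and k2: "\<nu> + (- 1/4 - real_of_int m) = - (5/12 + real_of_int m - real_of_int n)"
    by simp_all
  have nz: "\<nu> + a \<noteq> 0" "\<nu> + (- 1/4 - real_of_int m) \<noteq> 0"
    unfolding k1 k2 neg_equal_0_iff_equal by (rule nonzero_shifts)+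
  show "theta_rep 1 a (1/4 + 3 * real_of_int m + 3 * real_of_int (n - 1)) (plus_const (n - 1) m)
      (\<lambda>u. - 1 / ?k * (ladder_op a e (1/6 - real_of_int n) \<rho> u / p_f u ^ 3))
      (\<lambda>\<theta>. ferrers_P (- 1/6 + real_of_int (n - 1)) a (cos \<theta>))"
    using theta_rep_divide_p_f[OF plus theta_rep_lower_nu[OF plus nonint(1,2) parts(1,3) nz(1)]]
    unfolding k1 unfolding \<nu> e l
    by (rule theta_rep_scale) (rule const_ratio(4)[OF k k], use plus_const_raise_n[of "n - 1" m] in simp)
  have "minus_const n m * ?k = minus_const (n - 1) m * - (5/12 + real_of_int m - real_of_int n) / 8"
    using minus_const_raise_n[of "n - 1" m] by (simp add: algebra_simps)
  then have "64 * (- minus_const n m / (8 * - (5/12 + real_of_int m - real_of_int n))) =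
      minus_const (n - 1) m * (- 1 / ?k)"
    by (rule const_ratio(2)[OF nonzero_shifts(4) k])
  then show "theta_rep (- 1) a (1/4 + 3 * real_of_int m + 3 * real_of_int (n - 1)) (minus_const (n - 1) m)
      (\<lambda>u. - 1 / ?k * (ladder_op a e (1/6 - real_of_int n) \<rho> u / p_f u ^ 3))
      (\<lambda>\<theta>. ferrers_P (- 1/6 + real_of_int (n - 1)) (- 1/4 - real_of_int m) (cos \<theta>))"
    using theta_rep_divide_p_f[OF minus theta_rep_lower_nu[OF minus nonint(1,3) parts(1,4) nz(2)]]
    unfolding k2 unfolding \<nu> e l by (intro theta_rep_scale)
qed

text \<open>The first order rises with m and the second falls, so \<open>theta_rep_raise_mu\<close>
  and \<open>theta_rep_lower_mu\<close> are used side by side. Their operators agree because the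
  parameter l is -\<mu> in one and \<mu> in the other.\<close>

lemma octahedral_rep_raise_m:
  "octahedral_rep n (m + 1) (\<lambda>u. - 1 / (2 * a) * ladder_op a e (- a) \<rho> u)"
  unfolding octahedral_rep_def
proof (intro conjI)
  have a: "a \<noteq> 0" by (rule nonzero_shifts)
  show "rational_on_regular (\<lambda>u. - 1 / (2 * a) * ladder_op a e (- a) \<rho> u)"
    by (intro rational_on_regular_cmult rational_on_regular_ladder_op parts)
  have "1 / (2 * (c - 1)) = - 1 / (2 * a)" using a by (simp add: field_simps)
  moreover have "\<alpha> - 1/2 = - 1/24 - real_of_int (m + 1) / 2 - real_of_int n / 2" "c - 1 = 3/4 - real_of_int (m + 1)"
    "- a - a = 2 * (c - 1)" by (simp_all add: field_simps)
  ultimately show "near_zero_rep (- 1/24 - real_of_int (m + 1) / 2 - real_of_int n / 2) (3/4 - real_of_int (m + 1))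
      (\<lambda>u. - 1 / (2 * a) * ladder_op a e (- a) \<rho> u)"
    using near_zero_rep_raise_m[OF near, of "- a" a] unfolding e_eq by metis
  have e: "e + 3 = 1/4 + 3 * real_of_int (m + 1) + 3 * real_of_int n"
    and a1: "a + 1 = 1/4 + real_of_int (m + 1)"
    and a2: "- 1/4 - real_of_int m - 1 = - 1/4 - real_of_int (m + 1)"
    and l: "- 1/4 - real_of_int m = - a"
    and k1: "\<nu> - (- 1/4 - real_of_int m) + 1 = 13/12 + real_of_int n + real_of_int m"
    and k2: "\<nu> + (- 1/4 - real_of_int m) = - (5/12 + real_of_int m - real_of_int n)"
    by simp_all
  have nz: "\<nu> - (- 1/4 - real_of_int m) + 1 \<noteq> 0" "\<nu> + (- 1/4 - real_of_int m) \<noteq> 0"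
    unfolding k1 k2 neg_equal_0_iff_equal by (rule nonzero_shifts)+
  show "theta_rep 1 (1/4 + real_of_int (m + 1)) (1/4 + 3 * real_of_int (m + 1) + 3 * real_of_int n) (plus_const n (m + 1))
      (\<lambda>u. - 1 / (2 * a) * ladder_op a e (- a) \<rho> u)
      (\<lambda>\<theta>. ferrers_P \<nu> (1/4 + real_of_int (m + 1)) (cos \<theta>))"
    using theta_rep_raise_mu[OF plus nonint(1,2) parts(1,3)]
    unfolding e a1
    by (rule theta_rep_scale) (rule const_ratio(5)[OF a a plus_const_raise_m])
  define K where "K = (5/12 + real_of_int m - real_of_int n) * (13/12 + real_of_int n + real_of_int m)"
  have K: "K \<noteq> 0" using nonzero_shifts(4)[of m n] nonzero_shifts(6)[of n m] by (simp add: K_def)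
  have KK: "(13/12 + real_of_int n + real_of_int m) * - (5/12 + real_of_int m - real_of_int n) = - K"
    unfolding K_def by algebra
  have "- minus_const n m / (8 * - K) = minus_const n (m + 1) * (- 1 / (2 * a))"
    by (rule const_ratio(3)[OF K a]) (unfold K_def, rule minus_const_raise_m)
  then show "theta_rep (- 1) (1/4 + real_of_int (m + 1)) (1/4 + 3 * real_of_int (m + 1) + 3 * real_of_int n) (minus_const n (m + 1))
      (\<lambda>u. - 1 / (2 * a) * ladder_op a e (- a) \<rho> u)
      (\<lambda>\<theta>. ferrers_P \<nu> (- 1/4 - real_of_int (m + 1)) (cos \<theta>))"
    using theta_rep_lower_mu[OF minus nonint(1,3) parts(1,4) nz]
    unfolding k1 k2 KK unfolding e a1 a2 unfolding l by (intro theta_rep_scale)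
qed

text \<open>The constant 54 arises twice: from \<open>216 \<alpha> (c - \<alpha> - 1/2)\<close>,
  where both factors are halves of the shifted parameters up to sign, and from the 16/27 of
  \<open>theta_rep_divide_p_v\<close> combined with the denominators 8 and 4.\<close>

lemma octahedral_rep_lower_m:
  "octahedral_rep n (m - 1) (\<lambda>u. - c / (54 * ((7/12 + real_of_int n - real_of_int m) * (1/12 + real_of_int n + real_of_int m)))
     * (ladder_op a e a \<rho> u / p_v u))"
  unfolding octahedral_rep_def
proof (intro conjI)
  define K where "K = (7/12 + real_of_int n - real_of_int m) * (1/12 + real_of_int n + real_of_int m)"
  have K: "K \<noteq> 0" using nonzero_shifts(5,7)[of n m] by (simp add: K_def)
  have c: "c \<noteq> 0" by (rule nonzero_shifts)
  have "rational_on_regular (\<lambda>u. - c / (54 * K) * (ladder_op a e a \<rho> u / p_v u))"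
    by (intro rational_on_regular_cmult rational_on_regular_divide_p_v rational_on_regular_ladder_op parts)
  then show "rational_on_regular (\<lambda>u. - c / (54 * ((7/12 + real_of_int n - real_of_int m) * (1/12 + real_of_int n + real_of_int m)))
     * (ladder_op a e a \<rho> u / p_v u))" unfolding K_def .
  have "216 * \<alpha> * (c - (\<alpha> + 1/2)) = - (54 * K)" unfolding K_def by (simp add: field_simps)
  then have "c / (216 * \<alpha> * (c - (\<alpha> + 1/2))) = - c / (54 * K)" by (simp only: minus_divide_right[symmetric] minus_divide_left)
  moreover have "\<alpha> + 1/2 = - 1/24 - real_of_int (m - 1) / 2 - real_of_int n / 2" "c + 1 = 3/4 - real_of_int (m - 1)"
    by (simp_all add: field_simps)
  ultimately show "near_zero_rep (- 1/24 - real_of_int (m - 1) / 2 - real_of_int n / 2) (3/4 - real_of_int (m - 1))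
      (\<lambda>u. - c / (54 * ((7/12 + real_of_int n - real_of_int m) * (1/12 + real_of_int n + real_of_int m)))
     * (ladder_op a e a \<rho> u / p_v u))"
    using near_zero_rep_lower_m[OF near, of a] unfolding e_eq K_def[symmetric] by metis
  have e: "e - 3 = 1/4 + 3 * real_of_int (m - 1) + 3 * real_of_int n"
    and a1: "a - 1 = 1/4 + real_of_int (m - 1)"
    and a2: "- 1/4 - real_of_int m + 1 = - 1/4 - real_of_int (m - 1)"
    and l: "- (- 1/4 - real_of_int m) = a"
    and k1: "\<nu> - a + 1 = 7/12 + real_of_int n - real_of_int m"
    and k2: "\<nu> + a = 1/12 + real_of_int n + real_of_int m"
    by simp_all
  have nz: "\<nu> - a + 1 \<noteq> 0" "\<nu> + a \<noteq> 0"
    unfolding k1 k2 by (rule nonzero_shifts)+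
  have "plus_const n m = plus_const n (m - 1) * c / 4"
    using plus_const_raise_m[of n "m - 1"] by (simp add: algebra_simps)
  then have "16 / 27 * (- plus_const n m / (8 * K)) = plus_const n (m - 1) * (- c / (54 * K))"
    by (rule const_ratio_lower_m(1)[OF K])
  then show "theta_rep 1 (1/4 + real_of_int (m - 1)) (1/4 + 3 * real_of_int (m - 1) + 3 * real_of_int n) (plus_const n (m - 1))
      (\<lambda>u. - c / (54 * ((7/12 + real_of_int n - real_of_int m) * (1/12 + real_of_int n + real_of_int m)))
     * (ladder_op a e a \<rho> u / p_v u))
      (\<lambda>\<theta>. ferrers_P \<nu> (1/4 + real_of_int (m - 1)) (cos \<theta>))"
    using theta_rep_divide_p_v[OF plus theta_rep_lower_mu[OF plus nonint(1,2) parts(1,3) nz]]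
    unfolding k1 k2 K_def[symmetric] unfolding e a1 by (intro theta_rep_scale)
  have "minus_const n m * K = - minus_const n (m - 1) * c / 4"
    using minus_const_raise_m[of n "m - 1"] unfolding K_def by (simp add: field_simps)
  then have "16 / 27 * (minus_const n m / 8) = minus_const n (m - 1) * (- c / (54 * K))"
    by (rule const_ratio_lower_m(2)[OF K])
  then show "theta_rep (- 1) (1/4 + real_of_int (m - 1)) (1/4 + 3 * real_of_int (m - 1) + 3 * real_of_int n) (minus_const n (m - 1))
      (\<lambda>u. - c / (54 * ((7/12 + real_of_int n - real_of_int m) * (1/12 + real_of_int n + real_of_int m)))
     * (ladder_op a e a \<rho> u / p_v u))
      (\<lambda>\<theta>. ferrers_P \<nu> (- 1/4 - real_of_int (m - 1)) (cos \<theta>))"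
    using theta_rep_divide_p_v[OF minus theta_rep_raise_mu[OF minus nonint(1,3) parts(1,4)]]
    unfolding K_def[symmetric] e a1 a2 l by (intro theta_rep_scale)
qed

end

lemma octahedral_rep_base: "octahedral_rep 0 0 (\<lambda>_. 1)"
proof -
  have "rational_on_regular (\<lambda>_. 1)" using rational_on_regular_poly[of 1] by simp
  moreover have "near_zero_rep (- 1/24) (3/4) (\<lambda>_. 1)"
    using gauss_R_oct by (auto simp: near_zero_rep_def)
  moreover have "theta_rep 1 (1/4) (1/4) (plus_const 0 0) (\<lambda>_. 1) (\<lambda>\<theta>. ferrers_P (- 1/6) (1/4) (cos \<theta>))"
    using ferrers_P_base[of 1 1] by (simp add: theta_rep_def plus_const_def)
  moreover have "theta_rep (- 1) (1/4) (1/4) (minus_const 0 0) (\<lambda>_. 1) (\<lambda>\<theta>. ferrers_P (- 1/6) (- 1/4) (cos \<theta>))"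
  proof -
    \<comment> \<open>The normalization 27 of the base case is the origin of the constant 3^(3/4) in
      the second formula.\<close>
    have "(27::real) = 3 powr 3" by simp
    then have "(27::real) powr (1/4) = 3 powr (3 * (1/4))" by (simp only: powr_powr)
    then have "(27::real) powr (1/4) = 3 powr (3/4)" by simp
    then show ?thesis
      using ferrers_P_base[of "- 1" 27] by (simp add: theta_rep_def minus_const_def d_oct_def rising_fact_def)
  qed
  ultimately show ?thesis by (simp add: octahedral_rep_def)
qed

lemma octahedral_rep_exists: "\<exists>\<rho>. octahedral_rep n m \<rho>"
proof -
  have "\<exists>\<rho>. octahedral_rep n 0 \<rho>"
    by (induction n rule: int_induct[where k = 0])
      (use octahedral_rep_base octahedral_rep_raise_n octahedral_rep_lower_n in blast)+
  then show ?thesis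
    by (induction m rule: int_induct[where k = 0])
      (use octahedral_rep_raise_m octahedral_rep_lower_m in blast)+
qed


section \<open>Uniqueness of rational functions and identification with the octahedral
  functions\<close>

lemma coprime_poly_nonzero:
  fixes p q :: "real poly"
  assumes "coprime p q"
  shows "poly p u \<noteq> 0 \<or> poly q u \<noteq> 0"
proof (rule ccontr)
  assume "\<not> ?thesis"
  then have "[:- u, 1:] dvd p" "[:- u, 1:] dvd q" by (simp_all add: poly_eq_0_iff_dvd)
  then have "is_unit [:- u, 1:]" using assms coprime_common_divisor by blast
  then show False by (auto dest: is_unit_iff_degree[THEN iffD1, rotated])
qed

text \<open>Cancelling a common non-unit factor lowers the degree of the denominator. Zeros of q may
  disappear on the way, so the values are compared only where q is nonzero.\<close>

lemma rational_fun_lowest_terms: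
  fixes p q :: "real poly"
  assumes "q \<noteq> 0"
  shows "\<exists>p' q'. coprime p' q' \<and> q' \<noteq> 0 \<and>
           (\<forall>u. poly q u \<noteq> 0 \<longrightarrow> poly q' u \<noteq> 0 \<and> poly p u / poly q u = poly p' u / poly q' u)"
  using assms
proof (induction "degree q" arbitrary: p q rule: less_induct)
  case less
  show ?case
  proof (cases "coprime p q")
    case False
    then obtain d where d: "d dvd p" "d dvd q" "\<not> is_unit d"
      by (auto simp: coprime_def)
    then obtain p1 q1 where pq1: "p = d * p1" "q = d * q1" by (auto simp: dvd_def)
    have "d \<noteq> 0" "q1 \<noteq> 0" using less.prems pq1(2) by auto
    moreover have "degree d \<noteq> 0" using d(3) \<open>d \<noteq> 0\<close> by (simp add: is_unit_iff_degree)
    ultimately have "degree q1 < degree q" unfolding pq1(2) by (simp add: degree_mult_eq)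
    from less.hyps[OF this \<open>q1 \<noteq> 0\<close>, of p1] show ?thesis
      by (auto simp: pq1)
  qed (use less.prems in blast)
qed

text \<open>Agreement at infinitely many points gives p q' = p' q as polynomials. Coprimality then
  forces q and q' to have the same zeros, so that also the default values at poles coincide.\<close>

lemma rational_fun_eqI:
  assumes "rational_fun f" "rational_fun g" "\<forall>\<^sub>F u in nhds a. f u = g u"
  shows "f = g"
proof -
  obtain p q where pq: "q \<noteq> 0" "coprime p q" "\<And>u. f u = poly p u / poly q u"
    using assms(1) unfolding rational_fun_def by blast
  obtain p' q' where pq': "q' \<noteq> 0" "coprime p' q'" "\<And>u. g u = poly p' u / poly q' u"
    using assms(2) unfolding rational_fun_def by blast
  obtain S where S: "open S" "a \<in> S" "\<And>u. u \<in> S \<Longrightarrow> f u = g u"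
    using assms(3) unfolding eventually_nhds by blast
  let ?Z = "{u. poly (q * q') u = 0}"
  have "finite ?Z" by (rule poly_roots_finite) (use pq(1) pq'(1) in simp)
  moreover have "infinite S"
    using S(1,2) by (metis empty_iff finite_imp_not_open)
  ultimately have "infinite (S - ?Z)" by (rule Diff_infinite_finite)
  moreover have "S - ?Z \<subseteq> {u. poly (p * q' - p' * q) u = 0}"
  proof
    fix u assume u: "u \<in> S - ?Z"
    then have "poly q u \<noteq> 0" "poly q' u \<noteq> 0" by auto
    then show "u \<in> {u. poly (p * q' - p' * q) u = 0}"
      using S(3)[of u] u by (simp add: pq(3) pq'(3) frac_eq_eq)
  qed
  ultimately have "p * q' - p' * q = 0"
    using poly_roots_finite[of "p * q' - p' * q"] finite_subset by blast
  then have eq: "p * q' = p' * q" by simp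
  have denominator_iff: "poly q u = 0 \<longleftrightarrow> poly q' u = 0" for u
    using arg_cong[OF eq, of "\<lambda>p. poly p u"] coprime_poly_nonzero[OF pq(2), of u]
      coprime_poly_nonzero[OF pq'(2), of u] by auto
  have "f u = g u" for u
    using arg_cong[OF eq, of "\<lambda>p. poly p u"] denominator_iff[of u]
    by (cases "poly q u = 0") (simp_all add: pq(3) pq'(3) frac_eq_eq)
  then show "f = g" by blast
qed

text \<open>The description behind \<open>r_oct\<close> demands lowest terms and validity at u = 0,
  neither of which \<rho> need satisfy. Its reduced form r has both and equals \<rho> on
  \<open>regular_set\<close>.\<close>

lemma r_oct_eqI:
  assumes \<rho>: "rational_on_regular \<rho>"
    and near: "near_zero_rep (- 1/24 - real_of_int m / 2 - real_of_int n / 2) (3/4 - real_of_int m) \<rho>"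
    and u: "u \<in> regular_set"
  shows "r_oct n m u = \<rho> u"
proof -
  let ?\<alpha> = "- 1/24 - real_of_int m / 2 - real_of_int n / 2"
  let ?\<beta> = "11/24 - real_of_int m / 2 - real_of_int n / 2"
  let ?c = "3/4 - real_of_int m"
  let ?e = "- 1/12 - real_of_int m - real_of_int n"
  obtain p0 q0 where pq0: "\<And>u. u \<in> regular_set \<Longrightarrow> poly q0 u \<noteq> 0 \<and> \<rho> u = poly p0 u / poly q0 u"
    using \<rho> unfolding rational_on_regular_def by blast
  have "q0 \<noteq> 0" using pq0[OF u] by auto
  from rational_fun_lowest_terms[OF this, of p0] obtain p q where pq: "coprime p q" "q \<noteq> 0"
    "\<And>v. poly q0 v \<noteq> 0 \<Longrightarrow> poly q v \<noteq> 0 \<and> poly p0 v / poly q0 v = poly p v / poly q v"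
    by blast
  define r where "r = (\<lambda>u. poly p u / poly q u)"
  have r_rational: "rational_fun r"
    unfolding rational_fun_def using pq(1,2) by (intro exI[of _ p] exI[of _ q]) (simp add: r_def)
  have r_\<rho>: "r v = \<rho> v" and q_nz: "poly q v \<noteq> 0" if "v \<in> regular_set" for v
    using pq0[OF that] pq(3)[of v] by (auto simp: r_def)
  have arg: "?\<alpha> + 1/2 = ?\<beta>" "2 * ?\<alpha> = ?e" by simp_all
  have eq: "gauss_2F1 ?\<alpha> ?\<beta> ?c (R_oct v) = p_e v powr ?e * r v" if "v \<in> near_zero" "v \<noteq> 0" for v
    using near that r_\<rho>[OF near_zero_regular[OF that]] unfolding near_zero_rep_def arg by simp
  have zero: "0 \<in> near_zero" by (simp add: near_zero_def)
  have "r 0 = 1"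
  proof -
    have nonint: "?\<alpha> \<notin> \<int>" "?\<beta> \<notin> \<int>" "?c \<notin> \<int>"
      by (rule nonintI[of 24 _ "- 1 - 12 * m - 12 * n"], simp, presburger)
        (rule nonintI[of 24 _ "11 - 12 * m - 12 * n"], simp, presburger,
         rule nonintI[of 4 _ "3 - 4 * m"], simp, presburger)
    \<comment> \<open>Multiplying by q keeps h continuous at 0 even if r had a pole there. The limit
      gives equality of p and q at 0, and coprimality excludes that both vanish.\<close>
    define h where "h = (\<lambda>v. poly q v * gauss_2F1 ?\<alpha> ?\<beta> ?c (R_oct v) - p_e v powr ?e * poly p v)"
    have "isCont (\<lambda>v. gauss_2F1 ?\<alpha> ?\<beta> ?c (R_oct v)) 0"
      using DERIV_chain2[OF gauss_2F1_has_derivative[OF nonint near_zero_bounds(4)[OF zero]] R_oct_derivative[OF zero]]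
      by (rule DERIV_isCont)
    then have "isCont h 0"
      unfolding h_def by (intro continuous_intros DERIV_isCont[OF p_e_powr_derivative[OF zero]])
    then have "h \<midarrow>0\<rightarrow> h 0" by (simp add: isCont_def)
    moreover have "\<forall>\<^sub>F v in at 0. h v = 0"
    proof -
      have "open near_zero" by (simp add: near_zero_def)
      from eventually_at_in_open[OF this zero] show ?thesis
      proof eventually_elim
        case (elim v)
        then have v: "v \<in> near_zero" "v \<noteq> 0" by auto
        have "poly p v = poly q v * r v" using q_nz[OF near_zero_regular[OF v]] by (simp add: r_def)
        then show ?case by (simp only: h_def eq[OF v] mult.left_commute diff_self)
      qed
    qed
    then have "h \<midarrow>0\<rightarrow> 0" by (rule tendsto_eventually)
    ultimately have "h 0 = 0" by (rule LIM_unique)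
    then have pq_0: "poly q 0 = poly p 0" by (simp add: h_def R_oct_def p_v_def p_e_def)
    then have "poly q 0 \<noteq> 0" using coprime_poly_nonzero[OF pq(1), of 0] by auto
    then show ?thesis by (simp add: r_def pq_0)
  qed
  then have eq0: "gauss_2F1 ?\<alpha> ?\<beta> ?c (R_oct v) = p_e v powr ?e * r v" if "v \<in> near_zero" for v
    using eq[OF that] by (cases "v = 0") (simp_all add: R_oct_def p_v_def p_e_def)
  have nhds: "\<forall>\<^sub>F v in nhds 0. v \<in> near_zero"
    using zero by (intro eventually_nhds_in_open) (simp_all add: near_zero_def)
  have "r_oct n m = r"
    unfolding r_oct_def
  proof (rule the_equality)
    show "rational_fun r \<and> (\<forall>\<^sub>F v in nhds 0. gauss_2F1 ?\<alpha> ?\<beta> ?c (R_oct v) = p_e v powr ?e * r v)"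
      using r_rational nhds eq0 by (auto elim: eventually_mono)
  next
    fix r'
    assume r': "rational_fun r' \<and> (\<forall>\<^sub>F v in nhds 0. gauss_2F1 ?\<alpha> ?\<beta> ?c (R_oct v) = p_e v powr ?e * r' v)"
    then have "\<forall>\<^sub>F v in nhds 0. gauss_2F1 ?\<alpha> ?\<beta> ?c (R_oct v) = p_e v powr ?e * r' v" by blast
    with nhds have "\<forall>\<^sub>F v in nhds 0. r' v = r v"
    proof eventually_elim
      case (elim v)
      then show ?case using eq0[OF elim(1)] near_zero_bounds(1)[OF elim(1)] by simp
    qed
    then show "r' = r" using r' r_rational rational_fun_eqI by blast
  qed
  then show ?thesis using r_\<rho>[OF u] by simp
qed

theorem theorem3p5:
  fixes n m :: int and \<theta> :: real
  assumes "0 < \<theta>" and "\<theta> < pi"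
  shows "ferrers_P (- 1/6 + real_of_int n) (1/4 + real_of_int m) (cos \<theta>) =
           2 powi (- 2 * m - 3 * n) * inverse (Gamma (3/4 - real_of_int m)) *
           sin \<theta> powr (- 1/4 - real_of_int m) *
           B_plus \<theta> powr (1/4 + 3 * real_of_int m + 3 * real_of_int n) *
           r_oct n m (B_minus \<theta> / B_plus \<theta>)
         \<and>
         ferrers_P (- 1/6 + real_of_int n) (- 1/4 - real_of_int m) (cos \<theta>) =
           2 powi (- 2 * m - 3 * n) * 3 powr (3/4 + 3 * real_of_int m) *
           inverse (Gamma (5/4 + real_of_int m)) *
           sin \<theta> powr (- 1/4 - real_of_int m) *
           B_minus \<theta> powr (1/4 + 3 * real_of_int m + 3 * real_of_int n) *
           r_oct_hat n m (B_plus \<theta> / B_minus \<theta>)"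
proof -
  obtain \<rho> where \<rho>: "octahedral_rep n m \<rho>" using octahedral_rep_exists by blast
  have B: "B_sgn 1 \<theta> = B_plus \<theta>" "B_sgn (- 1) \<theta> = B_minus \<theta>"
    by (simp_all add: B_sgn_def B_plus_def B_minus_def)
  \<comment> \<open>Both arguments lie in \<open>regular_set\<close> for all \<theta>, including
    \<theta> = pi/2, where \<open>p_e\<close> vanishes at them.\<close>
  have "r_oct n m (u_sgn s \<theta>) = \<rho> (u_sgn s \<theta>)" if "s\<^sup>2 = 1" for s
    using \<rho> u_sgn_regular[OF that assms] unfolding octahedral_rep_def by (intro r_oct_eqI) auto
  from this[of 1] this[of "- 1"]
  have "\<rho> (u_sgn 1 \<theta>) = r_oct n m (B_minus \<theta> / B_plus \<theta>)"
    "\<rho> (u_sgn (- 1) \<theta>) = r_oct n m (B_plus \<theta> / B_minus \<theta>)"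
    by (simp_all add: u_sgn_def B)
  moreover have "- (1/4 + real_of_int m) = - 1/4 - real_of_int m" by simp
  ultimately show ?thesis
    using \<rho> assms unfolding octahedral_rep_def theta_rep_def
    by (simp add: B plus_const_def minus_const_def r_oct_hat_def)
qed

end
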